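(* Let $n \ge 1$ and let $\pi \in S_n$ be a permutation with inversion graph $G_\pi$. The following properties are equivalent: (i) $\beta(G_\pi) = 0$, equivalently, $G_\pi$ is a forest; (ii) no reduced word for $\pi$ contains a repeated letter; (iii) $\ell(\pi) = \ell'(\pi)$; (iv) $\pi \in \mathrm{Av}(321, 3412)$; (v) $\pi$ can be expressed as a direct sum of unimodal cycles of intervals; (vi) the Schubert variety $X_\pi$ is toric.
   Context: Permutations $\pi \in S_n$ act on $[n]=\{1,\dots,n\}$; the one-line notation of $\pi$ is $\pi(1)\pi(2)\cdots\pi(n)$. Products of permutations are composed from right to left. Inversion graph: $G_\pi$ is the simple graph with vertex set $[n]$ (the values of $\pi$) in which values $a<b$ are adjacent if and only if they form an inversion, i.e. $b$ appears to the left of $a$ in the one-line notation ($\pi^{-1}(b)<\pi^{-1}(a)$). Cyclomatic number: $\beta(G) = |E(G)| - |V(G)| + \kappa(G)$, where $\kappa(G)$ is the number of connected components; it is the dimension over $\mathbb{F}_2$ of the cycle space of $G$. Lengths: the simple reflections are $s_i=(i,i+1)$, $1\le i\le n-1$. The Coxeter length $\ell(\pi)$ is the minimum number of simple reflections in a product expression for $\pi$. A reduced word for $\pi$ is a sequence $i_1 i_2\cdots i_m$ with $m=\ell(\pi)$ and $\pi = s_{i_1}s_{i_2}\cdots s_{i_m}$; its letters are the indices $i_t$, and it contains a repeated letter if some letter occurs more than once. The reflection length $\ell'(\pi)$ is the minimum number of transpositions $(i,j)$ (arbitrary $i\neq j$) in a product expression for $\pi$. Patterns: $\pi$ contains $\sigma\in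 S_k$ as a pattern if some subsequence of the one-line notation of $\pi$ of length $k$ has its entries in the same relative order as $\sigma$; otherwise it avoids $\sigma$. $\mathrm{Av}(321,3412)$ is the set of permutations avoiding both $321$ and $3412$. Unimodal cycles: a unimodal cycle of an interval $[a,b]$ of integers is a permutation of $[a,b]$ that can be written as a single cycle $(c_1,\dots,c_m)$ on all of $[a,b]$ (mapping $c_i\mapsto c_{i+1}$, indices cyclic, $m=b-a+1$) whose entries, after cyclic rotation, strictly increase to a maximum and then strictly decrease. The strictly increasing or strictly decreasing part may be empty, and a fixed point (singleton interval) is allowed. Direct sums: for $\pi_1\in S_m$ and $\pi_2\in S_k$, $\pi_1\oplus\pi_2\in S_{m+k}$ has one-line notation that of $\pi_1$ followed by that of $\pi_2$ with every entry increased by $m$. Thus $\pi$ is a direct sum of unimodal cycles of intervals if $[n]$ is partitioned into intervals, each mapped to itself by $\pi$, such that the restriction of $\pi$ to each of them is a unimodal cycle of that interval. Schubert varieties: let $B\subset GL_n(\mathbb{C})$ be the subgroup of upper triangular matrices and $T$ the torus of diagonal matrices. $X_\pi$ is the Schubert variety of $\pi$ in the flag variety $GL_n(\mathbb{C})/B$, i.e. the Zariski closure of $B\pi B/B$, with $T$ acting by left multiplication. $X_\pi$ is called toric if $T$ acts on it with a dense orbit. *)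

theory Defs
  imports
    "HOL-Library.Sublist"
    "HOL-Library.Disjoint_Sets"
    "HOL-Combinatorics.Cycles"
    "HOL-Combinatorics.Orbits"
    "HOL-Analysis.Abstract_Topology"
    "HOL-Algebra.Left_Coset"
    "Jordan_Normal_Form.Matrix"
begin

text \<open>
  Elements of \<open>S\<^sub>n\<close> are functions \<open>\<pi> :: nat \<Rightarrow> nat\<close> with \<open>\<pi> permutes {1..n}\<close>, hence
  the identity outside \<open>{1..n}\<close>.
\<close>

definition one_line :: "nat \<Rightarrow> (nat \<Rightarrow> nat) \<Rightarrow> nat list" where
  "one_line n \<pi> = map \<pi> [1..<n + 1]"


section \<open>Graphs\<close>

text \<open>A simple graph is a pair of a vertex set and a set of two-element edges.\<close>

type_synonym 'a sgraph = "'a set \<times> 'a set set"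

definition conn_rel :: "'a sgraph \<Rightarrow> ('a \<times> 'a) set" where
  "conn_rel G = {(u, v). u \<in> fst G \<and> v \<in> fst G \<and> (u, v) \<in> {(x, y). {x, y} \<in> snd G}\<^sup>*}"

definition components :: "'a sgraph \<Rightarrow> 'a set set" where
  "components G = fst G // conn_rel G"

definition cyclomatic :: "'a sgraph \<Rightarrow> int" where
  "cyclomatic G = int (card (snd G)) - int (card (fst G)) + int (card (components G))"

definition graph_cycle :: "'a sgraph \<Rightarrow> 'a list \<Rightarrow> bool" where
  "graph_cycle G c \<longleftrightarrow> 3 \<le> length c \<and> distinct c \<and> set c \<subseteq> fst G \<and>
     (\<forall>i < length c. {c ! i, c ! (Suc i mod length c)} \<in> snd G)"

definition forest :: "'a sgraph \<Rightarrow> bool" where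
  "forest G \<longleftrightarrow> (\<nexists>c. graph_cycle G c)"

definition inversion_graph :: "nat \<Rightarrow> (nat \<Rightarrow> nat) \<Rightarrow> nat sgraph" where
  "inversion_graph n \<pi> =
     ({1..n}, {{a, b} | a b. a \<in> {1..n} \<and> b \<in> {1..n} \<and> a < b \<and>
                             Hilbert_Choice.inv \<pi> b < Hilbert_Choice.inv \<pi> a})"


section \<open>Words and lengths\<close>

definition simple_word_perm :: "nat list \<Rightarrow> nat \<Rightarrow> nat" where
  "simple_word_perm ws = foldr (\<lambda>i \<sigma>. transpose i (i + 1) \<circ> \<sigma>) ws id"

definition simple_word :: "nat \<Rightarrow> (nat \<Rightarrow> nat) \<Rightarrow> nat list \<Rightarrow> bool" where
  "simple_word n \<pi> ws \<longleftrightarrow> set ws \<subseteq> {1..<n} \<and> simple_word_perm ws = \<pi>"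

definition coxeter_length :: "nat \<Rightarrow> (nat \<Rightarrow> nat) \<Rightarrow> nat" where
  "coxeter_length n \<pi> = (LEAST m. \<exists>ws. simple_word n \<pi> ws \<and> length ws = m)"

definition reduced_word :: "nat \<Rightarrow> (nat \<Rightarrow> nat) \<Rightarrow> nat list \<Rightarrow> bool" where
  "reduced_word n \<pi> ws \<longleftrightarrow> simple_word n \<pi> ws \<and> length ws = coxeter_length n \<pi>"

definition has_repeated_letter :: "nat list \<Rightarrow> bool" where
  "has_repeated_letter ws \<longleftrightarrow> (\<exists>i. count_list ws i > 1)"

definition transp_word :: "nat \<Rightarrow> (nat \<Rightarrow> nat) \<Rightarrow> (nat \<times> nat) list \<Rightarrow> bool" where
  "transp_word n \<pi> ts \<longleftrightarrow>
     set ts \<subseteq> {(i, j). i \<in> {1..n} \<and> j \<in> {1..n} \<and> i \<noteq> j} \<and>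
     foldr (\<lambda>(i, j) \<sigma>. transpose i j \<circ> \<sigma>) ts id = \<pi>"

definition reflection_length :: "nat \<Rightarrow> (nat \<Rightarrow> nat) \<Rightarrow> nat" where
  "reflection_length n \<pi> = (LEAST m. \<exists>ts. transp_word n \<pi> ts \<and> length ts = m)"


section \<open>Pattern avoidance\<close>

definition same_relative_order :: "nat list \<Rightarrow> nat list \<Rightarrow> bool" where
  "same_relative_order xs ys \<longleftrightarrow> length xs = length ys \<and>
     (\<forall>i < length xs. \<forall>j < length xs. xs ! i < xs ! j \<longleftrightarrow> ys ! i < ys ! j)"

text \<open>Patterns are given by their one-line notation.\<close>

definition contains_pattern :: "nat \<Rightarrow> (nat \<Rightarrow> nat) \<Rightarrow> nat list \<Rightarrow> bool" where
  "contains_pattern n \<pi> \<sigma> \<longleftrightarrow> (\<exists>xs. subseq xs (one_line n \<pi>) \<and> same_relative_order xs \<sigma>)"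

definition Av :: "nat \<Rightarrow> nat list set \<Rightarrow> (nat \<Rightarrow> nat) set" where
  "Av n \<Sigma> = {\<pi>. \<pi> permutes {1..n} \<and> (\<forall>\<sigma>\<in>\<Sigma>. \<not> contains_pattern n \<pi> \<sigma>)}"


section \<open>Direct sums of unimodal cycles\<close>

text \<open>The entry at position \<open>j\<close> is the peak and belongs to both monotone parts.\<close>

definition unimodal :: "nat list \<Rightarrow> bool" where
  "unimodal cs \<longleftrightarrow>
     (\<exists>j < length cs. sorted_wrt (<) (take (Suc j) cs) \<and> sorted_wrt (>) (drop j cs))"

definition unimodal_cycle :: "nat \<Rightarrow> nat \<Rightarrow> (nat \<Rightarrow> nat) \<Rightarrow> bool" where
  "unimodal_cycle a b \<sigma> \<longleftrightarrow>
     (\<exists>cs. distinct cs \<and> set cs = {a..b} \<and> cycle_of_list cs = \<sigma> \<and> (\<exists>k. unimodal (rotate k cs)))"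

definition direct_sum_of_unimodal_cycles :: "nat \<Rightarrow> (nat \<Rightarrow> nat) \<Rightarrow> bool" where
  "direct_sum_of_unimodal_cycles n \<pi> \<longleftrightarrow>
     (\<exists>P. partition_on {1..n} P \<and>
       (\<forall>I\<in>P. \<exists>a b. a \<le> b \<and> I = {a..b} \<and> \<pi> ` I = I \<and> unimodal_cycle a b (perm_restrict \<pi> I)))"


section \<open>Schubert varieties\<close>

abbreviation GL :: "nat \<Rightarrow> complex mat monoid" where
  "GL n \<equiv> units_of (ring_mat TYPE(complex) n ())"

definition borel_subgroup :: "nat \<Rightarrow> complex mat set" where
  "borel_subgroup n = {g \<in> carrier (GL n). upper_triangular g}"

definition torus :: "nat \<Rightarrow> complex mat set" where
  "torus n = {g \<in> carrier (GL n). diagonal_mat g}"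

text \<open>The matrix sending \<open>e\<^sub>j\<close> to \<open>e\<^bsub>\<pi>(j)\<^esub>\<close>; matrix indices start at 0.\<close>

definition perm_matrix :: "nat \<Rightarrow> (nat \<Rightarrow> nat) \<Rightarrow> complex mat" where
  "perm_matrix n \<pi> = mat n n (\<lambda>(i, j). if i + 1 = \<pi> (j + 1) then 1 else 0)"

inductive_set poly_functions :: "nat \<Rightarrow> (complex mat \<Rightarrow> complex) set" for n where
  const: "(\<lambda>_. c) \<in> poly_functions n"
| entry: "i < n \<Longrightarrow> j < n \<Longrightarrow> (\<lambda>A. A $$ (i, j)) \<in> poly_functions n"
| add: "f \<in> poly_functions n \<Longrightarrow> g \<in> poly_functions n \<Longrightarrow> (\<lambda>A. f A + g A) \<in> poly_functions n"
| mult: "f \<in> poly_functions n \<Longrightarrow> g \<in> poly_functions n \<Longrightarrow> (\<lambda>A. f A * g A) \<in> poly_functions n"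

text \<open>
  Regular functions on \<open>GL\<^sub>n\<close> are polynomials in the entries divided by powers of the
  determinant, so polynomials in the entries already cut out all Zariski closed subsets.
\<close>

definition zariski_open :: "nat \<Rightarrow> complex mat set \<Rightarrow> bool" where
  "zariski_open n U \<longleftrightarrow>
     (\<exists>F \<subseteq> poly_functions n. U = {g \<in> carrier (GL n). \<exists>f\<in>F. f g \<noteq> 0})"

definition zariski_GL :: "nat \<Rightarrow> complex mat topology" where
  "zariski_GL n = topology (zariski_open n)"

lemma istopology_zariski_open: "istopology (zariski_open n)"
  unfolding istopology_def
proof (intro conjI allI impI)
  fix S T assume "zariski_open n S" "zariski_open n T"
  then obtain F G where F: "F \<subseteq> poly_functions n" "S = {g \<in> carrier (GL n). \<exists>f\<in>F. f g \<noteq> 0}"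
    and G: "G \<subseteq> poly_functions n" "T = {g \<in> carrier (GL n). \<exists>f\<in>G. f g \<noteq> 0}"
    unfolding zariski_open_def by blast
  define H where "H = (\<lambda>(f, g) A. f A * g A) ` (F \<times> G)"
  have H: "H \<subseteq> poly_functions n"
    using F(1) G(1) unfolding H_def by (auto intro: poly_functions.mult)
  have "(\<exists>h\<in>H. h A \<noteq> 0) \<longleftrightarrow> (\<exists>f\<in>F. f A \<noteq> 0) \<and> (\<exists>g\<in>G. g A \<noteq> 0)" for A
    unfolding H_def by simp
  then have "S \<inter> T = {A \<in> carrier (GL n). \<exists>h\<in>H. h A \<noteq> 0}"
    unfolding F(2) G(2) by auto
  with H show "zariski_open n (S \<inter> T)"
    unfolding zariski_open_def by (intro exI[of _ H] conjI)
next
  fix \<K> assume "\<forall>K\<in>\<K>. zariski_open n K"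
  then have "\<forall>K\<in>\<K>. \<exists>F. F \<subseteq> poly_functions n \<and> K = {g \<in> carrier (GL n). \<exists>f\<in>F. f g \<noteq> 0}"
    unfolding zariski_open_def .
  from bchoice[OF this] obtain F where F: "\<forall>K\<in>\<K>. F K \<subseteq> poly_functions n \<and>
      K = {g \<in> carrier (GL n). \<exists>f\<in>F K. f g \<noteq> 0}" ..
  have sub: "(\<Union>K\<in>\<K>. F K) \<subseteq> poly_functions n"
    using F by (intro UN_least) simp
  have mem: "A \<in> K \<longleftrightarrow> A \<in> carrier (GL n) \<and> (\<exists>f\<in>F K. f A \<noteq> 0)" if "K \<in> \<K>" for A K
    by (subst conjunct2[OF F[rule_format, OF that]]) simp
  have "\<Union>\<K> = {A \<in> carrier (GL n). \<exists>f\<in>(\<Union>K\<in>\<K>. F K). f A \<noteq> 0}"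
  proof (rule Set.set_eqI)
    fix A
    have "A \<in> \<Union>\<K> \<longleftrightarrow> (\<exists>K\<in>\<K>. A \<in> carrier (GL n) \<and> (\<exists>f\<in>F K. f A \<noteq> 0))"
      unfolding Union_iff by (intro bex_cong refl mem)
    then show "A \<in> \<Union>\<K> \<longleftrightarrow> A \<in> {A \<in> carrier (GL n). \<exists>f\<in>(\<Union>K\<in>\<K>. F K). f A \<noteq> 0}"
      by simp
  qed
  with sub show "zariski_open n (\<Union>\<K>)"
    unfolding zariski_open_def by (intro exI[of _ "\<Union>K\<in>\<K>. F K"] conjI)
qed

lemma openin_zariski_GL: "openin (zariski_GL n) = zariski_open n"
  by (simp add: zariski_GL_def istopology_zariski_open)

lemma topspace_zariski_GL [simp]: "topspace (zariski_GL n) = carrier (GL n)"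
proof -
  have "zariski_open n (carrier (GL n))"
    unfolding zariski_open_def
    by (rule exI[of _ "{\<lambda>_. 1}"]) (auto intro: poly_functions.const)
  moreover have "U \<subseteq> carrier (GL n)" if "zariski_open n U" for U
    using that unfolding zariski_open_def by blast
  ultimately show ?thesis
    unfolding topspace_def openin_zariski_GL by blast
qed

text \<open>
  The points of the flag variety \<open>GL\<^sub>n/B\<close> are the left cosets of \<open>B\<close>. Its Zariski topology is the
  quotient topology of \<open>GL\<^sub>n\<close>, since the projection to \<open>GL\<^sub>n/B\<close> is an open morphism.
\<close>

definition flags :: "nat \<Rightarrow> complex mat set set" where
  "flags n = lcosets\<^bsub>GL n\<^esub> (borel_subgroup n)"

definition flag_topology :: "nat \<Rightarrow> complex mat set topology" where
  "flag_topology n = topology (\<lambda>U. U \<subseteq> flags n \<and>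
     openin (zariski_GL n) {g \<in> carrier (GL n). g <#\<^bsub>GL n\<^esub> borel_subgroup n \<in> U})"

lemma openin_flag_topology:
  "openin (flag_topology n) U \<longleftrightarrow> U \<subseteq> flags n \<and>
     openin (zariski_GL n) {g \<in> carrier (GL n). g <#\<^bsub>GL n\<^esub> borel_subgroup n \<in> U}"
proof -
  let ?p = "\<lambda>g. g <#\<^bsub>GL n\<^esub> borel_subgroup n"
  let ?open = "\<lambda>U. U \<subseteq> flags n \<and> openin (zariski_GL n) {g \<in> carrier (GL n). ?p g \<in> U}"
  have "istopology ?open"
    unfolding istopology_def
  proof (rule conjI; intro allI impI)
    fix S T assume S: "?open S" and T: "?open T"
    have "{g \<in> carrier (GL n). ?p g \<in> S \<inter> T} =
        {g \<in> carrier (GL n). ?p g \<in> S} \<inter> {g \<in> carrier (GL n). ?p g \<in> T}"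
      by blast
    moreover have "openin (zariski_GL n) \<dots>"
      using S T by (intro openin_Int) auto
    ultimately show "?open (S \<inter> T)"
      using S by auto
  next
    fix \<K> assume \<K>: "\<forall>K\<in>\<K>. ?open K"
    have "{g \<in> carrier (GL n). ?p g \<in> \<Union>\<K>} = (\<Union>K\<in>\<K>. {g \<in> carrier (GL n). ?p g \<in> K})"
      by blast
    moreover have "openin (zariski_GL n) \<dots>"
      using \<K> by (intro openin_Union) auto
    ultimately show "?open (\<Union>\<K>)"
      using \<K> by auto
  qed
  then show ?thesis
    by (simp add: flag_topology_def)
qed

lemma quotient_map_flag_topology:
  "quotient_map (zariski_GL n) (flag_topology n) (\<lambda>g. g <#\<^bsub>GL n\<^esub> borel_subgroup n)"
proof -
  let ?p = "\<lambda>g. g <#\<^bsub>GL n\<^esub> borel_subgroup n"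
  have im: "?p ` carrier (GL n) = flags n"
    unfolding flags_def LCOSETS_def by blast
  have "openin (zariski_GL n) (topspace (zariski_GL n))"
    by (rule openin_topspace)
  moreover have "{g \<in> carrier (GL n). ?p g \<in> flags n} = carrier (GL n)"
    using im by blast
  ultimately have "openin (flag_topology n) (flags n)"
    unfolding openin_flag_topology by simp
  then have "topspace (flag_topology n) = flags n"
    unfolding topspace_def using openin_flag_topology by blast
  then show ?thesis
    unfolding quotient_map_def by (simp add: im openin_flag_topology)
qed

definition schubert_cell :: "nat \<Rightarrow> (nat \<Rightarrow> nat) \<Rightarrow> complex mat set set" where
  "schubert_cell n \<pi> =
     (\<lambda>b. b <#\<^bsub>GL n\<^esub> (perm_matrix n \<pi> <#\<^bsub>GL n\<^esub> borel_subgroup n)) ` borel_subgroup n"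

definition schubert_variety :: "nat \<Rightarrow> (nat \<Rightarrow> nat) \<Rightarrow> complex mat set set" where
  "schubert_variety n \<pi> = Abstract_Topology.closure_of (flag_topology n) (schubert_cell n \<pi>)"

definition torus_orbit :: "nat \<Rightarrow> complex mat set \<Rightarrow> complex mat set set" where
  "torus_orbit n x = (\<lambda>t. t <#\<^bsub>GL n\<^esub> x) ` torus n"

definition toric :: "nat \<Rightarrow> complex mat set set \<Rightarrow> bool" where
  "toric n X \<longleftrightarrow>
     (\<exists>x\<in>X. Abstract_Topology.closure_of (subtopology (flag_topology n) X) (torus_orbit n x) = X)"

end

theory Submission
  imports Defs "Jordan_Normal_Form.Determinant" "HOL-Library.Transitive_Closure_Table"
begin

text \<open>
  Everything is compared with the set of \<open>i < n\<close> for which \<open>\<pi>\<close> does not preserve the prefix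
  \<open>{1..i}\<close> (\<open>moved_prefixes\<close>). Let \<open>d\<close> be its size. The components of \<open>G\<^sub>\<pi>\<close> are the intervals
  between consecutive preserved prefixes, so there are \<open>n - d\<close> of them, and \<open>G\<^sub>\<pi>\<close> has
  \<open>\<ell>(\<pi>)\<close> edges. Hence \<open>\<beta>(G\<^sub>\<pi>) = \<ell>(\<pi>) - d\<close> (\<open>cyclomatic_inversion_graph\<close>).

  Words: the moved prefixes are letters of every word for \<open>\<pi>\<close>, and a letter that is used exactly once
  is a moved prefix. So \<open>\<ell>(\<pi>) = d\<close> holds iff some, equivalently every, reduced word has distinct
  letters.

  Reflections: always \<open>\<ell>'(\<pi>) \<le> d \<le> \<ell>(\<pi>)\<close>, which turns \<open>\<ell> = \<ell>'\<close> into \<open>\<beta> = 0\<close>. Conversely, a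
  function that is invariant under a product of distinct simple reflections is invariant under each of
  them. Applied to the components of the graph formed by the transpositions of any factorization, this
  shows that there are at most \<open>n - \<ell>(\<pi>)\<close> such components, hence at least \<open>\<ell>(\<pi>)\<close> transpositions.

  Patterns: 321 and 3412 are a triangle and a 4-cycle of \<open>G\<^sub>\<pi>\<close>; conversely the maximal vertex of a
  cycle, its two neighbours and one further vertex already show one of the two patterns
  (\<open>forest_iff_Av\<close>).

  Unimodal cycles: in a word with distinct letters the largest letter \<open>s\<^sub>n\<close> can be moved to one end,
  and multiplication by it inserts \<open>n + 1\<close> next to the maximum \<open>n\<close> of a unimodal cycle. In the other
  direction the increasing and the decreasing part of each cycle force the inequalities of
  \<open>interleaving\<close>, which exclude both patterns.

  Schubert varieties: the cell of \<open>\<pi>\<close> is an affine space with one coordinate \<open>v\<^sub>a\<^sub>b\<close> for every edge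
  \<open>a < b\<close> of \<open>G\<^sub>\<pi>\<close>, on which the torus acts by \<open>t\<^sub>a / t\<^sub>b\<close>. If \<open>G\<^sub>\<pi>\<close> is a forest, these ratios can be
  prescribed freely, and the orbit of the point with all coordinates 1 is the dense set where no
  coordinate vanishes (\<open>forest_imp_toric\<close>). A cycle gives instead a nonconstant invariant rational
  function, the product of the coordinates along the cycle with exponents \<open>1\<close> or \<open>-1\<close> according to
  direction. The coordinates are ratios of minors of the whole matrix, so this function makes sense on
  the whole flag variety and excludes every point of the closure of the cell, not only those of the cell,
  from having a dense orbit (\<open>toric_imp_forest\<close>).
\<close>

section \<open>Finite graphs: adding one edge, and forests\<close>

definition reach :: "'a set set \<Rightarrow> ('a \<times> 'a) set" where
  "reach E = {(x, y). {x, y} \<in> E}\<^sup>*"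

lemma conn_rel_eq: "conn_rel (V, E) = reach E \<inter> V \<times> V"
  by (auto simp: conn_rel_def reach_def)

lemma reach_refl [simp]: "(x, x) \<in> reach E"
  by (simp add: reach_def)

lemma reach_edge: "{x, y} \<in> E \<Longrightarrow> (x, y) \<in> reach E"
  by (auto simp: reach_def)

lemma reach_trans: "(x, y) \<in> reach E \<Longrightarrow> (y, z) \<in> reach E \<Longrightarrow> (x, z) \<in> reach E"
  by (simp add: reach_def)

lemma reach_sym: "(x, y) \<in> reach E \<Longrightarrow> (y, x) \<in> reach E"
proof -
  have "sym {(x, y). {x, y} \<in> E}" by (auto simp: sym_def insert_commute)
  then have "sym (reach E)" unfolding reach_def by (rule sym_rtrancl)
  then show "(x, y) \<in> reach E \<Longrightarrow> (y, x) \<in> reach E" by (rule symD)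
qed

lemma reach_insert:
  "(x, y) \<in> reach (insert {a, b} E) \<longleftrightarrow> (x, y) \<in> reach E
     \<or> (x, a) \<in> reach E \<and> (b, y) \<in> reach E \<or> (x, b) \<in> reach E \<and> (a, y) \<in> reach E"
proof -
  have "{(x, y). {x, y} \<in> insert {a, b} E} = insert (a, b) (insert (b, a) {(x, y). {x, y} \<in> E})"
    by (auto simp: doubleton_eq_iff insert_commute)
  then have "reach (insert {a, b} E) = (insert (a, b) (insert (b, a) {(x, y). {x, y} \<in> E}))\<^sup>*"
    by (simp add: reach_def)
  then show ?thesis
    unfolding rtrancl_insert reach_def[symmetric]
    by (auto intro: reach_trans reach_sym)
qed

lemma reach_invariant:
  assumes "(x, y) \<in> reach E" and "\<And>a b. {a, b} \<in> E \<Longrightarrow> f a = f b"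
  shows "f x = f y"
  using assms(1) unfolding reach_def
  by (induction rule: rtrancl_induct) (auto dest: assms(2))

lemma components_eq: "components (V, E) = (\<lambda>x. conn_rel (V, E) `` {x}) ` V"
  by (auto simp: components_def quotient_def)

lemma conn_rel_Image: "x \<in> V \<Longrightarrow> conn_rel (V, E) `` {x} = {y \<in> V. (x, y) \<in> reach E}"
  by (auto simp: conn_rel_eq)

lemma components_image:
  "components (V, E) = (\<lambda>x. {y \<in> V. (x, y) \<in> reach E}) ` V"
  unfolding components_eq by (intro image_cong refl conn_rel_Image)

lemma card_image_same_kernel:
  assumes "\<And>x y. x \<in> A \<Longrightarrow> y \<in> A \<Longrightarrow> f x = f y \<longleftrightarrow> g x = g y"
  shows "card (f ` A) = card (g ` A)"
proof -
  define h where "h X = g (inv_into A f X)" for X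
  have h: "h (f x) = g x" if "x \<in> A" for x
    unfolding h_def using that assms by (metis f_inv_into_f imageI inv_into_into)
  then have "inj_on h (f ` A)" by (auto intro!: inj_onI simp: assms)
  moreover have "h ` f ` A = g ` A" using h by force
  ultimately show ?thesis by (metis card_image)
qed

lemma components_eq_iff:
  assumes "x \<in> V" "y \<in> V"
  shows "{z \<in> V. (x, z) \<in> reach E} = {z \<in> V. (y, z) \<in> reach E} \<longleftrightarrow> (x, y) \<in> reach E"
  using assms by (auto intro: reach_sym reach_trans)

lemma components_insert_same:
  assumes "(a, b) \<in> reach E"
  shows "components (V, insert {a, b} E) = components (V, E)"
proof -
  have "reach (insert {a, b} E) = reach E"
    using assms reach_sym[OF assms] by (auto simp: reach_insert) (meson reach_trans)+
  then show ?thesis by (simp add: components_image)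
qed

lemma card_components_insert_new:
  assumes "finite V" and "a \<in> V" "b \<in> V" and new: "(a, b) \<notin> reach E"
  shows "card (components (V, E)) = Suc (card (components (V, insert {a, b} E)))"
proof -
  define C where "C x = {y \<in> V. (x, y) \<in> reach E}" for x
  define C' where "C' x = {y \<in> V. (x, y) \<in> reach (insert {a, b} E)}" for x
  have Ceq: "C x = C y \<longleftrightarrow> (x, y) \<in> reach E" if "x \<in> V" "y \<in> V" for x y
    unfolding C_def by (rule components_eq_iff[OF that])
  have C'eq: "C' x = C' y \<longleftrightarrow> (x, y) \<in> reach (insert {a, b} E)" if "x \<in> V" "y \<in> V" for x y
    unfolding C'_def by (rule components_eq_iff[OF that])
  define W where "W = {x \<in> V. (x, b) \<notin> reach E}"
  \<comment> \<open>Sending the old component of \<open>x\<close> to the new one is a bijection once the old component of \<open>b\<close> is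
    discarded.\<close>
  have "C ` V = insert (C b) (C ` W)"
  proof -
    have "C x \<in> insert (C b) (C ` W)" if "x \<in> V" for x
      using that assms(3) by (cases "x \<in> W") (auto simp: W_def Ceq)
    then show ?thesis using assms(3) by (auto simp: W_def)
  qed
  moreover have "C b \<notin> C ` W"
    using assms(3) unfolding W_def by (auto simp: Ceq dest: reach_sym)
  moreover have "finite (C ` W)" using assms(1) by (simp add: W_def)
  ultimately have 1: "card (C ` V) = Suc (card (C ` W))" by simp
  have aW: "a \<in> W" using assms(2) new by (simp add: W_def)
  have "C' ` V = C' ` W"
  proof -
    have "C' x \<in> C' ` W" if "x \<in> V" for x
    proof (cases "x \<in> W")
      case False
      then have "C' x = C' a"
        using that assms(2) by (subst C'eq) (auto simp: W_def reach_insert)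
      then show ?thesis using aW by blast
    qed blast
    then show ?thesis by (auto simp: W_def)
  qed
  moreover have "card (C' ` W) = card (C ` W)"
  proof (rule card_image_same_kernel)
    fix x y assume "x \<in> W" "y \<in> W"
    then show "C' x = C' y \<longleftrightarrow> C x = C y"
      using new unfolding W_def by (auto simp: Ceq C'eq reach_insert dest: reach_sym reach_trans)
  qed
  ultimately show ?thesis
    using 1 by (simp add: components_image C_def C'_def)
qed

definition simple_graph :: "'a sgraph \<Rightarrow> bool" where
  "simple_graph G \<longleftrightarrow> finite (fst G) \<and>
     (\<forall>e\<in>snd G. \<exists>a b. a \<in> fst G \<and> b \<in> fst G \<and> a \<noteq> b \<and> e = {a, b})"

lemma simple_graph_finite_edges: "simple_graph (V, E) \<Longrightarrow> finite E"
proof -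
  assume "simple_graph (V, E)"
  then have "E \<subseteq> Pow V" "finite V" by (auto simp: simple_graph_def)
  then show "finite E" by (meson finite_Pow_iff finite_subset)
qed

lemma simple_graph_insert:
  "simple_graph (V, insert e E) \<longleftrightarrow> simple_graph (V, E) \<and> (\<exists>a b. a \<in> V \<and> b \<in> V \<and> a \<noteq> b \<and> e = {a, b})"
  by (auto simp: simple_graph_def)

text \<open>
  An edge inside a component closes a new cycle; an edge between two components merges them.
\<close>

lemma cyclomatic_insert:
  assumes "simple_graph (V, insert {a, b} E)" and "{a, b} \<notin> E"
  shows "cyclomatic (V, insert {a, b} E) = cyclomatic (V, E) + of_bool ((a, b) \<in> reach E)"
proof -
  have "finite V" "a \<in> V" "b \<in> V" "finite E"
    using assms(1) simple_graph_finite_edges[OF assms(1)] by (auto simp: simple_graph_insert simple_graph_def doubleton_eq_iff)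
  then show ?thesis
    using assms(2) card_components_insert_new[of V a b E] components_insert_same[of a b E V]
    by (auto simp: cyclomatic_def)
qed

lemma cyclomatic_empty: "cyclomatic (V, {}) = 0" if "finite V"
proof -
  have "components (V, {}) = (\<lambda>x. {x}) ` V"
    unfolding components_image by (intro image_cong) (auto simp: reach_def)
  then show ?thesis by (simp add: cyclomatic_def card_image)
qed

lemma cyclomatic_nonneg: "simple_graph (V, E) \<Longrightarrow> cyclomatic (V, E) \<ge> 0"
proof -
  assume wf: "simple_graph (V, E)"
  then have "finite E" by (rule simple_graph_finite_edges)
  then show "cyclomatic (V, E) \<ge> 0" using wf
  proof (induction E)
    case empty
    then show ?case by (simp add: cyclomatic_empty simple_graph_def)
  next
    case (insert e E)
    then obtain a b where "e = {a, b}" by (auto simp: simple_graph_insert)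
    then show ?case
      using insert cyclomatic_insert[of V a b E] by (auto simp: simple_graph_insert)
  qed
qed

lemma rtrancl_path_consecutive:
  assumes "rtrancl_path r x xs y" "i < length xs"
  shows "r ((x # xs) ! i) (xs ! i)"
  using assms by (induction arbitrary: i rule: rtrancl_path.induct) (auto simp: nth_Cons split: nat.splits)

lemma rtrancl_path_last: "rtrancl_path r x xs y \<Longrightarrow> last (x # xs) = y"
  by (induction rule: rtrancl_path.induct) auto

text \<open>
  A path from \<open>a\<close> to \<open>b\<close> without repeated vertices, closed up by the new edge. It has length at least 2
  because the edge itself is missing from \<open>E\<close>.
\<close>

lemma reach_closes_cycle:
  assumes wf: "simple_graph (V, insert {a, b} E)" and "(a, b) \<in> reach E" and "a \<noteq> b" "{a, b} \<notin> E"
  shows "\<exists>c. graph_cycle (V, insert {a, b} E) c"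
proof -
  let ?r = "\<lambda>x y. {x, y} \<in> E"
  have "?r\<^sup>*\<^sup>* a b"
    using assms(2) by (simp add: reach_def rtrancl_def)
  then obtain xs0 where "rtrancl_path ?r a xs0 b"
    by (auto simp: rtranclp_eq_rtrancl_path)
  then obtain xs where xs: "rtrancl_path ?r a xs b" "distinct (a # xs)"
    by (rule rtrancl_path_distinct)
  let ?c = "a # xs"
  have last: "last ?c = b" using rtrancl_path_last[OF xs(1)] .
  have ne: "xs \<noteq> []" using last assms(3) by auto
  have "length xs \<noteq> 1"
  proof
    assume "length xs = 1"
    then have "xs = [b]" using last by (cases xs) auto
    then show False using rtrancl_path_consecutive[OF xs(1), of 0] assms(4) by simp
  qed
  then have len: "3 \<le> length ?c" using ne by (cases xs rule: remdups_adj.cases) auto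
  have edge: "{?c ! i, ?c ! (Suc i mod length ?c)} \<in> insert {a, b} E" if "i < length ?c" for i
  proof (cases "i < length xs")
    case True
    then show ?thesis using rtrancl_path_consecutive[OF xs(1) True] by simp
  next
    case False
    then have i: "i = length xs" using that by simp
    then have "?c ! i = b" using last ne by (simp add: last_conv_nth)
    then show ?thesis using i by (simp add: insert_commute)
  qed
  have "e \<subseteq> V" if "e \<in> insert {a, b} E" for e
    using wf that unfolding simple_graph_def by fastforce
  then have "?c ! i \<in> V" if "i < length ?c" for i
    using edge[OF that] by blast
  then have "set ?c \<subseteq> V" by (metis in_set_conv_nth subsetI)
  with len xs(2) edge show ?thesis
    unfolding graph_cycle_def by (intro exI[of _ ?c]) auto
qed

lemma graph_cycle_mono: "graph_cycle (V, E) c \<Longrightarrow> E \<subseteq> F \<Longrightarrow> graph_cycle (V, F) c"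
  unfolding graph_cycle_def by auto

text \<open>
  Forests are built edge by edge, each new edge joining two different components.
\<close>

lemma forest_induct [consumes 2, case_names empty insert]:
  assumes "simple_graph (V, E)" and "forest (V, E)"
    and "P {}"
    and "\<And>a b E. simple_graph (V, insert {a, b} E) \<Longrightarrow> a \<in> V \<Longrightarrow> b \<in> V \<Longrightarrow> a \<noteq> b \<Longrightarrow> {a, b} \<notin> E \<Longrightarrow>
        (a, b) \<notin> reach E \<Longrightarrow> P E \<Longrightarrow> P (insert {a, b} E)"
  shows "P E"
proof -
  have "finite E" using assms(1) by (rule simple_graph_finite_edges)
  then show ?thesis using assms(1,2)
  proof (induction E)
    case empty
    show ?case by (rule assms(3))
  next
    case (insert e E)
    from insert.prems(1) obtain a b where e: "e = {a, b}" "a \<in> V" "b \<in> V" "a \<noteq> b"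
      by (auto simp: simple_graph_insert)
    have "forest (V, E)"
      using insert.prems(2) graph_cycle_mono[of V E _ "insert e E"] unfolding forest_def by blast
    then have "P E" using insert.IH insert.prems(1) by (simp add: simple_graph_insert)
    moreover have "(a, b) \<notin> reach E"
      using reach_closes_cycle[of V a b E] insert e unfolding forest_def by blast
    ultimately show ?case
      using assms(4)[of a b E] insert e by simp
  qed
qed

lemma graph_cycle_reach_without_edge:
  assumes "graph_cycle (V, E) c"
  shows "(c ! 0, c ! (length c - 1)) \<in> reach (E - {{c ! 0, c ! (length c - 1)}})"
proof -
  let ?e = "{c ! 0, c ! (length c - 1)}"
  have len: "3 \<le> length c" and d: "distinct c"
    and edge: "\<And>i. i < length c \<Longrightarrow> {c ! i, c ! (Suc i mod length c)} \<in> E"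
    using assms by (auto simp: graph_cycle_def)
  have "(c ! 0, c ! i) \<in> reach (E - {?e})" if "i < length c" for i
    using that
  proof (induction i)
    case (Suc i)
    have "{c ! i, c ! Suc i} \<noteq> ?e"
    proof
      assume "{c ! i, c ! Suc i} = ?e"
      then have "c ! i = c ! 0 \<and> c ! Suc i = c ! (length c - 1) \<or> c ! Suc i = c ! 0"
        by (auto simp: doubleton_eq_iff)
      then have "i = 0 \<and> Suc i = length c - 1 \<or> Suc i = 0"
        using Suc.prems len nth_eq_iff_index_eq[OF d, of i 0] nth_eq_iff_index_eq[OF d, of "Suc i" 0]
          nth_eq_iff_index_eq[OF d, of "Suc i" "length c - 1"] by fastforce
      then show False using len by auto
    qed
    then have "{c ! i, c ! Suc i} \<in> E - {?e}"
      using edge[of i] Suc.prems by auto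
    then show ?case using Suc by (meson Suc_lessD reach_edge reach_trans)
  qed simp
  then show ?thesis using len by simp
qed

lemma cyclomatic_zero_iff_forest:
  assumes "simple_graph (V, E)"
  shows "cyclomatic (V, E) = 0 \<longleftrightarrow> forest (V, E)"
proof
  assume zero: "cyclomatic (V, E) = 0"
  show "forest (V, E)"
    unfolding forest_def
  proof
    assume "\<exists>c. graph_cycle (V, E) c"
    then obtain c where c: "graph_cycle (V, E) c" ..
    define a b where "a = c ! 0" and "b = c ! (length c - 1)"
    let ?F = "E - {{a, b}}"
    from c have len: "3 \<le> length c" by (simp add: graph_cycle_def)
    then have "Suc (length c - 1) mod length c = 0" by (cases c) auto
    then have "{b, a} \<in> E"
      using c len unfolding graph_cycle_def a_def b_def by (auto dest!: spec[of _ "length c - 1"])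
    then have E: "E = insert {a, b} ?F" by (auto simp: insert_commute)
    have "(a, b) \<in> reach ?F"
      using graph_cycle_reach_without_edge[OF c] by (simp add: a_def b_def)
    then have "cyclomatic (V, E) = cyclomatic (V, ?F) + 1"
      using cyclomatic_insert[of V a b ?F] assms E by simp
    moreover have "simple_graph (V, ?F)" using assms E simple_graph_insert by metis
    ultimately show False using zero cyclomatic_nonneg[of V ?F] by simp
  qed
next
  assume "forest (V, E)"
  with assms show "cyclomatic (V, E) = 0"
  proof (induction rule: forest_induct)
    case empty
    show ?case using assms by (simp add: cyclomatic_empty simple_graph_def)
  next
    case (insert a b E)
    then show ?case using cyclomatic_insert[of V a b E] by simp
  qed
qed

text \<open>
  Prescribed ratios \<open>t a / t b\<close> along the edges of a forest can always be realized: when an edge joins two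
  components, rescaling one of them adjusts the ratio on the new edge without changing the others. The
  lemma provides the torus elements that connect two points of a Schubert cell without zero coordinates.
\<close>

lemma forest_potential:
  fixes w :: "'a \<Rightarrow> 'a \<Rightarrow> 'b::field"
  assumes "simple_graph (V, E)" "forest (V, E)"
    and "\<And>a b. {a, b} \<in> E \<Longrightarrow> w a b \<noteq> 0 \<and> w a b * w b a = 1"
  shows "\<exists>t. (\<forall>a. t a \<noteq> 0) \<and> (\<forall>a b. {a, b} \<in> E \<longrightarrow> t a = w a b * t b)"
  using assms
proof (induction rule: forest_induct)
  case empty
  show ?case by (auto intro: exI[of _ "\<lambda>_. 1"])
next
  case (insert a b E)
  then obtain t where t: "\<And>x. t x \<noteq> 0" "\<And>x y. {x, y} \<in> E \<Longrightarrow> t x = w x y * t y"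
    by auto
  define s where "s x = (if (a, x) \<in> reach E then w a b * t b / t a * t x else t x)" for x
  have wab: "w a b \<noteq> 0" "w a b * w b a = 1" using insert.prems[of a b] by auto
  have "s x \<noteq> 0" for x using t(1) wab by (simp add: s_def)
  moreover have "s x = w x y * s y" if "{x, y} \<in> insert {a, b} E" for x y
  proof (cases "{x, y} \<in> E")
    case True
    then have "(a, x) \<in> reach E \<longleftrightarrow> (a, y) \<in> reach E"
      by (meson reach_edge reach_sym reach_trans)
    then show ?thesis using t(2)[OF True] by (simp add: s_def)
  next
    case False
    have "s a = w a b * s b" using insert.hyps t(1) by (simp add: s_def)
    moreover from this have "w b a * s a = (w a b * w b a) * s b" by simp
    then have "s b = w b a * s a" using wab by simp
    ultimately show ?thesis
      using False that by (auto simp: doubleton_eq_iff)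
  qed
  ultimately show ?case by blast
qed


section \<open>Reduced words and components of the inversion graph\<close>

abbreviation pos :: "(nat \<Rightarrow> nat) \<Rightarrow> nat \<Rightarrow> nat" where
  "pos \<pi> \<equiv> Hilbert_Choice.inv \<pi>"

text \<open>
  In terms of reduced words this is the support of \<open>\<pi>\<close>, the set of letters that occur in them.
\<close>

definition moved_prefixes :: "nat \<Rightarrow> (nat \<Rightarrow> nat) \<Rightarrow> nat set" where
  "moved_prefixes n \<pi> = {i \<in> {1..<n}. \<pi> ` {1..i} \<noteq> {1..i}}"

definition inversions :: "nat \<Rightarrow> (nat \<Rightarrow> nat) \<Rightarrow> (nat \<times> nat) set" where
  "inversions n \<pi> = {(a, b). 1 \<le> a \<and> a < b \<and> b \<le> n \<and> pos \<pi> b < pos \<pi> a}"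

abbreviation inv_edges :: "nat \<Rightarrow> (nat \<Rightarrow> nat) \<Rightarrow> nat set set" where
  "inv_edges n \<pi> \<equiv> snd (inversion_graph n \<pi>)"

lemma inversion_graph_eq: "inversion_graph n \<pi> = ({1..n}, inv_edges n \<pi>)"
  by (simp add: inversion_graph_def)

lemma inv_edges_eq: "inv_edges n \<pi> = (\<lambda>(a, b). {a, b}) ` inversions n \<pi>"
  unfolding inversion_graph_def inversions_def by (auto simp: image_iff) force

lemma inv_edges_iff: "a < b \<Longrightarrow> {a, b} \<in> inv_edges n \<pi> \<longleftrightarrow> (a, b) \<in> inversions n \<pi>"
  unfolding inv_edges_eq inversions_def by (auto simp: image_iff doubleton_eq_iff)

lemma finite_inversions: "finite (inversions n \<pi>)"
  by (rule finite_subset[of _ "{1..n} \<times> {1..n}"]) (auto simp: inversions_def)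

lemma card_inv_edges: "card (inv_edges n \<pi>) = card (inversions n \<pi>)"
  unfolding inv_edges_eq
  by (intro card_image) (auto simp: inj_on_def inversions_def doubleton_eq_iff)

lemma simple_inversion_graph: "simple_graph ({1..n}, inv_edges n \<pi>)"
  unfolding simple_graph_def inversion_graph_def by auto

text \<open>
  If the prefix \<open>{1..i}\<close> is not preserved, then a large value \<open>b\<close> stands in it and, by counting, a small
  value \<open>a\<close> stands outside.
\<close>

lemma moved_prefix_crossed:
  assumes \<pi>: "\<pi> permutes {1..n}" and i: "i \<in> moved_prefixes n \<pi>"
  shows "\<exists>a b. a \<le> i \<and> i < b \<and> pos \<pi> b \<le> i \<and> i < pos \<pi> a \<and> 1 \<le> a \<and> b \<le> n \<and> 1 \<le> pos \<pi> b"
proof -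
  have i: "1 \<le> i" "i < n" and ne: "\<pi> ` {1..i} \<noteq> {1..i}"
    using i by (auto simp: moved_prefixes_def)
  have card: "card (\<pi> ` {1..i}) = card {1..i}"
    using permutes_inj_on[OF \<pi>] by (rule card_image)
  have "\<not> \<pi> ` {1..i} \<subseteq> {1..i}" "\<not> {1..i} \<subseteq> \<pi> ` {1..i}"
    using card_subset_eq[OF _ _ card] card_subset_eq[OF _ _ card[symmetric]] ne by auto
  then obtain p a where p: "p \<in> {1..i}" "\<pi> p \<notin> {1..i}" and a: "a \<in> {1..i}" "a \<notin> \<pi> ` {1..i}"
    by blast
  have "\<pi> p \<in> {1..n}" using permutes_in_image[OF \<pi>, of p] p i by auto
  moreover have "pos \<pi> (\<pi> p) = p" using permutes_inverses(2)[OF \<pi>] .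
  moreover have "pos \<pi> a \<in> {1..n}"
    using permutes_in_image[OF permutes_inv[OF \<pi>], of a] a i by auto
  moreover have "\<pi> (pos \<pi> a) = a" using permutes_inverses(1)[OF \<pi>] .
  then have "pos \<pi> a \<notin> {1..i}" using a(2) by (metis imageI)
  ultimately show ?thesis
    using p a by (intro exI[of _ a] exI[of _ "\<pi> p"]) auto
qed

lemma inversion_crosses_moved_prefixes:
  assumes \<pi>: "\<pi> permutes {1..n}" and ab: "(a, b) \<in> inversions n \<pi>" and i: "a \<le> i" "i < b"
  shows "i \<in> moved_prefixes n \<pi>"
proof (rule ccontr)
  assume "i \<notin> moved_prefixes n \<pi>"
  then have fix_i: "\<pi> ` {1..i} = {1..i}"
    using ab i by (auto simp: moved_prefixes_def inversions_def)
  have "a \<in> \<pi> ` {1..i}" unfolding fix_i using ab i by (auto simp: inversions_def)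
  then have "pos \<pi> a \<le> i" using permutes_inverses(2)[OF \<pi>] by auto
  then have "pos \<pi> b < i" using ab by (auto simp: inversions_def)
  moreover have "pos \<pi> b \<in> {1..n}"
    using permutes_in_image[OF permutes_inv[OF \<pi>], of b] ab by (auto simp: inversions_def)
  ultimately have "\<pi> (pos \<pi> b) \<in> \<pi> ` {1..i}" by auto
  then show False using permutes_inverses(1)[OF \<pi>] i unfolding fix_i by auto
qed

lemma moved_prefix_connects:
  assumes \<pi>: "\<pi> permutes {1..n}" and i: "i \<in> moved_prefixes n \<pi>"
  shows "(i, Suc i) \<in> reach (inv_edges n \<pi>)"
proof -
  obtain a b where ab: "a \<le> i" "i < b" "pos \<pi> b \<le> i" "i < pos \<pi> a" "1 \<le> a" "b \<le> n"
    using moved_prefix_crossed[OF \<pi> i] by auto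
  have adj: "(x, y) \<in> reach (inv_edges n \<pi>)" if "(x, y) \<in> inversions n \<pi>" for x y
    using that by (intro reach_edge) (auto simp: inv_edges_eq)
  have "(a, b) \<in> inversions n \<pi>" using ab by (auto simp: inversions_def)
  note e = adj[OF this]
  \<comment> \<open>Every value between \<open>a\<close> and \<open>b\<close> forms an inversion with one of them.\<close>
  have near: "(a, x) \<in> reach (inv_edges n \<pi>)" if x: "a \<le> x" "x \<le> b" for x
  proof (cases "x = a \<or> x = b")
    case False
    then have x: "a < x" "x < b" using x by auto
    consider "pos \<pi> b < pos \<pi> x" | "pos \<pi> x < pos \<pi> a" using ab by linarith
    then show ?thesis
    proof cases
      case 1
      then have "(x, b) \<in> inversions n \<pi>" using x ab by (auto simp: inversions_def)
      then show ?thesis using e by (meson adj reach_sym reach_trans)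
    next
      case 2
      then have "(a, x) \<in> inversions n \<pi>" using x ab by (auto simp: inversions_def)
      then show ?thesis by (rule adj)
    qed
  qed (use e in auto)
  have "(a, i) \<in> reach (inv_edges n \<pi>)" "(a, Suc i) \<in> reach (inv_edges n \<pi>)"
    using near ab by auto
  then show ?thesis by (meson reach_sym reach_trans)
qed

text \<open>
  By the previous two lemmas, \<open>x\<close> and \<open>y\<close> are connected iff every prefix between them is moved. So a
  component is determined by the first preserved prefix that contains it, the number \<open>c x\<close> below.
\<close>

lemma card_components_inversion_graph:
  assumes \<pi>: "\<pi> permutes {1..n}"
  shows "card (components (inversion_graph n \<pi>)) + card (moved_prefixes n \<pi>) = n"
proof -
  let ?D = "moved_prefixes n \<pi>" and ?R = "reach (inv_edges n \<pi>)"
  define c where "c x = (LEAST b. x \<le> b \<and> b \<notin> ?D)" for x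
  have D: "?D \<subseteq> {1..n}" by (auto simp: moved_prefixes_def)
  have n: "n \<notin> ?D" by (simp add: moved_prefixes_def)
  have c: "x \<le> c x \<and> c x \<notin> ?D" "c x \<le> n" "\<And>i. x \<le> i \<Longrightarrow> i < c x \<Longrightarrow> i \<in> ?D" if "x \<le> n" for x
  proof -
    show "x \<le> c x \<and> c x \<notin> ?D" unfolding c_def by (rule LeastI[of _ n]) (use n that in auto)
    show "c x \<le> n" unfolding c_def by (rule Least_le) (use n that in auto)
    show "i \<in> ?D" if "x \<le> i" "i < c x" for i
      using not_less_Least[of i "\<lambda>b. x \<le> b \<and> b \<notin> ?D"] that unfolding c_def by auto
  qed
  have c_eqI: "c x = b" if "x \<le> b" "b \<notin> ?D" "\<And>i. x \<le> i \<Longrightarrow> i < b \<Longrightarrow> i \<in> ?D" for x b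
    unfolding c_def by (rule Least_equality) (use that in \<open>auto intro: leI\<close>)
  have c_edge: "c a = c b" if "(a, b) \<in> inversions n \<pi>" for a b
  proof (rule c_eqI)
    have ab: "a < b" "b \<le> n" using that by (auto simp: inversions_def)
    show "a \<le> c b" "c b \<notin> ?D" using c(1)[of b] ab by auto
    show "i \<in> ?D" if "a \<le> i" "i < c b" for i
      using that c(3)[of b i] ab inversion_crosses_moved_prefixes[OF \<pi> \<open>(a, b) \<in> inversions n \<pi>\<close>, of i]
      by (cases "i < b") auto
  qed
  have to_c: "(x, c x) \<in> ?R" if "x \<le> n" for x
  proof -
    have "(x, i) \<in> ?R" if "x \<le> i" "i \<le> c x" for i
      using that
    proof (induction i rule: dec_induct)
      case (step i)
      then have "i \<in> ?D" using c(3)[OF \<open>x \<le> n\<close>] by auto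
      then have "(i, Suc i) \<in> ?R" by (rule moved_prefix_connects[OF \<pi>])
      moreover have "(x, i) \<in> ?R" using step by simp
      ultimately show ?case by (rule reach_trans[rotated])
    qed simp
    then show ?thesis using c(1)[OF that] by simp
  qed
  have R_iff: "(x, y) \<in> ?R \<longleftrightarrow> c x = c y" if "x \<in> {1..n}" "y \<in> {1..n}" for x y
  proof
    assume "(x, y) \<in> ?R"
    then show "c x = c y"
    proof (rule reach_invariant)
      fix a b assume "{a, b} \<in> inv_edges n \<pi>"
      then obtain p q where pq: "(p, q) \<in> inversions n \<pi>" "{a, b} = {p, q}"
        by (auto simp: inv_edges_eq)
      show "c a = c b" using c_edge[OF pq(1)] pq(2) by (auto simp: doubleton_eq_iff)
    qed
  next
    assume "c x = c y"
    moreover have "(x, c x) \<in> ?R" "(y, c y) \<in> ?R" using to_c that by auto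
    ultimately show "(x, y) \<in> ?R" using reach_trans[of x "c x"] reach_sym[of y "c y"] by simp
  qed
  have "card (components (inversion_graph n \<pi>)) = card (c ` {1..n})"
  proof -
    have "card ((\<lambda>x. {y \<in> {1..n}. (x, y) \<in> ?R}) ` {1..n}) = card (c ` {1..n})"
    proof (rule card_image_same_kernel)
      fix x y assume xy: "x \<in> {1..n}" "y \<in> {1..n}"
      show "{z \<in> {1..n}. (x, z) \<in> ?R} = {z \<in> {1..n}. (y, z) \<in> ?R} \<longleftrightarrow> c x = c y"
        unfolding components_eq_iff[OF xy] by (rule R_iff[OF xy])
    qed
    then show ?thesis by (subst inversion_graph_eq) (simp only: components_image)
  qed
  also have "c ` {1..n} = {1..n} - ?D"
  proof -
    have "c x = x" if "x \<notin> ?D" for x using that by (intro c_eqI) auto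
    then have "{1..n} - ?D \<subseteq> c ` {1..n}" by force
    moreover have "c x \<in> {1..n} - ?D" if "x \<in> {1..n}" for x using c(1,2)[of x] that by auto
    ultimately show ?thesis by blast
  qed
  also have "card ({1..n} - ?D) = n - card ?D"
    using card_Diff_subset[OF finite_subset[OF D] D] by simp
  finally have "card (components (inversion_graph n \<pi>)) = n - card ?D" .
  moreover have "card ?D \<le> n" using card_mono[OF _ D] by simp
  ultimately show ?thesis by linarith
qed

lemma simple_word_perm_simps [simp]:
  "simple_word_perm [] = id"
  "simple_word_perm (i # ws) = transpose i (i + 1) \<circ> simple_word_perm ws"
  by (simp_all add: simple_word_perm_def)

lemma simple_word_perm_append: "simple_word_perm (u @ v) = simple_word_perm u \<circ> simple_word_perm v"
  by (induction u) (auto simp: fun_eq_iff)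

lemma simple_word_perm_permutes: "set ws \<subseteq> {1..<n} \<Longrightarrow> simple_word_perm ws permutes {1..n}"
  by (induction ws) (auto intro!: permutes_compose permutes_swap_id permutes_id)

text \<open>
  Exchanging the values \<open>i\<close> and \<open>i + 1\<close> only affects the order of this pair; on all other pairs the
  exchange is a bijection between the inversions.
\<close>

lemma inversions_swap:
  assumes \<pi>: "\<pi> permutes {1..n}" and i: "(i, Suc i) \<in> inversions n \<pi>"
  shows "card (inversions n \<pi>) = Suc (card (inversions n (transpose i (i + 1) \<circ> \<pi>)))"
proof -
  let ?s = "transpose i (Suc i)"
  have n: "1 \<le> i" "i < n" using i by (auto simp: inversions_def)
  have inv: "pos (?s \<circ> \<pi>) x = pos \<pi> (?s x)" for x
    using permutes_bij[OF \<pi>] by (simp add: o_inv_distrib)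
  have s: "?s a < ?s b \<longleftrightarrow> a < b" if "(a, b) \<noteq> (i, Suc i)" "(b, a) \<noteq> (i, Suc i)" for a b
    using that by (auto simp: transpose_def)
  have dom: "1 \<le> ?s a \<longleftrightarrow> 1 \<le> a" "?s a \<le> n \<longleftrightarrow> a \<le> n" for a
    using n by (auto simp: transpose_def)
  have mem: "(?s a, ?s b) \<in> inversions n (?s \<circ> \<pi>) \<longleftrightarrow> (a, b) \<in> inversions n \<pi> - {(i, Suc i)}" for a b
  proof (cases "(a, b) = (i, Suc i) \<or> (b, a) = (i, Suc i)")
    case True
    then show ?thesis using i by (auto simp: inversions_def inv)
  next
    case False
    then have "?s a < ?s b \<longleftrightarrow> a < b" by (intro s) auto
    then show ?thesis using False by (simp add: inversions_def inv dom del: One_nat_def)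
  qed
  have "inversions n (?s \<circ> \<pi>) = (\<lambda>(a, b). (?s a, ?s b)) ` (inversions n \<pi> - {(i, Suc i)})"
  proof (intro Set.set_eqI iffI)
    fix p assume "p \<in> inversions n (?s \<circ> \<pi>)"
    moreover obtain a b where p: "p = (?s a, ?s b)"
      by (metis surj_pair transpose_involutory)
    ultimately have "(?s a, ?s b) \<in> inversions n (?s \<circ> \<pi>)" by simp
    then show "p \<in> (\<lambda>(a, b). (?s a, ?s b)) ` (inversions n \<pi> - {(i, Suc i)})"
      unfolding mem p by (intro image_eqI[of _ _ "(a, b)"]) auto
  qed (auto simp: mem simp del: Diff_iff)
  moreover have "inj_on (\<lambda>(a, b). (?s a, ?s b)) A" for A
    by (auto simp: inj_on_def dest: injD[OF inj_transpose])
  ultimately have "card (inversions n (?s \<circ> \<pi>)) = card (inversions n \<pi> - {(i, Suc i)})"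
    by (simp add: card_image)
  then show ?thesis using card_Suc_Diff1[OF finite_inversions i] by simp
qed

lemma card_inversions_swap_le:
  assumes \<pi>: "\<pi> permutes {1..n}" and i: "i \<in> {1..<n}"
  shows "card (inversions n (transpose i (i + 1) \<circ> \<pi>)) \<le> Suc (card (inversions n \<pi>))"
proof (cases "(i, Suc i) \<in> inversions n \<pi>")
  case True
  then show ?thesis using inversions_swap[OF \<pi>] by simp
next
  case False
  let ?\<sigma> = "transpose i (i + 1) \<circ> \<pi>"
  have \<sigma>: "?\<sigma> permutes {1..n}"
    using i by (intro permutes_compose[OF \<pi>] permutes_swap_id) auto
  have "pos ?\<sigma> x = pos \<pi> (transpose i (i + 1) x)" for x
    using permutes_bij[OF \<pi>] by (simp add: o_inv_distrib)
  moreover have "pos \<pi> i \<noteq> pos \<pi> (Suc i)"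
    using inj_eq[OF permutes_inj[OF permutes_inv[OF \<pi>]], of i "Suc i"] by simp
  ultimately have "(i, Suc i) \<in> inversions n ?\<sigma>"
    using False i by (auto simp: inversions_def)
  from inversions_swap[OF \<sigma> this]
  have "card (inversions n ?\<sigma>) = Suc (card (inversions n (transpose i (i + 1) \<circ> ?\<sigma>)))" .
  moreover have "transpose i (i + 1) \<circ> ?\<sigma> = \<pi>" by (simp add: fun_eq_iff)
  ultimately show ?thesis by simp
qed

lemma no_descent_imp_id:
  assumes \<pi>: "\<pi> permutes {1..n}" and asc: "\<And>i. i \<in> {1..<n} \<Longrightarrow> \<pi> i < \<pi> (Suc i)"
  shows "\<pi> = id"
proof -
  have "\<pi> x \<ge> x" if "1 \<le> x" "x \<le> n" for x
    using that
  proof (induction x rule: dec_induct)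
    case base
    then show ?case using permutes_in_image[OF \<pi>, of 1] by auto
  next
    case (step x)
    then show ?case using asc[of x] by auto
  qed
  moreover have "sum \<pi> {1..n} = sum id {1..n}"
    using sum.reindex_bij_betw[OF permutes_imp_bij[OF \<pi>], of id] by simp
  ultimately have "\<pi> x = x" if "x \<in> {1..n}" for x
    using sum_mono_inv[of id "{1..n}" \<pi> x] that by auto
  then show ?thesis using permutes_not_in[OF \<pi>] by (metis eq_id_iff)
qed

lemma length_simple_word_ge:
  "simple_word n \<pi> ws \<Longrightarrow> card (inversions n \<pi>) \<le> length ws"
proof (induction ws arbitrary: \<pi>)
  case Nil
  then have "\<pi> = id" by (simp add: simple_word_def)
  then have "inversions n \<pi> = {}" by (auto simp: inversions_def)
  then show ?case by simp
next
  case (Cons i ws)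
  let ?\<sigma> = "simple_word_perm ws"
  have ws: "set ws \<subseteq> {1..<n}" "i \<in> {1..<n}" and \<pi>: "\<pi> = transpose i (i + 1) \<circ> ?\<sigma>"
    using Cons.prems by (auto simp: simple_word_def)
  have "card (inversions n ?\<sigma>) \<le> length ws"
    using Cons.IH ws by (simp add: simple_word_def)
  moreover have "card (inversions n \<pi>) \<le> Suc (card (inversions n ?\<sigma>))"
    unfolding \<pi> using simple_word_perm_permutes ws by (intro card_inversions_swap_le)
  ultimately show ?case by simp
qed

lemma ex_simple_word:
  assumes "\<pi> permutes {1..n}"
  shows "\<exists>ws. simple_word n \<pi> ws \<and> length ws = card (inversions n \<pi>)"
  using assms
proof (induction "card (inversions n \<pi>)" arbitrary: \<pi> rule: less_induct)
  case less
  note \<pi> = less.prems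
  show ?case
  proof (cases "\<exists>i. (i, Suc i) \<in> inversions n \<pi>")
    case True
    then obtain i where i: "(i, Suc i) \<in> inversions n \<pi>" ..
    then have i': "i \<in> {1..<n}" by (auto simp: inversions_def)
    let ?\<sigma> = "transpose i (i + 1) \<circ> \<pi>"
    have "?\<sigma> permutes {1..n}"
      using i' by (intro permutes_compose[OF \<pi>] permutes_swap_id) auto
    then obtain ws where ws: "simple_word n ?\<sigma> ws" "length ws = card (inversions n ?\<sigma>)"
      using less.hyps[of ?\<sigma>] inversions_swap[OF \<pi> i] by auto
    have "transpose i (i + 1) \<circ> ?\<sigma> = \<pi>" by (simp add: fun_eq_iff)
    then have "simple_word n \<pi> (i # ws)"
      using ws(1) i' by (simp add: simple_word_def del: comp_apply)
    then show ?thesis using ws(2) inversions_swap[OF \<pi> i] by (intro exI[of _ "i # ws"]) simp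
  next
    case False
    have "pos \<pi> i < pos \<pi> (Suc i)" if "i \<in> {1..<n}" for i
    proof -
      have "pos \<pi> i \<noteq> pos \<pi> (Suc i)"
        using inj_eq[OF permutes_inj[OF permutes_inv[OF \<pi>]], of i "Suc i"] by simp
      moreover have "\<not> pos \<pi> (Suc i) < pos \<pi> i"
        using False that by (auto simp: inversions_def)
      ultimately show ?thesis by linarith
    qed
    then have "pos \<pi> = id" by (rule no_descent_imp_id[OF permutes_inv[OF \<pi>]])
    then have "\<pi> = id" using inv_inv_eq[OF permutes_bij[OF \<pi>]] by simp
    then have "simple_word n \<pi> [] \<and> inversions n \<pi> = {}"
      by (auto simp: simple_word_def inversions_def)
    then show ?thesis by (metis card.empty list.size(3))
  qed
qed

lemma coxeter_length_eq:
  assumes "\<pi> permutes {1..n}"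
  shows "coxeter_length n \<pi> = card (inversions n \<pi>)"
  unfolding coxeter_length_def
  by (rule Least_equality) (use ex_simple_word[OF assms] length_simple_word_ge in auto)

lemma ex_reduced_word: "\<pi> permutes {1..n} \<Longrightarrow> \<exists>ws. reduced_word n \<pi> ws"
  using ex_simple_word[of \<pi> n] by (simp add: reduced_word_def coxeter_length_eq)

lemma simple_word_perm_prefix:
  assumes "i \<notin> set ws" "0 \<notin> set ws"
  shows "simple_word_perm ws ` {1..i} = {1..i}"
  using assms
proof (induction ws)
  case (Cons j ws)
  then have "transpose j (j + 1) permutes {1..i} \<or> j > i"
    by (auto intro!: permutes_swap_id)
  then have "transpose j (j + 1) ` {1..i} = {1..i}"
    by (elim disjE, simp only: permutes_image) (force simp: transpose_def image_def)
  then show ?case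
    using Cons unfolding simple_word_perm_simps image_comp[symmetric] by simp
qed simp

lemma moved_prefixes_subset_letters:
  "simple_word n \<pi> ws \<Longrightarrow> moved_prefixes n \<pi> \<subseteq> set ws"
  unfolding moved_prefixes_def simple_word_def using simple_word_perm_prefix[of _ ws] by fastforce

text \<open>
  All other letters preserve \<open>{1..i}\<close>, and the single occurrence of \<open>s\<^sub>i\<close> does not.
\<close>

lemma distinct_letters_subset_moved_prefixes:
  assumes "simple_word n \<pi> ws" "distinct ws"
  shows "set ws \<subseteq> moved_prefixes n \<pi>"
proof
  fix i assume "i \<in> set ws"
  then obtain u v where ws: "ws = u @ i # v" by (auto simp: in_set_conv_decomp)
  have i: "i \<in> {1..<n}" "set ws \<subseteq> {1..<n}" "\<pi> = simple_word_perm ws"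
    using assms(1) ws by (auto simp: simple_word_def)
  let ?u = "simple_word_perm u" and ?s = "transpose i (i + 1)"
  have u: "?u ` {1..i} = {1..i}" and v: "simple_word_perm v ` {1..i} = {1..i}"
    using assms(2) i(2) ws by (intro simple_word_perm_prefix; auto)+
  have "?u permutes {1..n}" using i ws by (intro simple_word_perm_permutes) auto
  note inj = permutes_inj[OF this]
  have "\<pi> ` {1..i} = ?u ` ?s ` simple_word_perm v ` {1..i}"
    by (simp add: i(3) ws simple_word_perm_append image_comp comp_assoc)
  then have "\<pi> ` {1..i} = ?u ` ?s ` {1..i}" using v by simp
  have "Suc i \<in> ?s ` {1..i}" using i(1) by (force simp: transpose_def image_def)
  moreover have "Suc i \<notin> {1..i}" by simp
  ultimately have "?s ` {1..i} \<noteq> {1..i}" by metis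
  with \<open>\<pi> ` {1..i} = ?u ` ?s ` {1..i}\<close> have "\<pi> ` {1..i} \<noteq> ?u ` {1..i}" using inj by (simp add: inj_image_eq_iff)
  then show "i \<in> moved_prefixes n \<pi>" using i u by (simp add: moved_prefixes_def)
qed

lemma cyclomatic_inversion_graph:
  assumes "\<pi> permutes {1..n}"
  shows "cyclomatic (inversion_graph n \<pi>) = int (coxeter_length n \<pi>) - int (card (moved_prefixes n \<pi>))"
  using card_components_inversion_graph[OF assms]
  by (simp add: cyclomatic_def card_inv_edges coxeter_length_eq[OF assms]) (simp add: inversion_graph_def)

lemma has_repeated_letter_iff: "has_repeated_letter ws \<longleftrightarrow> \<not> distinct ws"
proof
  assume "has_repeated_letter ws"
  then show "\<not> distinct ws"
    unfolding has_repeated_letter_def by (induction ws) (auto split: if_splits simp: count_list_0_iff)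
next
  assume "\<not> distinct ws"
  then obtain xs ys zs y where "ws = xs @ [y] @ ys @ [y] @ zs" using not_distinct_decomp by blast
  then show "has_repeated_letter ws" by (auto simp: has_repeated_letter_def intro!: exI[of _ y])
qed

lemma cyclomatic_zero_iff_word:
  assumes \<pi>: "\<pi> permutes {1..n}"
  shows "cyclomatic (inversion_graph n \<pi>) = 0 \<longleftrightarrow> (\<exists>ws. reduced_word n \<pi> ws \<and> distinct ws)"
    and "cyclomatic (inversion_graph n \<pi>) = 0 \<longleftrightarrow> \<not> (\<exists>ws. reduced_word n \<pi> ws \<and> has_repeated_letter ws)"
proof -
  let ?D = "moved_prefixes n \<pi>"
  have 1: "distinct ws" if "cyclomatic (inversion_graph n \<pi>) = 0" "reduced_word n \<pi> ws" for ws
  proof -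
    have "length ws = card ?D"
      using that by (simp add: cyclomatic_inversion_graph[OF \<pi>] reduced_word_def)
    also have "\<dots> \<le> card (set ws)"
      using that(2) moved_prefixes_subset_letters by (intro card_mono) (auto simp: reduced_word_def)
    finally show ?thesis using card_distinct[of ws] card_length[of ws] by linarith
  qed
  have 2: "cyclomatic (inversion_graph n \<pi>) = 0" if "reduced_word n \<pi> ws" "distinct ws" for ws
  proof -
    have "set ws = ?D"
      using that moved_prefixes_subset_letters distinct_letters_subset_moved_prefixes
      by (fastforce simp: reduced_word_def)
    then show ?thesis
      using that distinct_card[of ws] by (simp add: cyclomatic_inversion_graph[OF \<pi>] reduced_word_def)
  qed
  obtain ws where "reduced_word n \<pi> ws" using ex_reduced_word[OF \<pi>] ..
  then show "cyclomatic (inversion_graph n \<pi>) = 0 \<longleftrightarrow> (\<exists>ws. reduced_word n \<pi> ws \<and> distinct ws)"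
    and "cyclomatic (inversion_graph n \<pi>) = 0 \<longleftrightarrow> \<not> (\<exists>ws. reduced_word n \<pi> ws \<and> has_repeated_letter ws)"
    using 1 2 unfolding has_repeated_letter_iff by blast+
qed


section \<open>Reflection length\<close>

text \<open>
  If the last value is misplaced, one transposition brings it home. Afterwards the longest proper prefix,
  which was moved, is preserved, and every prefix that was preserved still is.
\<close>

lemma ex_transp_word:
  "\<pi> permutes {1..n} \<Longrightarrow> \<exists>ts. transp_word n \<pi> ts \<and> length ts \<le> card (moved_prefixes n \<pi>)"
proof (induction n arbitrary: \<pi>)
  case 0
  then have "\<pi> = id" by simp
  then show ?case by (intro exI[of _ "[]"]) (simp add: transp_word_def id_def)
next
  case (Suc n)
  note \<pi> = Suc.prems
  have fin: "finite (moved_prefixes m \<sigma>)" for m \<sigma> by (simp add: moved_prefixes_def)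
  have extend: "transp_word (Suc n) \<sigma> ts" if "transp_word n \<sigma> ts" for \<sigma> ts
    using that by (fastforce simp: transp_word_def)
  have restrict: "\<sigma> permutes {1..n}" if "\<sigma> permutes {1..Suc n}" "\<sigma> (Suc n) = Suc n" for \<sigma>
    by (rule permutes_superset[OF that(1)]) (use that(2) in \<open>auto simp: le_Suc_eq\<close>)
  show ?case
  proof (cases "\<pi> (Suc n) = Suc n")
    case True
    from Suc.IH[OF restrict[OF \<pi> True]] obtain ts
      where "transp_word n \<pi> ts" "length ts \<le> card (moved_prefixes n \<pi>)" by blast
    moreover have "card (moved_prefixes n \<pi>) \<le> card (moved_prefixes (Suc n) \<pi>)"
      by (rule card_mono[OF fin]) (auto simp: moved_prefixes_def)
    ultimately show ?thesis using extend le_trans by blast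
  next
    case False
    define k where "k = \<pi> (Suc n)"
    let ?\<sigma> = "transpose (Suc n) k \<circ> \<pi>"
    have k: "k \<in> {1..Suc n}" "k \<noteq> Suc n"
      using permutes_in_image[OF \<pi>, of "Suc n"] False by (auto simp: k_def)
    have "?\<sigma> permutes {1..Suc n}"
      using k by (intro permutes_compose[OF \<pi>] permutes_swap_id) auto
    then have "?\<sigma> permutes {1..n}" by (rule restrict) (simp add: k_def)
    from Suc.IH[OF this] obtain ts
      where ts: "transp_word n ?\<sigma> ts" "length ts \<le> card (moved_prefixes n ?\<sigma>)" by blast
    have "k \<notin> \<pi> ` {1..i}" if "i \<le> n" for i
      using that by (auto simp: k_def inj_eq[OF permutes_inj[OF \<pi>]])
    then have out: "k \<notin> {1..i}" if "\<pi> ` {1..i} = {1..i}" "i \<le> n" for i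
      using that by metis
    have "n \<in> moved_prefixes (Suc n) \<pi>"
      using out[of n] k by (auto simp: moved_prefixes_def)
    moreover have "i \<in> moved_prefixes (Suc n) \<pi> - {n}" if i: "i \<in> moved_prefixes n ?\<sigma>" for i
    proof (rule ccontr)
      assume "i \<notin> moved_prefixes (Suc n) \<pi> - {n}"
      then have fix_i: "\<pi> ` {1..i} = {1..i}" "i < n"
        using i by (auto simp: moved_prefixes_def)
      have "transpose (Suc n) k x = x" if "x \<in> {1..i}" for x
        using that out[of i] fix_i by (intro transpose_apply_other) auto
      then have "transpose (Suc n) k ` {1..i} = {1..i}" by simp
      then have "?\<sigma> ` {1..i} = {1..i}" unfolding image_comp[symmetric] fix_i(1) .
      then show False using i by (simp add: moved_prefixes_def)
    qed
    ultimately have "card (moved_prefixes n ?\<sigma>) < card (moved_prefixes (Suc n) \<pi>)"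
      by (intro psubset_card_mono[OF fin]) blast
    moreover have "transp_word (Suc n) \<pi> ((Suc n, k) # ts)"
      using extend[OF ts(1)] k by (simp add: transp_word_def fun_eq_iff)
    ultimately show ?thesis using ts(2) by (intro exI[of _ "(Suc n, k) # ts"]) simp
  qed
qed

text \<open>
  Compare the partial sums \<open>g 1 + \<dots> + g i\<close> before and after applying the word: the only letter that can
  change this sum is \<open>i\<close>, and it replaces the term \<open>g i\<close> by \<open>g (i + 1)\<close>.
\<close>

lemma invariant_under_distinct_word:
  fixes g :: "nat \<Rightarrow> int"
  assumes "distinct ws" "0 \<notin> set ws" "\<And>x. g (simple_word_perm ws x) = g x"
  shows "\<forall>i\<in>set ws. g i = g (Suc i)"
  using assms
proof (induction ws)
  case (Cons i ws)
  let ?P = "simple_word_perm ws" and ?s = "transpose i (i + 1)"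
  have i: "i \<notin> set ws" "0 < i" using Cons.prems by auto
  have g: "g (?s (?P x)) = g x" for x using Cons.prems(3)[of x] by simp
  have "set ws \<subseteq> {1..<Suc (Max (set ws))}" "0 \<notin> set ws"
    using Cons.prems(2) by (auto simp: less_Suc_eq_le Suc_le_eq intro: gr0I)
  then have "inj ?P" using permutes_inj[OF simple_word_perm_permutes] by blast
  then have inj: "inj_on ?P {1..i}" by (rule inj_on_subset) simp
  have split: "sum h {1..i} = h i + sum h {1..<i}" for h :: "nat \<Rightarrow> int"
    using i(2) by (subst atLeastLessThanSuc_atLeastAtMost[symmetric]) simp
  have "sum g {1..i} = sum ((\<lambda>x. g (?s x)) \<circ> ?P) {1..i}" by (simp only: comp_def g)
  also have "\<dots> = sum (\<lambda>x. g (?s x)) (?P ` {1..i})"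
    by (rule sum.reindex[OF inj, symmetric])
  also have "?P ` {1..i} = {1..i}"
    using i Cons.prems by (intro simple_word_perm_prefix) auto
  finally have "g i + sum g {1..<i} = g (Suc i) + sum (\<lambda>x. g (?s x)) {1..<i}"
    unfolding split by simp
  moreover have "sum (\<lambda>x. g (?s x)) {1..<i} = sum g {1..<i}"
    by (intro sum.cong) (auto simp: transpose_def)
  ultimately have gi: "g i = g (Suc i)" by simp
  then have "g (?s x) = g x" for x by (auto simp: transpose_def)
  then have "g (?P x) = g x" for x using g[of x] by simp
  then show ?case using Cons gi by simp
qed simp

text \<open>
  Each component of the graph \<open>E\<close> of the transpositions is stable under \<open>\<pi>\<close>, so by the previous lemma
  \<open>i\<close> and \<open>i + 1\<close> lie in the same component for every letter \<open>i\<close> of the word. This bounds the number of components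
  from above, and a graph with few components has many edges.
\<close>

lemma length_transp_word_ge:
  assumes ts: "transp_word n \<pi> ts" and ws: "simple_word n \<pi> ws" "distinct ws"
  shows "length ws \<le> length ts"
proof -
  define E where "E = (\<lambda>(i, j). {i, j}) ` set ts"
  have letters: "set ws \<subseteq> {1..<n}" and \<pi>: "\<pi> = simple_word_perm ws"
    using ws(1) by (auto simp: simple_word_def)
  have wf: "simple_graph ({1..n}, E)"
    using ts by (fastforce simp: simple_graph_def E_def transp_word_def)
  define C where "C x = {y \<in> {1..n}. (x, y) \<in> reach E}" for x
  have along: "(foldr (\<lambda>(i, j) \<sigma>. transpose i j \<circ> \<sigma>) us id x, x) \<in> reach E" if "set us \<subseteq> set ts" for us x
    using that
  proof (induction us)
    case (Cons p us)
    obtain i j where p: "p = (i, j)" by (cases p)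
    then have "(i, j) \<in> reach E" using Cons.prems by (intro reach_edge) (force simp: E_def)
    then have "(transpose i j y, y) \<in> reach E" for y
      by (auto simp: transpose_def intro: reach_sym)
    then show ?case using Cons p by (auto intro: reach_trans)
  qed simp
  have r: "(\<pi> x, x) \<in> reach E" for x
    using along[of ts x] ts by (simp add: transp_word_def)
  have "C (\<pi> x) = C x" for x
    unfolding C_def using reach_trans[OF r[of x]] reach_trans[OF reach_sym[OF r[of x]]] by auto
  then have "of_bool (C (simple_word_perm ws x) = X) = (of_bool (C x = X) :: int)" for x X
    using \<pi> by simp
  then have const: "\<forall>i\<in>set ws. of_bool (C i = X) = (of_bool (C (Suc i) = X) :: int)" for X
    using letters by (intro invariant_under_distinct_word[OF ws(2)]) auto
  have step: "C i = C (Suc i)" if "i \<in> set ws" for i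
  proof -
    have "of_bool (C i = C (Suc i)) = (of_bool (C (Suc i) = C (Suc i)) :: int)"
      using const that by blast
    then show ?thesis by simp
  qed
  have "C x \<in> C ` ({1..n} - set ws)" if "x \<in> {1..n}" for x
    using that
  proof (induction "n - x" arbitrary: x rule: less_induct)
    case less
    show ?case
    proof (cases "x \<in> set ws")
      case True
      then have "x \<in> {1..<n}" using letters by blast
      then have "Suc x \<in> {1..n}" "n - Suc x < n - x" by auto
      then show ?thesis using less.hyps step[OF True] by simp
    qed (use less.prems in blast)
  qed
  then have "C ` {1..n} \<subseteq> C ` ({1..n} - set ws)" by blast
  then have "card (C ` {1..n}) \<le> card (C ` ({1..n} - set ws))" by (intro card_mono) auto
  also have "\<dots> \<le> card ({1..n} - set ws)" by (rule card_image_le) simp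
  also have "\<dots> = n - length ws"
  proof -
    have "set ws \<subseteq> {1..n}" using letters by auto
    then show ?thesis using distinct_card[OF ws(2)] by (simp add: card_Diff_subset)
  qed
  finally have "card (components ({1..n}, E)) \<le> n - length ws"
    by (simp add: components_image C_def)
  moreover have "length ws \<le> n"
    using card_mono[OF _ letters] distinct_card[OF ws(2)] by simp
  moreover have "card E \<le> length ts"
    unfolding E_def using card_image_le[of "set ts"] card_length[of ts] le_trans by blast
  ultimately show ?thesis
    using cyclomatic_nonneg[OF wf] by (simp add: cyclomatic_def)
qed

lemma cyclomatic_zero_iff_lengths:
  assumes \<pi>: "\<pi> permutes {1..n}"
  shows "cyclomatic (inversion_graph n \<pi>) = 0 \<longleftrightarrow> coxeter_length n \<pi> = reflection_length n \<pi>"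
proof -
  obtain ts0 where ts0: "transp_word n \<pi> ts0" "length ts0 \<le> card (moved_prefixes n \<pi>)"
    using ex_transp_word[OF \<pi>] by blast
  then have le: "reflection_length n \<pi> \<le> card (moved_prefixes n \<pi>)"
    unfolding reflection_length_def
    by (intro order_trans[OF Least_le[of _ "length ts0"]]) blast+
  have "\<exists>ts. transp_word n \<pi> ts \<and> length ts = reflection_length n \<pi>"
    unfolding reflection_length_def
    by (rule LeastI_ex[of "\<lambda>m. \<exists>ts. transp_word n \<pi> ts \<and> length ts = m"]) (use ts0(1) in blast)
  then obtain ts where ts: "transp_word n \<pi> ts" "length ts = reflection_length n \<pi>" by blast
  have "coxeter_length n \<pi> \<le> reflection_length n \<pi>" if "cyclomatic (inversion_graph n \<pi>) = 0"
  proof -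
    from that obtain ws where "reduced_word n \<pi> ws" "distinct ws"
      using cyclomatic_zero_iff_word(1)[OF \<pi>] by blast
    then show ?thesis using length_transp_word_ge[OF ts(1), of ws] ts(2) by (auto simp: reduced_word_def)
  qed
  moreover have "cyclomatic (inversion_graph n \<pi>) \<ge> 0"
    using cyclomatic_nonneg[OF simple_inversion_graph, of n \<pi>] by (subst inversion_graph_eq)
  ultimately show ?thesis
    using le cyclomatic_inversion_graph[OF \<pi>] by linarith
qed


section \<open>Pattern avoidance\<close>

lemma contains_pattern_iff:
  "contains_pattern n \<pi> \<sigma> \<longleftrightarrow>
     (\<exists>ps. sorted_wrt (<) ps \<and> set ps \<subseteq> {1..n} \<and> same_relative_order (map \<pi> ps) \<sigma>)"
proof
  assume "contains_pattern n \<pi> \<sigma>"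
  then obtain N where N: "same_relative_order (nths (map \<pi> [1..<n + 1]) N) \<sigma>"
    by (auto simp: contains_pattern_def one_line_def subseq_conv_nths)
  let ?ps = "nths [1..<n + 1] N"
  have "subseq ?ps [1..<n + 1]" by (auto simp: subseq_conv_nths)
  then have "sorted_wrt (<) ?ps" "set ?ps \<subseteq> {1..n}"
    using set_nths_subset[of "[1..<n + 1]" N]
    by (auto simp: strict_sorted_iff sorted_nths simp del: upt_Suc)
  then show "\<exists>ps. sorted_wrt (<) ps \<and> set ps \<subseteq> {1..n} \<and> same_relative_order (map \<pi> ps) \<sigma>"
    using N by (intro exI[of _ ?ps]) (simp add: nths_map)
next
  assume "\<exists>ps. sorted_wrt (<) ps \<and> set ps \<subseteq> {1..n} \<and> same_relative_order (map \<pi> ps) \<sigma>"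
  then obtain ps where ps: "sorted_wrt (<) ps" "set ps \<subseteq> {1..n}" "same_relative_order (map \<pi> ps) \<sigma>"
    by blast
  have "ps = filter (\<lambda>x. x \<in> set ps) [1..<n + 1]"
    using ps(1,2) by (intro sorted_distinct_set_unique) (auto simp: strict_sorted_iff sorted_wrt_filter simp del: upt_Suc)
  then have "subseq ps [1..<n + 1]" by (metis subseq_filter_left)
  then have "subseq (map \<pi> ps) (one_line n \<pi>)" unfolding one_line_def by (rule subseq_map)
  then show "contains_pattern n \<pi> \<sigma>" using ps(3) unfolding contains_pattern_def by blast
qed

lemma contains_321_iff:
  "contains_pattern n \<pi> [3, 2, 1] \<longleftrightarrow>
     (\<exists>p q r. 1 \<le> p \<and> p < q \<and> q < r \<and> r \<le> n \<and> \<pi> q < \<pi> p \<and> \<pi> r < \<pi> q)"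
  (is "_ \<longleftrightarrow> ?R")
proof
  assume "contains_pattern n \<pi> [3, 2, 1]"
  then obtain ps where ps: "sorted_wrt (<) ps" "set ps \<subseteq> {1..n}" "same_relative_order (map \<pi> ps) [3, 2, 1]"
    by (auto simp: contains_pattern_iff)
  then have "length ps = 3" by (simp add: same_relative_order_def)
  then obtain p q r where [simp]: "ps = [p, q, r]"
    by (auto simp: numeral_3_eq_3 length_Suc_conv)
  have rel: "map \<pi> ps ! i < map \<pi> ps ! j \<longleftrightarrow> [3, 2, 1 :: nat] ! i < [3, 2, 1] ! j"
    if "i < 3" "j < 3" for i j
    using ps(3) that by (simp add: same_relative_order_def)
  then show ?R
    using ps(1,2) rel[of 1 0] rel[of 2 1]
    by (intro exI[of _ p] exI[of _ q] exI[of _ r]) simp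
next
  assume ?R
  then obtain p q r where "1 \<le> p" "p < q" "q < r" "r \<le> n" "\<pi> q < \<pi> p" "\<pi> r < \<pi> q" by blast
  then show "contains_pattern n \<pi> [3, 2, 1]"
    unfolding contains_pattern_iff
    by (intro exI[of _ "[p, q, r]"]) (auto simp: same_relative_order_def All_less_Suc nth_Cons')
qed

lemma contains_3412_iff:
  "contains_pattern n \<pi> [3, 4, 1, 2] \<longleftrightarrow>
     (\<exists>p q r s. 1 \<le> p \<and> p < q \<and> q < r \<and> r < s \<and> s \<le> n \<and> \<pi> r < \<pi> s \<and> \<pi> s < \<pi> p \<and> \<pi> p < \<pi> q)"
  (is "_ \<longleftrightarrow> ?R")
proof
  assume "contains_pattern n \<pi> [3, 4, 1, 2]"
  then obtain ps where ps: "sorted_wrt (<) ps" "set ps \<subseteq> {1..n}" "same_relative_order (map \<pi> ps) [3, 4, 1, 2]"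
    by (auto simp: contains_pattern_iff)
  then have "length ps = Suc (Suc (Suc (Suc 0)))" by (simp add: same_relative_order_def)
  then obtain p q r s where [simp]: "ps = [p, q, r, s]"
    by (auto simp: length_Suc_conv)
  have rel: "map \<pi> ps ! i < map \<pi> ps ! j \<longleftrightarrow> [3, 4, 1, 2 :: nat] ! i < [3, 4, 1, 2] ! j"
    if "i < 4" "j < 4" for i j
    using ps(3) that by (simp add: same_relative_order_def)
  then show ?R
    using ps(1,2) rel[of 2 3] rel[of 3 0] rel[of 0 1]
    by (intro exI[of _ p] exI[of _ q] exI[of _ r] exI[of _ s]) simp
next
  assume ?R
  then obtain p q r s where "1 \<le> p" "p < q" "q < r" "r < s" "s \<le> n" "\<pi> r < \<pi> s" "\<pi> s < \<pi> p" "\<pi> p < \<pi> q"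
    by blast
  then show "contains_pattern n \<pi> [3, 4, 1, 2]"
    unfolding contains_pattern_iff
    by (intro exI[of _ "[p, q, r, s]"]) (auto simp: same_relative_order_def All_less_Suc nth_Cons')
qed

lemma inversions_iff_positions:
  assumes "\<pi> permutes {1..n}"
  shows "(a, b) \<in> inversions n \<pi> \<longleftrightarrow>
    (\<exists>p q. 1 \<le> p \<and> p < q \<and> q \<le> n \<and> \<pi> p = b \<and> \<pi> q = a \<and> a < b)"
proof -
  have pos: "\<pi> p = b \<longleftrightarrow> p = pos \<pi> b" for p b
    using permutes_inverses[OF assms] by metis
  have "pos \<pi> x \<in> {1..n} \<longleftrightarrow> x \<in> {1..n}" for x
    using permutes_in_image[OF permutes_inv[OF assms]] .
  then have range: "1 \<le> pos \<pi> x \<and> pos \<pi> x \<le> n \<longleftrightarrow> 1 \<le> x \<and> x \<le> n" for x by simp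
  show ?thesis
    unfolding inversions_def pos using range[of a] range[of b] by auto
qed

lemma graph_cycle_neighbours:
  assumes "graph_cycle (V, E) c" "v \<in> set c"
  obtains x y where "x \<in> set c" "y \<in> set c" "x \<noteq> y" "{v, x} \<in> E" "{v, y} \<in> E"
proof -
  let ?L = "length c"
  have len: "3 \<le> ?L" and d: "distinct c"
    and edge: "\<And>i. i < ?L \<Longrightarrow> {c ! i, c ! (Suc i mod ?L)} \<in> E"
    using assms(1) by (auto simp: graph_cycle_def)
  from assms(2) obtain k where k: "k < ?L" "v = c ! k" by (metis in_set_conv_nth)
  define i where "i = Suc k mod ?L"
  define j where "j = (if k = 0 then ?L - 1 else k - 1)"
  have "0 < ?L" using len by linarith
  then have ij: "i < ?L" "j < ?L" using k by (auto simp: i_def j_def)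
  have "i \<noteq> j"
  proof (cases "Suc k = ?L")
    case True
    then show ?thesis using len by (auto simp: i_def j_def)
  next
    case False
    then have "i = Suc k" using k by (simp add: i_def)
    then show ?thesis using len by (auto simp: j_def)
  qed
  then have "c ! i \<noteq> c ! j" using ij nth_eq_iff_index_eq[OF d] by blast
  moreover have "Suc j mod ?L = k"
  proof (cases "k = 0")
    case True
    then show ?thesis using len by (cases c) (auto simp: j_def)
  qed (use k in \<open>simp add: j_def\<close>)
  then have "{v, c ! j} \<in> E" using edge[of j] ij k by (simp add: insert_commute)
  moreover have "{v, c ! i} \<in> E" using edge[of k] k by (simp add: i_def)
  ultimately show ?thesis using that[of "c ! i" "c ! j"] ij by simp
qed

text \<open>
  In the second half, \<open>m\<close> is the maximal vertex of a cycle, \<open>a < b\<close> are neighbours of \<open>m\<close>, and \<open>d\<close> is a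
  neighbour of \<open>b\<close> other than \<open>m\<close>; the values \<open>d m a b\<close> form a 3412 if there is no 321.
\<close>

lemma forest_iff_Av:
  assumes \<pi>: "\<pi> permutes {1..n}"
  shows "forest (inversion_graph n \<pi>) \<longleftrightarrow> \<pi> \<in> Av n {[3, 2, 1], [3, 4, 1, 2]}"
proof
  let ?E = "inv_edges n \<pi>"
  assume "forest (inversion_graph n \<pi>)"
  then have forest: "\<not> graph_cycle ({1..n}, ?E) c" for c
    unfolding forest_def inversion_graph_eq[symmetric] by blast
  have adj: "{a, b} \<in> ?E" "{b, a} \<in> ?E" if "(a, b) \<in> inversions n \<pi>" for a b
    using that by (auto simp: inv_edges_eq insert_commute intro: rev_image_eqI)
  have inv: "(\<pi> y, \<pi> x) \<in> inversions n \<pi>" if "1 \<le> x" "x < y" "y \<le> n" "\<pi> y < \<pi> x" for x y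
    unfolding inversions_iff_positions[OF \<pi>] using that by blast
  have "\<not> contains_pattern n \<pi> [3, 2, 1]"
  proof
    assume "contains_pattern n \<pi> [3, 2, 1]"
    then obtain p q r where "1 \<le> p" "p < q" "q < r" "r \<le> n" "\<pi> q < \<pi> p" "\<pi> r < \<pi> q"
      unfolding contains_321_iff by blast
    then have "(\<pi> q, \<pi> p) \<in> inversions n \<pi>" "(\<pi> r, \<pi> q) \<in> inversions n \<pi>" "(\<pi> r, \<pi> p) \<in> inversions n \<pi>"
      by (auto intro!: inv)
    then have "graph_cycle ({1..n}, ?E) [\<pi> p, \<pi> q, \<pi> r]"
      by (auto simp: graph_cycle_def All_less_Suc nth_Cons' adj numeral_2_eq_2 inversions_def)
    then show False using forest by blast
  qed
  moreover have "\<not> contains_pattern n \<pi> [3, 4, 1, 2]"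
  proof
    assume "contains_pattern n \<pi> [3, 4, 1, 2]"
    then obtain p q r s where *: "1 \<le> p" "p < q" "q < r" "r < s" "s \<le> n" "\<pi> r < \<pi> s" "\<pi> s < \<pi> p" "\<pi> p < \<pi> q"
      unfolding contains_3412_iff by blast
    have "graph_cycle ({1..n}, ?E) [\<pi> p, \<pi> r, \<pi> q, \<pi> s]"
      using inv[of p r] inv[of p s] inv[of q r] inv[of q s] *
      by (auto simp: graph_cycle_def All_less_Suc nth_Cons' adj inversions_def)
    then show False using forest by blast
  qed
  ultimately show "\<pi> \<in> Av n {[3, 2, 1], [3, 4, 1, 2]}" using \<pi> by (simp add: Av_def)
next
  let ?E = "inv_edges n \<pi>" and ?I = "inversions n \<pi>"
  assume Av: "\<pi> \<in> Av n {[3, 2, 1], [3, 4, 1, 2]}"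
  have no321: False if "(a, b) \<in> ?I" "(b, c) \<in> ?I" for a b c
  proof -
    have "1 \<le> pos \<pi> c" "pos \<pi> a \<le> n"
      using that permutes_in_image[OF permutes_inv[OF \<pi>], of c] permutes_in_image[OF permutes_inv[OF \<pi>], of a]
      by (auto simp: inversions_def)
    then have "contains_pattern n \<pi> [3, 2, 1]"
      unfolding contains_321_iff
      by (intro exI[of _ "pos \<pi> c"] exI[of _ "pos \<pi> b"] exI[of _ "pos \<pi> a"])
        (use that in \<open>auto simp: inversions_def permutes_inverses[OF \<pi>]\<close>)
    then show False using Av by (simp add: Av_def)
  qed
  show "forest (inversion_graph n \<pi>)"
    unfolding forest_def
  proof
    assume "\<exists>c. graph_cycle (inversion_graph n \<pi>) c"
    then obtain c where c: "graph_cycle ({1..n}, ?E) c" unfolding inversion_graph_eq[symmetric] by blast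
    define m where "m = Max (set c)"
    have "set c \<noteq> {}" using c by (auto simp: graph_cycle_def)
    then have m: "m \<in> set c" "\<And>x. x \<in> set c \<Longrightarrow> x \<le> m" by (auto simp: m_def)
    have edge: "(x, y) \<in> ?I \<or> (y, x) \<in> ?I" "x \<noteq> y" if "{x, y} \<in> ?E" for x y
      using that by (auto simp: inv_edges_eq doubleton_eq_iff inversions_def)
    from graph_cycle_neighbours[OF c m(1)] obtain x y
      where xy: "x \<in> set c" "y \<in> set c" "x \<noteq> y" "{m, x} \<in> ?E" "{m, y} \<in> ?E" by blast
    define a where "a = min x y" define b where "b = max x y"
    have ab: "a < b" "b \<in> set c" "a \<in> set c" "{m, a} \<in> ?E" "{m, b} \<in> ?E"
      using xy by (auto simp: a_def b_def min_def max_def)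
    have am: "(a, m) \<in> ?I" and bm: "(b, m) \<in> ?I"
      using edge(1)[OF ab(4)] edge(1)[OF ab(5)] m(2)[OF ab(2)] m(2)[OF ab(3)] by (auto simp: inversions_def)
    obtain d where d: "d \<in> set c" "d \<noteq> m" "{b, d} \<in> ?E"
      by (rule graph_cycle_neighbours[OF c ab(2)]) metis
    have dm: "d < m" using d m(2)[of d] by simp
    have bd: "(b, d) \<in> ?I" using edge(1)[OF d(3)] no321[OF _ bm] by blast
    \<comment> \<open>The four values stand in the order \<open>d\<close>, \<open>m\<close>, \<open>a\<close>, \<open>b\<close>: every other order creates a 321.\<close>
    have "pos \<pi> d \<noteq> pos \<pi> m" "pos \<pi> a \<noteq> pos \<pi> b"
      using inj_eq[OF permutes_inj[OF permutes_inv[OF \<pi>]]] d(2) ab(1) by auto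
    moreover have "\<not> pos \<pi> m < pos \<pi> d"
      using no321[OF bd, of m] dm bm bd by (auto simp: inversions_def)
    moreover have "\<not> pos \<pi> b < pos \<pi> a"
      using no321[OF _ bm, of a] ab(1) am bm by (auto simp: inversions_def)
    ultimately have order: "pos \<pi> d < pos \<pi> m" "pos \<pi> m < pos \<pi> a" "pos \<pi> a < pos \<pi> b"
      using am by (auto simp: inversions_def)
    moreover have "1 \<le> pos \<pi> d" "pos \<pi> b \<le> n"
      using bd permutes_in_image[OF permutes_inv[OF \<pi>], of d] permutes_in_image[OF permutes_inv[OF \<pi>], of b]
      by (auto simp: inversions_def)
    moreover have "b < d" using bd by (simp add: inversions_def)
    ultimately have "contains_pattern n \<pi> [3, 4, 1, 2]"
      unfolding contains_3412_iff
      by (intro exI[of _ "pos \<pi> d"] exI[of _ "pos \<pi> m"] exI[of _ "pos \<pi> a"] exI[of _ "pos \<pi> b"])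
        (use ab(1) dm in \<open>simp add: permutes_inverses[OF \<pi>]\<close>)
    then show False using Av by (simp add: Av_def)
  qed
qed


section \<open>Direct sums of unimodal cycles\<close>

lemma cycle_of_list_nth:
  assumes "distinct cs" "i < length cs"
  shows "cycle_of_list cs (cs ! i) = cs ! (Suc i mod length cs)"
proof -
  have "map (cycle_of_list cs) cs = rotate1 cs"
    using cyclic_rotation[OF assms(1), of 1] by simp
  then have "map (cycle_of_list cs) cs ! i = rotate1 cs ! i" by simp
  then show ?thesis using assms(2) by (simp add: nth_rotate1)
qed

text \<open>
  Two elements that \<open>\<pi>\<close> moves up have their intervals \<open>[x, \<pi> x]\<close> side by side, and likewise two
  elements that \<open>\<pi>\<close> does not move up the intervals \<open>[\<pi> x, x]\<close>. Permutations in \<open>Av(321, 3412)\<close> are those with this property, but it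
  is also what the two monotone parts of a unimodal cycle yield directly.
\<close>

definition interleaving :: "nat set \<Rightarrow> (nat \<Rightarrow> nat) \<Rightarrow> bool" where
  "interleaving S \<pi> \<longleftrightarrow> (\<forall>x\<in>S. \<forall>y\<in>S. x < y \<longrightarrow>
     (\<pi> x > x \<and> \<pi> y > y \<longrightarrow> \<pi> x \<le> y) \<and> (\<pi> x \<le> x \<and> \<pi> y \<le> y \<longrightarrow> x \<le> \<pi> y))"

text \<open>
  An element before the peak is sent to the next larger element of the increasing part, an element from
  the peak on to the next smaller one of the decreasing part. The last entry of the list is special:
  it is sent to the first, which may be larger or smaller than it.
\<close>

lemma unimodal_cycle_interleaving:
  assumes "unimodal_cycle a b \<sigma>"
  shows "interleaving {a..b} \<sigma>"
proof -
  obtain cs k where cs: "distinct cs" "set cs = {a..b}" "cycle_of_list cs = \<sigma>" "unimodal (rotate k cs)"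
    using assms by (auto simp: unimodal_cycle_def)
  define L where "L = rotate k cs"
  let ?n = "length L"
  have L: "distinct L" "set L = {a..b}" "cycle_of_list L = \<sigma>"
    using cs cycle_of_list_rotate_independent[OF cs(1), of k] by (simp_all add: L_def)
  obtain j where j: "j < ?n" "sorted_wrt (<) (take (Suc j) L)" "sorted_wrt (>) (drop j L)"
    using cs(4) by (auto simp: unimodal_def L_def)
  have inc: "L ! p < L ! q" if "p < q" "q \<le> j" for p q
    using sorted_wrt_nth_less[OF j(2), of p q] that j(1) by simp
  have dec: "L ! q < L ! p" if "j \<le> p" "p < q" "q < ?n" for p q
    using sorted_wrt_nth_less[OF j(3), of "p - j" "q - j"] that by simp
  have \<sigma>: "\<sigma> (L ! p) = (if Suc p = ?n then L ! 0 else L ! Suc p)" if "p < ?n" for p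
    using cycle_of_list_nth[OF L(1) that] that L(3) by simp
  show ?thesis
    unfolding interleaving_def
  proof (intro ballI impI)
    fix x y assume "x \<in> {a..b}" "y \<in> {a..b}" and xy: "x < y"
    then obtain p q where p: "p < ?n" "x = L ! p" and q: "q < ?n" "y = L ! q"
      unfolding L(2)[symmetric] by (metis in_set_conv_nth)
    have up_le: "\<sigma> x \<le> y" if up: "\<sigma> x > x" "\<sigma> y > y"
    proof -
      have *: "r < j \<or> Suc r = ?n \<and> L ! r < L ! 0" if "r < ?n" "\<sigma> (L ! r) > L ! r" for r
        using that \<sigma>[of r] dec[of r "Suc r"] by (cases "r < j") (auto split: if_splits)
      have first: "L ! 0 \<le> L ! r" if "r \<le> j" for r
        using inc[of 0 r] that by (cases "r = 0") auto
      show ?thesis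
      proof (cases "p < j")
        case True
        have "q < j"
        proof (rule ccontr)
          assume "\<not> q < j"
          then have "L ! q < L ! 0" using *[of q] q up by auto
          then show False using first[of p] True xy p q by simp
        qed
        then have "p < q" using inc[of q p] True xy p q by (cases p q rule: linorder_cases) auto
        then have "L ! Suc p \<le> L ! q" using inc[of "Suc p" q] \<open>q < j\<close> by (cases "Suc p = q") auto
        then show ?thesis using \<sigma>[OF p(1)] p q \<open>q < j\<close> \<open>p < q\<close> by simp
      next
        case False
        then have p': "Suc p = ?n" "L ! p < L ! 0" using *[of p] p up by auto
        have "q \<noteq> p" using xy p q by auto
        then have "q < j" using *[of q] q up p'(1) by auto
        then show ?thesis using first[of q] \<sigma>[OF p(1)] p' p q by simp
      qed
    qed
    have down_le: "x \<le> \<sigma> y" if down: "\<sigma> x \<le> x" "\<sigma> y \<le> y"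
    proof -
      have *: "j \<le> r" if "r < ?n" "\<sigma> (L ! r) \<le> L ! r" for r
      proof (rule ccontr)
        assume "\<not> j \<le> r"
        then show False using \<sigma>[of r] that inc[of r "Suc r"] j(1) by (auto split: if_splits)
      qed
      have pj: "j \<le> p" "j \<le> q" using * p q down by auto
      have "q < p" using dec[of p q] pj p q xy by (cases p q rule: linorder_cases) auto
      then have "L ! p \<le> L ! Suc q" using dec[of "Suc q" p] pj p by (cases "Suc q = p") auto
      then show ?thesis using \<sigma>[OF q(1)] \<open>q < p\<close> p q by simp
    qed
    from up_le down_le show "(x < \<sigma> x \<and> y < \<sigma> y \<longrightarrow> \<sigma> x \<le> y) \<and> (\<sigma> x \<le> x \<and> \<sigma> y \<le> y \<longrightarrow> x \<le> \<sigma> y)"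
      by blast
  qed
qed

lemma direct_sumE:
  assumes "direct_sum_of_unimodal_cycles n \<pi>"
  obtains P where "partition_on {1..n} P"
    and "\<forall>I\<in>P. \<exists>a b. a \<le> b \<and> I = {a..b} \<and> \<pi> ` I = I \<and> unimodal_cycle a b (perm_restrict \<pi> I)"
  using assms unfolding direct_sum_of_unimodal_cycles_def by (elim exE conjE)

lemma direct_sum_interleaving:
  assumes "direct_sum_of_unimodal_cycles n \<pi>"
  shows "interleaving {1..n} \<pi>"
  unfolding interleaving_def
proof (intro ballI impI)
  fix x y assume xy: "x \<in> {1..n}" "y \<in> {1..n}" "x < y"
  from assms obtain P where P: "partition_on {1..n} P"
    and blocks: "\<And>I. I \<in> P \<Longrightarrow> \<exists>a b. a \<le> b \<and> I = {a..b} \<and> \<pi> ` I = I \<and> unimodal_cycle a b (perm_restrict \<pi> I)"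
    by (rule direct_sumE) (erule that, erule bspec)
  have "x \<in> \<Union>P" "y \<in> \<Union>P" using partition_onD1[OF P] xy by auto
  then obtain I J where I: "I \<in> P" "x \<in> I" and J: "J \<in> P" "y \<in> J" by blast
  show "(x < \<pi> x \<and> y < \<pi> y \<longrightarrow> \<pi> x \<le> y) \<and> (\<pi> x \<le> x \<and> \<pi> y \<le> y \<longrightarrow> x \<le> \<pi> y)"
  proof (cases "I = J")
    case True
    obtain a b where ab: "I = {a..b}" "unimodal_cycle a b (perm_restrict \<pi> I)"
      using blocks[OF I(1)] by blast
    have "interleaving I (perm_restrict \<pi> I)"
      using unimodal_cycle_interleaving[OF ab(2)] ab(1) by simp
    then show ?thesis
      using I J True xy(3) unfolding interleaving_def by (auto simp: perm_restrict_def)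
  next
    case False
    then have disj: "I \<inter> J = {}" using disjointD[OF partition_onD2[OF P] I(1) J(1)] by simp
    obtain a b c d where ab: "I = {a..b}" and cd: "J = {c..d}"
      using blocks[OF I(1)] blocks[OF J(1)] by blast
    have "y \<notin> {a..b}" "x \<notin> {c..d}" using disj I J ab cd by auto
    then have "b < y" "x < c" using I J ab cd xy(3) by auto
    moreover have "\<pi> x \<in> I" "\<pi> y \<in> J" using blocks[OF I(1)] blocks[OF J(1)] I J by blast+
    ultimately show ?thesis using ab cd by auto
  qed
qed

text \<open>
  In an inverted pair the left value must go up and the right one must not. A 321 would have a middle
  element of both kinds, and for a 3412 at positions \<open>p < q < r < s\<close> the inequalities give
  \<open>\<pi> p \<le> q < r \<le> \<pi> s\<close>.
\<close>

lemma interleaving_Av: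
  assumes \<pi>: "\<pi> permutes {1..n}" and "interleaving {1..n} \<pi>"
  shows "\<pi> \<in> Av n {[3, 2, 1], [3, 4, 1, 2]}"
proof -
  have up: "\<pi> x \<le> y" if "1 \<le> x" "x < y" "y \<le> n" "x < \<pi> x" "y < \<pi> y" for x y
    using assms(2) that unfolding interleaving_def by simp
  have down: "x \<le> \<pi> y" if "1 \<le> x" "x < y" "y \<le> n" "\<pi> x \<le> x" "\<pi> y \<le> y" for x y
    using assms(2) that unfolding interleaving_def by simp
  have inj: "\<pi> x = \<pi> y \<longleftrightarrow> x = y" for x y using inj_eq[OF permutes_inj[OF \<pi>]] .
  have inverted: "p < \<pi> p \<and> \<pi> q \<le> q" if "1 \<le> p" "p < q" "q \<le> n" "\<pi> q < \<pi> p" for p q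
    using up[of p q] down[of p q] that by linarith
  have "\<not> contains_pattern n \<pi> [3, 2, 1]"
  proof
    assume "contains_pattern n \<pi> [3, 2, 1]"
    then obtain p q r where "1 \<le> p" "p < q" "q < r" "r \<le> n" "\<pi> q < \<pi> p" "\<pi> r < \<pi> q"
      unfolding contains_321_iff by blast
    then show False using inverted[of p q] inverted[of q r] by simp
  qed
  moreover have "\<not> contains_pattern n \<pi> [3, 4, 1, 2]"
  proof
    assume "contains_pattern n \<pi> [3, 4, 1, 2]"
    then obtain p q r s where *: "1 \<le> p" "p < q" "q < r" "r < s" "s \<le> n" "\<pi> r < \<pi> s" "\<pi> s < \<pi> p" "\<pi> p < \<pi> q"
      unfolding contains_3412_iff by blast
    have "\<pi> p \<le> q" "r \<le> \<pi> s"
      using inverted[of p r] inverted[of q s] up[of p q] down[of r s] * by auto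
    then show False using * by linarith
  qed
  ultimately show ?thesis using \<pi> by (simp add: Av_def)
qed

lemma transpose_comp_conj:
  "inj f \<Longrightarrow> f \<circ> transpose a b = transpose (f a) (f b) \<circ> f"
  by (auto simp: fun_eq_iff transpose_def inj_eq)

text \<open>
  Multiplication by \<open>(n, n + 1)\<close> on the left inserts \<open>n + 1\<close> just before \<open>n\<close> in the cycle, and
  multiplication on the right just after. Since \<open>n\<close> is the peak, the cycle stays unimodal.
\<close>

lemma unimodal_cycle_extend:
  assumes "unimodal_cycle a n \<rho>" "a \<le> n"
  shows "unimodal_cycle a (Suc n) (transpose n (Suc n) \<circ> \<rho>)"
    and "unimodal_cycle a (Suc n) (\<rho> \<circ> transpose n (Suc n))"
proof -
  obtain cs k where cs: "distinct cs" "set cs = {a..n}" "cycle_of_list cs = \<rho>" "unimodal (rotate k cs)"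
    using assms(1) by (auto simp: unimodal_cycle_def)
  define L where "L = rotate k cs"
  have L: "distinct L" "set L = {a..n}" "cycle_of_list L = \<rho>"
    using cs cycle_of_list_rotate_independent[OF cs(1), of k] by (simp_all add: L_def)
  obtain j where j: "j < length L" "sorted_wrt (<) (take (Suc j) L)" "sorted_wrt (>) (drop j L)"
    using cs(4) by (auto simp: unimodal_def L_def)
  define xs ys where "xs = take j L" and "ys = drop (Suc j) L"
  have L_split: "L = xs @ L ! j # ys" using id_take_nth_drop[OF j(1)] by (simp add: xs_def ys_def)
  have inc: "sorted_wrt (<) (xs @ [L ! j])" and dec: "sorted_wrt (>) (L ! j # ys)"
    using j by (simp_all add: xs_def ys_def take_Suc_conv_app_nth Cons_nth_drop_Suc)
  have "n \<in> set L" using L(2) assms(2) by simp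
  then have "n \<in> set xs \<or> n = L ! j \<or> n \<in> set ys" using L_split by (metis Un_iff set_append set_ConsD)
  moreover have "L ! j \<le> n" using L(2) nth_mem[OF j(1)] by simp
  ultimately have peak: "L ! j = n" using inc dec by (auto simp: sorted_wrt_append)
  have split: "L = xs @ n # ys" and d: "distinct (xs @ n # ys)" and set: "set xs \<union> set ys \<union> {n} = {a..n}"
    using L_split L(1,2) peak by auto
  have inc: "sorted_wrt (<) (xs @ [n])" and dec: "sorted_wrt (>) (n # ys)"
    using inc dec peak by simp_all
  have "Suc n \<notin> set xs \<union> set ys \<union> {n}" unfolding set by simp
  then have new: "Suc n \<notin> set xs" "Suc n \<notin> set ys" by simp_all
  have set': "set xs \<union> set ys \<union> {n, Suc n} = {a..Suc n}"
    using set assms(2) by (auto simp: atLeastAtMostSuc_conv)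
  have rot: "cycle_of_list (us @ vs) = cycle_of_list (vs @ us)" if "distinct (us @ vs)" for us vs :: "nat list"
    using cycle_of_list_rotate_independent[OF that, of "length us"] by (simp add: rotate_append)
  have *: "unimodal_cycle a (Suc n) \<tau>"
    if "unimodal M" "distinct M" "set M = {a..Suc n}" "cycle_of_list M = \<tau>" for M \<tau>
    unfolding unimodal_cycle_def using that by (intro exI[of _ M] conjI exI[of _ 0]) auto
  show "unimodal_cycle a (Suc n) (transpose n (Suc n) \<circ> \<rho>)"
  proof (rule *)
    let ?M = "xs @ Suc n # n # ys"
    have lt: "x < Suc n" if "x \<in> set xs \<union> set ys" for x using that set by auto
    show "unimodal ?M"
      unfolding unimodal_def
      by (rule exI[of _ "length xs"]) (use inc dec lt in \<open>auto simp: sorted_wrt_append\<close>)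
    show "distinct ?M" "set ?M = {a..Suc n}" using d new set' by auto
    then have "cycle_of_list ?M = cycle_of_list (Suc n # n # ys @ xs)"
      using rot[of xs "Suc n # n # ys"] by simp
    also have "\<dots> = transpose (Suc n) n \<circ> cycle_of_list (n # ys @ xs)" by simp
    also have "cycle_of_list (n # ys @ xs) = \<rho>"
      using rot[of xs "n # ys"] d split L(3) by simp
    also have "transpose (Suc n) n = transpose n (Suc n)" by (rule transpose_commute)
    finally show "cycle_of_list ?M = transpose n (Suc n) \<circ> \<rho>" .
  qed
  show "unimodal_cycle a (Suc n) (\<rho> \<circ> transpose n (Suc n))"
  proof (rule *)
    let ?M = "xs @ n # Suc n # ys"
    have lt: "x < Suc n" if "x \<in> set xs \<union> set ys" for x using that set by auto
    show "unimodal ?M"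
      unfolding unimodal_def
      by (rule exI[of _ "Suc (length xs)"]) (use inc dec lt in \<open>auto simp: sorted_wrt_append\<close>)
    show dM: "distinct ?M" and "set ?M = {a..Suc n}" using d new set' by auto
    obtain q qs where q: "ys @ xs @ [n] = q # qs" by (cases "ys @ xs @ [n]") auto
    have \<rho>: "cycle_of_list (q # qs) = \<rho>"
      using rot[of "xs @ [n]" ys] d split L(3) q by simp
    have "distinct (q # qs)" using d q[symmetric] by auto
    then have "map \<rho> (q # qs) = rotate1 (q # qs)"
      using cyclic_rotation[of "q # qs" 1] \<rho> by simp
    then have "last (map \<rho> (ys @ xs @ [n])) = last (rotate1 (q # qs))" using q by simp
    then have \<rho>n: "\<rho> n = q" by simp
    have "Suc n \<notin> set (q # qs)" unfolding q[symmetric] using new by simp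
    then have \<rho>S: "\<rho> (Suc n) = Suc n" using id_outside_supp[of "Suc n" "q # qs"] \<rho> by simp
    have "inj \<rho>" using permutes_inj[OF cycle_permutes[of "q # qs"]] \<rho> by simp
    have "cycle_of_list ?M = cycle_of_list (Suc n # ys @ xs @ [n])"
      using rot[of "xs @ [n]" "Suc n # ys"] dM by simp
    also have "\<dots> = transpose (Suc n) q \<circ> \<rho>" unfolding q using \<rho> by simp
    also have "\<dots> = \<rho> \<circ> transpose n (Suc n)"
      unfolding transpose_comp_conj[OF \<open>inj \<rho>\<close>] \<rho>n \<rho>S by (simp only: transpose_commute[of q])
    finally show "cycle_of_list ?M = \<rho> \<circ> transpose n (Suc n)" .
  qed
qed

lemma direct_sum_extend_fixed:
  assumes \<pi>: "\<pi> permutes {1..n}" and "direct_sum_of_unimodal_cycles n \<pi>"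
  shows "direct_sum_of_unimodal_cycles (Suc n) \<pi>"
proof -
  from assms(2) obtain P where P: "partition_on {1..n} P"
    and blocks: "\<And>I. I \<in> P \<Longrightarrow> \<exists>a b. a \<le> b \<and> I = {a..b} \<and> \<pi> ` I = I \<and> unimodal_cycle a b (perm_restrict \<pi> I)"
    by (rule direct_sumE) (erule that, erule bspec)
  have fixed: "\<pi> (Suc n) = Suc n" using permutes_not_in[OF \<pi>] by simp
  have "unimodal_cycle (Suc n) (Suc n) id"
    unfolding unimodal_cycle_def
    by (intro exI[of _ "[Suc n]"] conjI exI[of _ 0]) (auto simp: unimodal_def)
  moreover have "perm_restrict \<pi> {Suc n} = id" using fixed by (auto simp: perm_restrict_def)
  moreover have "partition_on {1..Suc n} (insert {Suc n} P)"
  proof -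
    have "{1..Suc n} - {Suc n} = {1..n}" by auto
    moreover have "disjnt {Suc n} (\<Union>P)" using P by (simp add: partition_on_def)
    ultimately show ?thesis using P by (simp add: partition_on_insert)
  qed
  moreover have "\<exists>a b. a \<le> b \<and> {Suc n} = {a..b} \<and> \<pi> ` {Suc n} = {Suc n}
      \<and> unimodal_cycle a b (perm_restrict \<pi> {Suc n})"
    using fixed calculation(1,2) by (intro exI[of _ "Suc n"]) simp
  ultimately show ?thesis
    unfolding direct_sum_of_unimodal_cycles_def
    by (intro exI[of _ "insert {Suc n} P"] conjI ballI) (assumption, elim insertE, simp only:, erule blocks)
qed

lemma direct_sum_extend_swap:
  assumes \<pi>: "\<pi> permutes {1..n}" and sum: "direct_sum_of_unimodal_cycles n \<pi>" and "1 \<le> n"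
    and \<tau>: "\<tau> = transpose n (Suc n) \<circ> \<pi> \<or> \<tau> = \<pi> \<circ> transpose n (Suc n)"
  shows "direct_sum_of_unimodal_cycles (Suc n) \<tau>"
proof -
  let ?s = "transpose n (Suc n)"
  from sum obtain P where P: "partition_on {1..n} P"
    and blocks: "\<And>I. I \<in> P \<Longrightarrow> \<exists>a b. a \<le> b \<and> I = {a..b} \<and> \<pi> ` I = I \<and> unimodal_cycle a b (perm_restrict \<pi> I)"
    by (rule direct_sumE) (erule that, erule bspec)
  have "n \<in> \<Union>P" using partition_onD1[OF P] \<open>1 \<le> n\<close> by auto
  then obtain I where I: "I \<in> P" "n \<in> I" by blast
  obtain a b where ab: "a \<le> b" "I = {a..b}" "\<pi> ` I = I" "unimodal_cycle a b (perm_restrict \<pi> I)"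
    using blocks[OF I(1)] by blast
  have sub: "J \<subseteq> {1..n}" if "J \<in> P" for J using partition_onD1[OF P] that by auto
  have "b \<in> I" using ab by simp
  then have "b = n" using sub[OF I(1)] I(2) ab(2) by force
  then have I_eq: "I = {a..n}" and a: "a \<le> n" using ab by auto
  let ?I = "{a..Suc n}"
  have I': "?I = insert (Suc n) I" using a I_eq by auto
  have fixed: "\<pi> (Suc n) = Suc n" using permutes_not_in[OF \<pi>] by simp
  have s_I: "?s ` ?I = ?I" using permutes_image[OF permutes_swap_id[of n ?I "Suc n"]] a by simp
  have \<pi>_I: "\<pi> ` ?I = ?I" unfolding I' using ab(3) fixed by simp
  have \<tau>_I: "\<tau> ` ?I = ?I"
    using \<tau> by (elim disjE) (simp_all only: image_comp[symmetric] s_I \<pi>_I)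
  have inI: "x \<in> I \<Longrightarrow> \<pi> x \<in> I" for x using ab(3) by blast
  have restr: "perm_restrict (?s \<circ> \<pi>) ?I = ?s \<circ> perm_restrict \<pi> I"
    "perm_restrict (\<pi> \<circ> ?s) ?I = perm_restrict \<pi> I \<circ> ?s"
    using fixed I_eq a by (auto simp: perm_restrict_def fun_eq_iff transpose_def)
  have "unimodal_cycle a (Suc n) (perm_restrict \<tau> ?I)"
    using \<tau> unimodal_cycle_extend[of a n "perm_restrict \<pi> I"] ab(4) \<open>b = n\<close> a restr by auto
  moreover have "\<tau> ` J = J" "perm_restrict \<tau> J = perm_restrict \<pi> J" if J: "J \<in> P" "J \<noteq> I" for J
  proof -
    have "I \<inter> J = {}" using disjointD[OF partition_onD2[OF P] I(1) J(1)] J(2) by simp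
    then have "n \<notin> J" "Suc n \<notin> J" and \<pi>J: "\<pi> ` J = J"
      using I(2) sub[OF J(1)] blocks[OF J(1)] by auto
    then have eq: "\<tau> x = \<pi> x" if "x \<in> J" for x
    proof -
      have "\<pi> x \<in> J" using that \<pi>J by blast
      then show ?thesis
        using \<tau> that \<open>n \<notin> J\<close> \<open>Suc n \<notin> J\<close> by (auto simp: transpose_def)
    qed
    then show "\<tau> ` J = J" using \<pi>J by simp
    show "perm_restrict \<tau> J = perm_restrict \<pi> J" using eq by (auto simp: perm_restrict_def)
  qed
  moreover have "partition_on {1..Suc n} (insert ?I (P - {I}))"
  proof -
    have "insert I (P - {I}) = P" using I(1) by auto
    moreover have disj: "disjnt I (\<Union>(P - {I}))"
      using P I(1) unfolding partition_on_def disjoint_def disjnt_def by auto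
    ultimately have "partition_on ({1..n} - I) (P - {I})"
      using P partition_on_insert[OF disj, of "{1..n}"] by simp
    moreover have "{1..Suc n} - ?I = {1..n} - I" unfolding I' by auto
    moreover have "Suc n \<notin> \<Union>(P - {I})" using sub by force
    then have "disjnt ?I (\<Union>(P - {I}))" using disj unfolding I' by (simp add: disjnt_insert1)
    moreover have "?I \<subseteq> {1..Suc n}" unfolding I' using sub[OF I(1)] by auto
    moreover have "?I \<noteq> {}" unfolding I' by simp
    ultimately show ?thesis using partition_on_insert[of ?I "P - {I}" "{1..Suc n}"] by simp
  qed
  ultimately show ?thesis
    unfolding direct_sum_of_unimodal_cycles_def
  proof (intro exI[of _ "insert ?I (P - {I})"] conjI ballI, goal_cases)
    case (2 J)
    show ?case
    proof (cases "J = ?I")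
      case True
      then show ?thesis using 2(1) \<tau>_I a by (intro exI[of _ a] exI[of _ "Suc n"]) simp
    next
      case False
      then have "J \<in> P" "J \<noteq> I" using 2(5) by auto
      then show ?thesis unfolding 2(2)[OF \<open>J \<in> P\<close> \<open>J \<noteq> I\<close>] 2(3)[OF \<open>J \<in> P\<close> \<open>J \<noteq> I\<close>]
        using blocks[OF \<open>J \<in> P\<close>] by blast
    qed
  qed
qed

lemma distinct_word_direct_sum:
  "set ws \<subseteq> {1..<n} \<Longrightarrow> distinct ws \<Longrightarrow> direct_sum_of_unimodal_cycles n (simple_word_perm ws)"
proof (induction n arbitrary: ws)
  case 0
  then show ?case
    unfolding direct_sum_of_unimodal_cycles_def by (intro exI[of _ "{}"]) (simp add: partition_on_def)
next
  case (Suc n)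
  show ?case
  proof (cases "n \<in> set ws")
    case False
    then have ws: "set ws \<subseteq> {1..<n}" using Suc.prems(1) by (force simp: less_Suc_eq)
    show ?thesis
      by (rule direct_sum_extend_fixed[OF simple_word_perm_permutes[OF ws] Suc.IH[OF ws Suc.prems(2)]])
  next
    case True
    then obtain u v where ws: "ws = u @ n # v" by (auto simp: in_set_conv_decomp)
    have n: "1 \<le> n" using Suc.prems(1) ws by auto
    have "x \<in> {1..<n}" if "x \<in> set (u @ v)" for x
    proof -
      have "x \<in> {1..<Suc n}" "x \<noteq> n" using that Suc.prems ws by auto
      then show ?thesis by auto
    qed
    then have uv: "set (u @ v) \<subseteq> {1..<n}" by blast
    have d: "distinct (u @ v)" "set u \<inter> set v = {}" using Suc.prems(2) ws by auto
    \<comment> \<open>The letter \<open>n\<close> commutes with every letter except \<open>n - 1\<close>, which lies on one side of it only.\<close>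
    have comm: "transpose n (n + 1) \<circ> simple_word_perm w = simple_word_perm w \<circ> transpose n (n + 1)"
      if w: "set w \<subseteq> {1..<n - 1}" for w
    proof -
      have p: "simple_word_perm w permutes {1..n - 1}" by (rule simple_word_perm_permutes[OF w])
      have "simple_word_perm w n = n" "simple_word_perm w (n + 1) = n + 1"
        using permutes_not_in[OF p] n by auto
      then show ?thesis using transpose_comp_conj[OF permutes_inj[OF p], of n "n + 1"] by simp
    qed
    have small: "set w \<subseteq> {1..<n - 1}" if "set w \<subseteq> set (u @ v)" "n - 1 \<notin> set w" for w
    proof
      fix x assume "x \<in> set w"
      then have "x \<in> {1..<n}" "x \<noteq> n - 1" using that uv by blast+
      then show "x \<in> {1..<n - 1}" by auto
    qed
    have "n - 1 \<notin> set u \<or> n - 1 \<notin> set v" using d(2) by blast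
    then have "simple_word_perm ws = transpose n (Suc n) \<circ> simple_word_perm (u @ v)
        \<or> simple_word_perm ws = simple_word_perm (u @ v) \<circ> transpose n (Suc n)"
    proof
      assume "n - 1 \<notin> set u"
      then have "transpose n (n + 1) \<circ> simple_word_perm u = simple_word_perm u \<circ> transpose n (n + 1)"
        by (intro comm small) auto
      then have "transpose n (n + 1) \<circ> simple_word_perm u \<circ> simple_word_perm v
          = simple_word_perm u \<circ> transpose n (n + 1) \<circ> simple_word_perm v" by simp
      then show ?thesis by (simp add: ws simple_word_perm_append comp_assoc)
    next
      assume "n - 1 \<notin> set v"
      then have "transpose n (n + 1) \<circ> simple_word_perm v = simple_word_perm v \<circ> transpose n (n + 1)"
        by (intro comm small) auto
      then have "simple_word_perm u \<circ> (transpose n (n + 1) \<circ> simple_word_perm v)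
          = simple_word_perm u \<circ> (simple_word_perm v \<circ> transpose n (n + 1))" by simp
      then show ?thesis by (simp add: ws simple_word_perm_append comp_assoc)
    qed
    then show ?thesis
      by (rule direct_sum_extend_swap[OF simple_word_perm_permutes[OF uv] Suc.IH[OF uv d(1)] n])
  qed
qed


section \<open>The matrix groups\<close>

lemma GL_carrier: "carrier (GL n) = {A \<in> carrier_mat n n. det A \<noteq> 0}"
proof -
  have "A \<in> Units (ring_mat TYPE(complex) n ()) \<longleftrightarrow> A \<in> carrier_mat n n \<and> det A \<noteq> 0" for A
    using det_non_zero_imp_unit[of A n "()"] unit_imp_det_non_zero[of A n "()"]
    by (auto simp: Units_def ring_mat_simps)
  then show ?thesis by (auto simp: units_of_carrier)
qed

lemma GL_coset: "g <#\<^bsub>GL n\<^esub> S = (\<lambda>h. g * h) ` S"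
  by (auto simp: l_coset_def units_of_mult ring_mat_simps)

lemma mat_mult_index:
  "A \<in> carrier_mat n n \<Longrightarrow> B \<in> carrier_mat n n \<Longrightarrow> i < n \<Longrightarrow> j < n \<Longrightarrow>
    (A * B) $$ (i, j) = (\<Sum>k<n. A $$ (i, k) * B $$ (k, j))"
  by (auto simp: scalar_prod_def lessThan_atLeast0 intro!: sum.cong)

lemma det_upper:
  assumes "A \<in> carrier_mat m m" "upper_triangular A"
  shows "det A = (\<Prod>i<m. A $$ (i, i))"
  using assms by (simp add: det_upper_triangular prod_list_diag_prod lessThan_atLeast0)

lemma borel_iff:
  "b \<in> borel_subgroup n \<longleftrightarrow>
     b \<in> carrier_mat n n \<and> (\<forall>i<n. \<forall>j<i. b $$ (i, j) = 0) \<and> (\<forall>i<n. b $$ (i, i) \<noteq> 0)"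
  by (auto simp: borel_subgroup_def GL_carrier upper_triangular_def det_upper)

lemma torus_iff:
  "t \<in> torus n \<longleftrightarrow>
     t \<in> carrier_mat n n \<and> (\<forall>i<n. \<forall>j<n. i \<noteq> j \<longrightarrow> t $$ (i, j) = 0) \<and> (\<forall>i<n. t $$ (i, i) \<noteq> 0)"
proof -
  have "upper_triangular t" if "t \<in> carrier_mat n n" "diagonal_mat t"
    using that by (auto simp: upper_triangular_def diagonal_mat_def)
  then show ?thesis
    by (auto simp: torus_def GL_carrier det_upper diagonal_mat_def)
qed

lemma borel_GL: "b \<in> borel_subgroup n \<Longrightarrow> b \<in> carrier (GL n)"
  by (simp add: borel_subgroup_def)

lemma torus_GL: "t \<in> torus n \<Longrightarrow> t \<in> carrier (GL n)"
  by (simp add: torus_def)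

lemma GL_mult: "g \<in> carrier (GL n) \<Longrightarrow> h \<in> carrier (GL n) \<Longrightarrow> g * h \<in> carrier (GL n)"
  by (auto simp: GL_carrier det_mult)

lemma GL_mat: "g \<in> carrier (GL n) \<Longrightarrow> g \<in> carrier_mat n n"
  by (simp add: GL_carrier)

lemma borel_mult:
  assumes a: "a \<in> borel_subgroup n" and b: "b \<in> borel_subgroup n"
  shows "a * b \<in> borel_subgroup n"
proof -
  have ab: "a \<in> carrier_mat n n" "b \<in> carrier_mat n n" using a b by (auto simp: borel_iff)
  have "(a * b) $$ (i, j) = 0" if ij: "i < n" "j < i" for i j
    unfolding mat_mult_index[OF ab ij(1) less_trans[OF ij(2,1)]]
  proof (intro sum.neutral ballI)
    fix k assume "k \<in> {..<n}"
    then show "a $$ (i, k) * b $$ (k, j) = 0"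
      using a b ij by (cases "k < i") (auto simp: borel_iff)
  qed
  moreover have "det (a * b) \<noteq> 0" using GL_mult[OF borel_GL[OF a] borel_GL[OF b]] by (simp add: GL_carrier)
  ultimately show ?thesis
    using ab by (simp add: borel_subgroup_def GL_carrier upper_triangular_def)
qed

text \<open>
  Back substitution, which works on any set of indices because a principal submatrix of a triangular
  matrix is triangular. It provides both the inverses in \<open>B\<close> and the normal form of points in a Schubert
  cell.
\<close>

lemma triangular_solve:
  fixes b :: "nat \<Rightarrow> nat \<Rightarrow> 'a::field"
  assumes "finite S" and "\<And>i. i \<in> S \<Longrightarrow> b i i \<noteq> 0" and "\<And>i j. i \<in> S \<Longrightarrow> j \<in> S \<Longrightarrow> j < i \<Longrightarrow> b i j = 0"
  shows "\<exists>v. (\<forall>k. k \<notin> S \<longrightarrow> v k = 0) \<and> (\<forall>i\<in>S. (\<Sum>k\<in>S. b i k * v k) = w i)"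
  using assms
proof (induction S rule: finite_linorder_min_induct)
  case (insert m S)
  have "\<exists>v. (\<forall>k. k \<notin> S \<longrightarrow> v k = 0) \<and> (\<forall>i\<in>S. (\<Sum>k\<in>S. b i k * v k) = w i)"
    by (rule insert.IH) (use insert.prems in auto)
  then obtain v where v: "\<And>k. k \<notin> S \<Longrightarrow> v k = 0" "\<And>i. i \<in> S \<Longrightarrow> (\<Sum>k\<in>S. b i k * v k) = w i"
    by blast
  have m: "m \<notin> S" using insert.hyps(2) by auto
  let ?v = "v(m := (w m - (\<Sum>k\<in>S. b m k * v k)) / b m m)"
  have S: "(\<Sum>k\<in>S. b i k * ?v k) = (\<Sum>k\<in>S. b i k * v k)" for i
    by (rule sum.cong) (use m in auto)
  have "(\<Sum>k\<in>insert m S. b i k * ?v k) = w i" if "i \<in> insert m S" for i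
    unfolding sum.insert[OF insert.hyps(1) m] S
    using that v(2) insert.hyps(2) insert.prems m by auto
  moreover have "?v k = 0" if "k \<notin> insert m S" for k using that v(1) by auto
  ultimately show ?case by blast
qed auto

lemma borel_inverse:
  assumes b: "b \<in> borel_subgroup n"
  shows "\<exists>c\<in>borel_subgroup n. b * c = 1\<^sub>m n \<and> c * b = 1\<^sub>m n"
proof -
  have bm: "b \<in> carrier_mat n n" using b by (simp add: borel_iff)
  have "\<forall>j\<in>{..<n}. \<exists>v. (\<forall>k. k \<notin> {..j} \<longrightarrow> v k = 0) \<and>
      (\<forall>i\<in>{..j}. (\<Sum>k\<in>{..j}. b $$ (i, k) * v k) = of_bool (i = j))"
    using b by (intro ballI triangular_solve) (auto simp: borel_iff)
  from bchoice[OF this] obtain v where v': "\<forall>j\<in>{..<n}. (\<forall>k. k \<notin> {..j} \<longrightarrow> v j k = 0) \<and>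
      (\<forall>i\<in>{..j}. (\<Sum>k\<in>{..j}. b $$ (i, k) * v j k) = of_bool (i = j))" ..
  have v: "v j k = 0" if "j < n" "j < k" for j k
    using v' that by simp
  have v2: "(\<Sum>k\<le>j. b $$ (i, k) * v j k) = of_bool (i = j)" if "j < n" "i \<le> j" for i j
    using v' that by simp
  define c where "c = mat n n (\<lambda>(k, j). v j k)"
  have cm: "c \<in> carrier_mat n n" by (simp add: c_def)
  have bc: "b * c = 1\<^sub>m n"
  proof (rule eq_matI)
    fix i j assume "i < dim_row (1\<^sub>m n :: complex mat)" "j < dim_col (1\<^sub>m n :: complex mat)"
    then have ij: "i < n" "j < n" by auto
    have "(b * c) $$ (i, j) = (\<Sum>k<n. b $$ (i, k) * v j k)"
      unfolding mat_mult_index[OF bm cm ij] using ij by (intro sum.cong) (auto simp: c_def)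
    also have "\<dots> = (\<Sum>k\<le>j. b $$ (i, k) * v j k)"
      using ij v by (intro sum.mono_neutral_right) auto
    also have "\<dots> = of_bool (i = j)"
    proof (cases "i \<le> j")
      case False
      then have "(\<Sum>k\<le>j. b $$ (i, k) * v j k) = 0"
        using b ij by (intro sum.neutral) (auto simp: borel_iff)
      then show ?thesis using False by simp
    qed (use v2 ij in simp)
    finally show "(b * c) $$ (i, j) = 1\<^sub>m n $$ (i, j)" using ij by simp
  qed (use bm cm in auto)
  have "det b * det c = 1" using det_mult[OF bm cm] bc by simp
  then have "det c \<noteq> 0" by auto
  then have "c \<in> borel_subgroup n"
    using cm v by (auto simp: borel_subgroup_def GL_carrier upper_triangular_def c_def)
  then show ?thesis using bc mat_mult_left_right_inverse[OF bm cm bc] by blast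
qed

lemma one_borel: "1\<^sub>m n \<in> borel_subgroup n"
  by (simp add: borel_iff)

abbreviation flag_of :: "nat \<Rightarrow> complex mat \<Rightarrow> complex mat set" where
  "flag_of n g \<equiv> g <#\<^bsub>GL n\<^esub> borel_subgroup n"

lemma coset_mult:
  assumes "g \<in> carrier (GL n)" "h \<in> carrier (GL n)"
  shows "g <#\<^bsub>GL n\<^esub> flag_of n h = flag_of n (g * h)"
proof -
  have "g * (h * b) = g * h * b" if "b \<in> borel_subgroup n" for b
    using assoc_mult_mat[OF GL_mat[OF assms(1)] GL_mat[OF assms(2)] GL_mat[OF borel_GL[OF that]]] by simp
  then show ?thesis unfolding GL_coset image_image by (intro image_cong) auto
qed

lemma flag_of_mult_borel:
  assumes g: "g \<in> carrier (GL n)" and b: "b \<in> borel_subgroup n"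
  shows "flag_of n (g * b) = flag_of n g"
proof -
  obtain c where c: "c \<in> borel_subgroup n" "b * c = 1\<^sub>m n" using borel_inverse[OF b] by blast
  have mats: "g \<in> carrier_mat n n" "b \<in> carrier_mat n n" "c \<in> carrier_mat n n"
    using g b c(1) by (auto simp: GL_mat borel_GL)
  have "(\<lambda>h. b * h) ` borel_subgroup n = borel_subgroup n"
  proof (intro equalityI subsetI)
    fix x assume x: "x \<in> borel_subgroup n"
    then have "x \<in> carrier_mat n n" by (simp add: borel_iff)
    then have "x = b * (c * x)"
      using assoc_mult_mat[OF mats(2,3), of x n] c(2) by simp
    then show "x \<in> (\<lambda>h. b * h) ` borel_subgroup n" using borel_mult[OF c(1) x] by blast
  qed (use borel_mult[OF b] in auto)
  then have "b <#\<^bsub>GL n\<^esub> borel_subgroup n = borel_subgroup n" unfolding GL_coset .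
  then show ?thesis using coset_mult[OF g borel_GL[OF b]] by simp
qed

lemma mem_flag_of: "g \<in> carrier (GL n) \<Longrightarrow> g \<in> flag_of n g"
  unfolding GL_coset using one_borel[of n] by (intro image_eqI[of _ _ "1\<^sub>m n"]) (auto simp: GL_carrier)

lemma flags_eq: "flags n = flag_of n ` carrier (GL n)"
  unfolding flags_def LCOSETS_def by blast

lemma topspace_flag_topology: "topspace (flag_topology n) = flags n"
  using quotient_map_flag_topology[of n] unfolding quotient_map_def flags_eq by simp

text \<open>
  A polynomial whose zero set is stable under right multiplication by \<open>B\<close> defines a closed subset of the
  flag variety.
\<close>

lemma flag_closure_polynomial_zero:
  assumes H: "H \<in> poly_functions n"
    and inv: "\<And>A b. A \<in> carrier (GL n) \<Longrightarrow> b \<in> borel_subgroup n \<Longrightarrow> H (A * b) = 0 \<longleftrightarrow> H A = 0"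
    and h: "h \<in> carrier (GL n)" and cl: "flag_of n h \<in> flag_topology n closure_of S"
    and zero: "\<And>g. g \<in> carrier (GL n) \<Longrightarrow> flag_of n g \<in> S \<Longrightarrow> H g = 0"
  shows "H h = 0"
proof (rule ccontr)
  assume "H h \<noteq> 0"
  let ?O = "{g \<in> carrier (GL n). H g \<noteq> 0}"
  have "g \<in> ?O" if g: "g \<in> carrier (GL n)" and g': "g' \<in> ?O" "flag_of n g = flag_of n g'" for g g'
  proof -
    have "g \<in> flag_of n g'" using mem_flag_of[OF g] g'(2) by simp
    then obtain b where "b \<in> borel_subgroup n" "g = g' * b" unfolding GL_coset by blast
    then show ?thesis using inv[of g' b] g'(1) g by simp
  qed
  then have pre: "{g \<in> carrier (GL n). flag_of n g \<in> flag_of n ` ?O} = ?O" by blast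
  have "zariski_open n ?O"
    unfolding zariski_open_def by (rule exI[of _ "{H}"]) (use H in auto)
  then have op: "openin (flag_topology n) (flag_of n ` ?O)"
    unfolding openin_flag_topology pre openin_zariski_GL by (auto simp: flags_eq)
  have mem: "flag_of n h \<in> flag_of n ` ?O" using h \<open>H h \<noteq> 0\<close> by blast
  have "\<forall>T. flag_of n h \<in> T \<and> openin (flag_topology n) T \<longrightarrow> (\<exists>y. y \<in> S \<and> y \<in> T)"
    using cl unfolding in_closure_of by (rule conjunct2)
  from this[rule_format, OF conjI[OF mem op]]
  obtain y where "y \<in> S" "y \<in> flag_of n ` ?O" by blast
  then show False using zero by blast
qed

lemma flag_closure_by_polynomials:
  assumes h: "h \<in> carrier (GL n)"
    and dense: "\<And>f. f \<in> poly_functions n \<Longrightarrow> f h \<noteq> 0 \<Longrightarrow> \<exists>g\<in>carrier (GL n). flag_of n g \<in> S \<and> f g \<noteq> 0"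
  shows "flag_of n h \<in> flag_topology n closure_of S"
  unfolding in_closure_of
proof (intro conjI allI impI)
  show "flag_of n h \<in> topspace (flag_topology n)" using h by (simp add: topspace_flag_topology flags_eq)
  fix T assume T: "flag_of n h \<in> T \<and> openin (flag_topology n) T"
  then have "zariski_open n {g \<in> carrier (GL n). flag_of n g \<in> T}"
    by (simp add: openin_flag_topology openin_zariski_GL)
  then obtain F where F: "F \<subseteq> poly_functions n"
    "{g \<in> carrier (GL n). flag_of n g \<in> T} = {g \<in> carrier (GL n). \<exists>f\<in>F. f g \<noteq> 0}"
    unfolding zariski_open_def by blast
  have "h \<in> {g \<in> carrier (GL n). flag_of n g \<in> T}" using T h by simp
  then obtain f where f: "f \<in> F" "f h \<noteq> 0" unfolding F(2) by blast
  then obtain g where g: "g \<in> carrier (GL n)" "flag_of n g \<in> S" "f g \<noteq> 0" using dense F(1) by blast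
  then have "g \<in> {g \<in> carrier (GL n). flag_of n g \<in> T}" unfolding F(2) using f(1) by blast
  then show "\<exists>y. y \<in> S \<and> y \<in> T" using g(2) by blast
qed

lemma poly_functions_sum:
  "finite I \<Longrightarrow> (\<And>i. i \<in> I \<Longrightarrow> f i \<in> poly_functions n) \<Longrightarrow> (\<lambda>A. \<Sum>i\<in>I. f i A) \<in> poly_functions n"
proof (induction I rule: finite_induct)
  case empty
  show ?case using poly_functions.const[of 0 n] by simp
next
  case (insert i I)
  then show ?case using poly_functions.add[of "f i" n "\<lambda>A. \<Sum>i\<in>I. f i A"] by simp
qed

lemma poly_functions_prod:
  "finite I \<Longrightarrow> (\<And>i. i \<in> I \<Longrightarrow> f i \<in> poly_functions n) \<Longrightarrow> (\<lambda>A. \<Prod>i\<in>I. f i A) \<in> poly_functions n"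
proof (induction I rule: finite_induct)
  case empty
  show ?case using poly_functions.const[of 1 n] by simp
next
  case (insert i I)
  then show ?case using poly_functions.mult[of "f i" n "\<lambda>A. \<Prod>i\<in>I. f i A"] by simp
qed

text \<open>
  Restricted to an affine line of matrices, a polynomial in the entries becomes a polynomial in one
  variable. This reduces density to the finiteness of the number of roots.
\<close>

lemma poly_functions_line:
  assumes "f \<in> poly_functions n"
    and "\<And>i j s. i < n \<Longrightarrow> j < n \<Longrightarrow> M s $$ (i, j) = a i j + s * c i j"
  shows "\<exists>p :: complex poly. \<forall>s. f (M s) = poly p s"
  using assms(1)
proof (induction rule: poly_functions.induct)
  case (const c)
  then show ?case by (intro exI[of _ "[:c:]"]) simp
next
  case (entry i j)
  then show ?case by (intro exI[of _ "[:a i j, c i j:]"]) (simp add: assms(2))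
next
  case (add f g)
  then obtain p q where "\<forall>s. f (M s) = poly p s" "\<forall>s. g (M s) = poly q s" by blast
  then show ?case by (intro exI[of _ "p + q"]) simp
next
  case (mult f g)
  then obtain p q where "\<forall>s. f (M s) = poly p s" "\<forall>s. g (M s) = poly q s" by blast
  then show ?case by (intro exI[of _ "p * q"]) simp
qed


section \<open>Coordinates on a Schubert cell\<close>

locale schubert =
  fixes n :: nat and \<pi> :: "nat \<Rightarrow> nat"
  assumes perm: "\<pi> permutes {1..n}"
begin

text \<open>The permutation \<open>\<pi>\<close> and its inverse on matrix indices, which start at 0.\<close>

definition \<rho> :: "nat \<Rightarrow> nat" where "\<rho> i = \<pi> (Suc i) - 1"
definition \<rho>' :: "nat \<Rightarrow> nat" where "\<rho>' i = pos \<pi> (Suc i) - 1"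

abbreviation P :: "complex mat" where "P \<equiv> perm_matrix n \<pi>"

lemma Suc_\<rho>: "i < n \<Longrightarrow> Suc (\<rho> i) = \<pi> (Suc i)"
  using permutes_in_image[OF perm, of "Suc i"] by (simp add: \<rho>_def)

lemma Suc_\<rho>': "i < n \<Longrightarrow> Suc (\<rho>' i) = pos \<pi> (Suc i)"
  using permutes_in_image[OF permutes_inv[OF perm], of "Suc i"] by (simp add: \<rho>'_def)

lemma \<rho>_less: "i < n \<Longrightarrow> \<rho> i < n"
  using permutes_in_image[OF perm, of "Suc i"] Suc_\<rho>[of i] by simp

lemma \<rho>'_less: "i < n \<Longrightarrow> \<rho>' i < n"
  using permutes_in_image[OF permutes_inv[OF perm], of "Suc i"] Suc_\<rho>'[of i] by simp

lemma \<rho>_\<rho>': "i < n \<Longrightarrow> \<rho> (\<rho>' i) = i"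
  by (simp add: \<rho>_def Suc_\<rho>' permutes_inverses[OF perm])

lemma \<rho>'_\<rho>: "i < n \<Longrightarrow> \<rho>' (\<rho> i) = i"
  by (simp add: \<rho>'_def Suc_\<rho> permutes_inverses[OF perm])

lemma P_carrier: "P \<in> carrier_mat n n"
  by (simp add: perm_matrix_def)

lemma P_index: "i < n \<Longrightarrow> j < n \<Longrightarrow> P $$ (i, j) = of_bool (i = \<rho> j)"
  using Suc_\<rho>[of j] by (auto simp: perm_matrix_def)

lemma mult_P_index:
  assumes A: "A \<in> carrier_mat n n" and ij: "i < n" "j < n"
  shows "(A * P) $$ (i, j) = A $$ (i, \<rho> j)"
proof -
  have "(A * P) $$ (i, j) = (\<Sum>k<n. if k = \<rho> j then A $$ (i, k) else 0)"
    unfolding mat_mult_index[OF A P_carrier ij] by (intro sum.cong) (auto simp: P_index ij)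
  then show ?thesis using \<rho>_less[OF ij(2)] by simp
qed

lemma P_mult_index:
  assumes A: "A \<in> carrier_mat n n" and ij: "i < n" "j < n"
  shows "(P * A) $$ (i, j) = A $$ (\<rho>' i, j)"
proof -
  have eq: "i = \<rho> k \<longleftrightarrow> k = \<rho>' i" if "k < n" for k
    using \<rho>_\<rho>'[OF ij(1)] \<rho>'_\<rho>[OF that] by auto
  have "(P * A) $$ (i, j) = (\<Sum>k<n. if k = \<rho>' i then A $$ (k, j) else 0)"
    unfolding mat_mult_index[OF P_carrier A ij] by (intro sum.cong) (auto simp: P_index ij eq)
  then show ?thesis using \<rho>'_less[OF ij(1)] by simp
qed

lemma P_GL: "P \<in> carrier (GL n)"
proof -
  define Q :: "complex mat" where "Q = mat n n (\<lambda>(i, j). of_bool (j = \<rho> i))"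
  have Q: "Q \<in> carrier_mat n n" by (simp add: Q_def)
  have "P * Q = 1\<^sub>m n"
  proof (rule eq_matI)
    fix i j assume "i < dim_row (1\<^sub>m n :: complex mat)" "j < dim_col (1\<^sub>m n :: complex mat)"
    then have "i < n" "j < n" by auto
    then show "(P * Q) $$ (i, j) = 1\<^sub>m n $$ (i, j)"
      using P_mult_index[OF Q] \<rho>'_less[of i] \<rho>_\<rho>'[of i] by (auto simp: Q_def)
  qed (use P_carrier Q in auto)
  then have "det P * det Q = 1" using det_mult[OF P_carrier Q] by simp
  then show ?thesis using P_carrier by (auto simp: GL_carrier)
qed

text \<open>
  The group \<open>U \<inter> \<pi> U\<^sup>- \<pi>\<^sup>-\<^sup>1\<close>, where \<open>U\<close> and \<open>U\<^sup>-\<close> consist of the upper and lower unitriangular matrices. Its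
  free entries are indexed by the inversions of \<open>\<pi>\<close>, and it parametrizes the Schubert cell.
\<close>

definition cell_matrix :: "complex mat \<Rightarrow> bool" where
  "cell_matrix v \<longleftrightarrow> v \<in> carrier_mat n n \<and> (\<forall>i<n. v $$ (i, i) = 1) \<and>
     (\<forall>i<n. \<forall>j<n. i \<noteq> j \<longrightarrow> (Suc i, Suc j) \<notin> inversions n \<pi> \<longrightarrow> v $$ (i, j) = 0)"

lemma cell_matrix_borel: "cell_matrix v \<Longrightarrow> v \<in> borel_subgroup n"
  unfolding cell_matrix_def borel_iff by (auto simp: inversions_def)

lemma schubert_cell_eq: "schubert_cell n \<pi> = (\<lambda>b. flag_of n (b * P)) ` borel_subgroup n"
  unfolding schubert_cell_def by (intro image_cong refl coset_mult borel_GL P_GL)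

text \<open>
  Column operations from \<open>\<pi> B \<pi>\<^sup>-\<^sup>1\<close> may add to column \<open>l\<close> of \<open>b\<close> multiples of the columns that stand to the
  left of it in \<open>b \<pi>\<close>. Those with indices in \<open>S l\<close> suffice to clear the entries of column \<open>l\<close> in the rows
  \<open>S l\<close> and to normalize the diagonal: this is a triangular system. The entries that remain are at
  inversions.
\<close>

lemma cell_normal_form:
  assumes b: "b \<in> borel_subgroup n"
  shows "\<exists>v. cell_matrix v \<and> flag_of n (b * P) = flag_of n (v * P)"
proof -
  have bm: "b \<in> carrier_mat n n" using b by (simp add: borel_iff)
  define S where "S l = {k. k \<le> l \<and> \<rho>' k \<le> \<rho>' l}" for l
  have S: "finite (S l)" "l \<in> S l" "\<And>k. k \<in> S l \<Longrightarrow> k \<le> l" for l by (auto simp: S_def)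
  have "\<forall>l\<in>{..<n}. \<exists>x. (\<forall>k. k \<notin> S l \<longrightarrow> x k = 0) \<and>
      (\<forall>i\<in>S l. (\<Sum>k\<in>S l. b $$ (i, k) * x k) = of_bool (i = l))"
    by (intro ballI triangular_solve S(1)) (use b in \<open>auto simp: borel_iff S_def\<close>)
  from bchoice[OF this] obtain x where x': "\<forall>l\<in>{..<n}. (\<forall>k. k \<notin> S l \<longrightarrow> x l k = 0) \<and>
      (\<forall>i\<in>S l. (\<Sum>k\<in>S l. b $$ (i, k) * x l k) = of_bool (i = l))" ..
  have x: "k \<notin> S l \<Longrightarrow> x l k = 0" "i \<in> S l \<Longrightarrow> (\<Sum>k\<in>S l. b $$ (i, k) * x l k) = of_bool (i = l)"
    if "l < n" for l k i
    using x' that by simp_all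
  define W where "W = mat n n (\<lambda>(k, l). x l k)"
  define c where "c = mat n n (\<lambda>(i, j). x (\<rho> j) (\<rho> i))"
  define v where "v = b * W"
  have carr: "W \<in> carrier_mat n n" "c \<in> carrier_mat n n" "v \<in> carrier_mat n n"
    using bm by (auto simp: W_def c_def v_def)
  have v_index: "v $$ (i, l) = (\<Sum>k\<in>S l. b $$ (i, k) * x l k)" if "i < n" "l < n" for i l
  proof -
    have "v $$ (i, l) = (\<Sum>k<n. b $$ (i, k) * x l k)"
      unfolding v_def mat_mult_index[OF bm carr(1) that] using that by (intro sum.cong) (auto simp: W_def)
    also have "\<dots> = (\<Sum>k\<in>S l. b $$ (i, k) * x l k)"
    proof (rule sum.mono_neutral_right)
      show "S l \<subseteq> {..<n}" using S(3)[of _ l] that(2) by force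
    qed (use x(1)[OF that(2)] in auto)
    finally show ?thesis .
  qed
  have "cell_matrix v"
    unfolding cell_matrix_def
  proof (intro conjI allI impI)
    show "v \<in> carrier_mat n n" by (rule carr(3))
    show "v $$ (i, i) = 1" if "i < n" for i
      using v_index[OF that that] x(2)[OF that S(2)] by simp
    fix i l assume il: "i < n" "l < n" "i \<noteq> l" and no: "(Suc i, Suc l) \<notin> inversions n \<pi>"
    show "v $$ (i, l) = 0"
    proof (cases "i \<in> S l")
      case True
      then show ?thesis using v_index[OF il(1,2)] x(2)[OF il(2) True] il(3) by simp
    next
      case False
      have "l < i"
      proof (rule ccontr)
        assume "\<not> l < i"
        then have "i < l" "\<rho>' l < \<rho>' i" using False il(3) by (auto simp: S_def)
        then have "(Suc i, Suc l) \<in> inversions n \<pi>"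
          using il Suc_\<rho>'[of i] Suc_\<rho>'[of l] by (auto simp: inversions_def)
        then show False using no by simp
      qed
      then have "b $$ (i, k) = 0" if "k \<in> S l" for k
        using b il(1) S(3)[OF that] by (auto simp: borel_iff)
      then show ?thesis using v_index[OF il(1,2)] by simp
    qed
  qed
  moreover have "c \<in> borel_subgroup n"
    unfolding borel_iff
  proof (intro conjI allI impI)
    show "c \<in> carrier_mat n n" by (rule carr(2))
    fix i assume i: "i < n"
    have l: "\<rho> i < n" by (rule \<rho>_less[OF i])
    show "c $$ (i, j) = 0" if "j < i" for j
    proof -
      have "\<rho> i \<notin> S (\<rho> j)" using that i \<rho>'_\<rho>[of i] \<rho>'_\<rho>[of j] by (auto simp: S_def)
      then show ?thesis using x(1)[OF \<rho>_less[of j]] i that by (simp add: c_def)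
    qed
    \<comment> \<open>Row \<open>\<rho> i\<close> is the last of the system for column \<open>\<rho> i\<close>, so only its diagonal term survives.\<close>
    have "(\<Sum>k\<in>S (\<rho> i). b $$ (\<rho> i, k) * x (\<rho> i) k) = (\<Sum>k\<in>{\<rho> i}. b $$ (\<rho> i, k) * x (\<rho> i) k)"
    proof (rule sum.mono_neutral_right)
      show "\<forall>k\<in>S (\<rho> i) - {\<rho> i}. b $$ (\<rho> i, k) * x (\<rho> i) k = 0"
      proof
        fix k assume "k \<in> S (\<rho> i) - {\<rho> i}"
        then have "k < \<rho> i" using S(3)[of k "\<rho> i"] by auto
        then show "b $$ (\<rho> i, k) * x (\<rho> i) k = 0" using b l by (simp add: borel_iff)
      qed
    qed (use S in auto)
    then have "b $$ (\<rho> i, \<rho> i) * x (\<rho> i) (\<rho> i) = 1" using x(2)[OF l S(2)] by simp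
    then have "x (\<rho> i) (\<rho> i) \<noteq> 0" by auto
    then show "c $$ (i, i) \<noteq> 0" using i by (simp add: c_def)
  qed
  moreover have "b * P * c = v * P"
  proof -
    have "P * c = W * P"
    proof (rule eq_matI)
      fix i j assume "i < dim_row (W * P)" "j < dim_col (W * P)"
      then have ij: "i < n" "j < n" using carr(1) P_carrier by auto
      then show "(P * c) $$ (i, j) = (W * P) $$ (i, j)"
        unfolding P_mult_index[OF carr(2) ij] mult_P_index[OF carr(1) ij]
        using \<rho>_less[OF ij(2)] \<rho>'_less[OF ij(1)] by (simp add: W_def c_def \<rho>_\<rho>')
    qed (use carr P_carrier in auto)
    then show ?thesis
      unfolding v_def assoc_mult_mat[OF bm P_carrier carr(2)] assoc_mult_mat[OF bm carr(1) P_carrier]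
      by simp
  qed
  ultimately show ?thesis
    using flag_of_mult_borel[OF GL_mult[OF borel_GL[OF b] P_GL], of c] by auto
qed

text \<open>
  Let \<open>k = \<rho>' l\<close> be the position of the value \<open>l\<close>. \<open>coord l i\<close> is the minor on the columns \<open>0..k\<close> and
  the rows \<open>\<rho> 0, \<dots>, \<rho> (k - 1), i\<close>; in other words a Pluecker coordinate of the flag variety whose row
  set is that of the leading one, \<open>coord l l\<close>, with \<open>l\<close> replaced by \<open>i\<close>. The order of the rows fixes the
  sign.
\<close>

definition coord :: "nat \<Rightarrow> nat \<Rightarrow> complex mat \<Rightarrow> complex" where
  "coord l i A = det (mat (Suc (\<rho>' l)) (Suc (\<rho>' l)) (\<lambda>(a, c). A $$ (if a = \<rho>' l then i else \<rho> a, c)))"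

lemma coord_poly:
  assumes "l < n" "i < n"
  shows "coord l i \<in> poly_functions n"
proof -
  let ?m = "Suc (\<rho>' l)" and ?r = "\<lambda>a. if a = \<rho>' l then i else \<rho> a"
  have m: "?m \<le> n" using \<rho>'_less[OF assms(1)] by simp
  have r: "?r a < n" if "a < ?m" for a using that m assms(2) \<rho>_less[of a] by auto
  have "coord l i = (\<lambda>A. \<Sum>p\<in>{p. p permutes {0..<?m}}. of_int (sign p) * (\<Prod>a\<in>{0..<?m}. A $$ (?r a, p a)))"
  proof
    fix A :: "complex mat"
    show "coord l i A = (\<Sum>p\<in>{p. p permutes {0..<?m}}. of_int (sign p) * (\<Prod>a\<in>{0..<?m}. A $$ (?r a, p a)))"
      unfolding coord_def det_def'[OF mat_carrier]
    proof (intro sum.cong refl arg_cong2[of _ _ _ _ "(*)"] prod.cong)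
      fix p a assume "p \<in> {p. p permutes {0..<?m}}" "a \<in> {0..<?m}"
      then have "p a < ?m" "a < ?m" using permutes_in_image[of p "{0..<?m}" a] by auto
      then show "mat ?m ?m (\<lambda>(a, c). A $$ (?r a, c)) $$ (a, p a) = A $$ (?r a, p a)" by simp
    qed
  qed
  also have "\<dots> \<in> poly_functions n"
  proof (intro poly_functions_sum poly_functions.mult poly_functions.const poly_functions_prod)
    fix p a assume "p \<in> {p. p permutes {0..<?m}}" "a \<in> {0..<?m}"
    then have "p a < ?m" "a < ?m" using permutes_in_image[of p "{0..<?m}" a] by auto
    then show "(\<lambda>A. A $$ (?r a, p a)) \<in> poly_functions n"
      using m r by (intro poly_functions.entry) auto
  qed (auto simp: finite_permutations)
  finally show ?thesis .
qed

text \<open>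
  The factor depends on \<open>i\<close> only through \<open>t\<^sub>i\<^sub>i\<close>, so \<open>coord l i\<close> and \<open>coord l l\<close> differ in weight by
  \<open>t\<^sub>i / t\<^sub>l\<close>.
\<close>

lemma coord_torus:
  assumes t: "t \<in> torus n" and A: "A \<in> carrier_mat n n" and l: "l < n" and i: "i < n"
  shows "coord l i (t * A) = (\<Prod>a<\<rho>' l. t $$ (\<rho> a, \<rho> a)) * t $$ (i, i) * coord l i A"
proof -
  let ?m = "Suc (\<rho>' l)" and ?r = "\<lambda>a. if a = \<rho>' l then i else \<rho> a"
  have m: "?m \<le> n" using \<rho>'_less[OF l] by simp
  have tm: "t \<in> carrier_mat n n" using t by (simp add: torus_iff)
  have r: "?r a < n" if "a < ?m" for a using that m i \<rho>_less[of a] by auto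
  define T where "T = mat ?m ?m (\<lambda>(a, c). if a = c then t $$ (?r a, ?r a) else 0)"
  define M where "M = mat ?m ?m (\<lambda>(a, c). A $$ (?r a, c))"
  have carr: "T \<in> carrier_mat ?m ?m" "M \<in> carrier_mat ?m ?m" by (auto simp: T_def M_def)
  have entry: "(t * A) $$ (a, c) = t $$ (a, a) * A $$ (a, c)" if "a < n" "c < n" for a c
  proof -
    have "(t * A) $$ (a, c) = (\<Sum>k\<in>{a}. t $$ (a, k) * A $$ (k, c))"
      unfolding mat_mult_index[OF tm A that]
      using t that by (intro sum.mono_neutral_right) (auto simp: torus_iff)
    then show ?thesis by simp
  qed
  have "mat ?m ?m (\<lambda>(a, c). (t * A) $$ (?r a, c)) = T * M"
  proof (rule eq_matI)
    fix a c assume "a < dim_row (T * M)" "c < dim_col (T * M)"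
    then have ac: "a < ?m" "c < ?m" by (auto simp: T_def M_def)
    have "(T * M) $$ (a, c) = (\<Sum>k\<in>{a}. T $$ (a, k) * M $$ (k, c))"
      unfolding mat_mult_index[OF carr ac] using ac by (intro sum.mono_neutral_right) (auto simp: T_def)
    then show "mat ?m ?m (\<lambda>(a, c). (t * A) $$ (?r a, c)) $$ (a, c) = (T * M) $$ (a, c)"
      using ac entry[OF r[OF ac(1)], of c] m by (simp add: T_def M_def)
  qed (auto simp: T_def M_def)
  then have "coord l i (t * A) = det T * det M" unfolding coord_def using det_mult[OF carr] by simp
  moreover have "det T = (\<Prod>a<?m. t $$ (?r a, ?r a))"
    by (subst det_upper[OF carr(1)]) (auto simp: T_def upper_triangular_def intro!: prod.cong)
  moreover have "\<dots> = (\<Prod>a<\<rho>' l. t $$ (?r a, ?r a)) * t $$ (i, i)"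
    by (simp add: lessThan_Suc mult.commute)
  moreover have "(\<Prod>a<\<rho>' l. t $$ (?r a, ?r a)) = (\<Prod>a<\<rho>' l. t $$ (\<rho> a, \<rho> a))"
    by (intro prod.cong) auto
  ultimately show ?thesis by (simp add: coord_def M_def)
qed

text \<open>
  Up to position \<open>\<rho>' l\<close> the columns of \<open>A b\<close> only involve the leading principal block of \<open>b\<close>, which is triangular.
\<close>

lemma coord_borel:
  assumes b: "b \<in> borel_subgroup n" and A: "A \<in> carrier_mat n n" and l: "l < n" and i: "i < n"
  shows "coord l i (A * b) = coord l i A * (\<Prod>a\<le>\<rho>' l. b $$ (a, a))"
proof -
  let ?m = "Suc (\<rho>' l)" and ?r = "\<lambda>a. if a = \<rho>' l then i else \<rho> a"
  have m: "?m \<le> n" using \<rho>'_less[OF l] by simp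
  have bm: "b \<in> carrier_mat n n" using b by (simp add: borel_iff)
  have r: "?r a < n" if "a < ?m" for a using that m i \<rho>_less[of a] by auto
  define T where "T = mat ?m ?m (\<lambda>(a, c). b $$ (a, c))"
  define M where "M = mat ?m ?m (\<lambda>(a, c). A $$ (?r a, c))"
  have carr: "M \<in> carrier_mat ?m ?m" "T \<in> carrier_mat ?m ?m" by (auto simp: T_def M_def)
  have "mat ?m ?m (\<lambda>(a, c). (A * b) $$ (?r a, c)) = M * T"
  proof (rule eq_matI)
    fix a c assume "a < dim_row (M * T)" "c < dim_col (M * T)"
    then have ac: "a < ?m" "c < ?m" by (auto simp: T_def M_def)
    then have c: "c < n" using m by simp
    have "(A * b) $$ (?r a, c) = (\<Sum>k<?m. A $$ (?r a, k) * b $$ (k, c))"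
      unfolding mat_mult_index[OF A bm r[OF ac(1)] c]
      using b ac m by (intro sum.mono_neutral_right) (auto simp: borel_iff)
    also have "\<dots> = (M * T) $$ (a, c)"
      unfolding mat_mult_index[OF carr ac] using ac by (intro sum.cong) (auto simp: M_def T_def)
    finally show "mat ?m ?m (\<lambda>(a, c). (A * b) $$ (?r a, c)) $$ (a, c) = (M * T) $$ (a, c)"
      using ac by simp
  qed (auto simp: T_def M_def)
  then have "coord l i (A * b) = det M * det T" unfolding coord_def using det_mult[OF carr] by simp
  moreover have "det T = (\<Prod>a<?m. b $$ (a, a))"
    using b m by (subst det_upper[OF carr(2)]) (auto simp: T_def upper_triangular_def borel_iff intro!: prod.cong)
  ultimately show ?thesis by (simp add: coord_def M_def lessThan_Suc_atMost)
qed

text \<open>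
  Because \<open>\<pi>\<^sup>-\<^sup>1 v \<pi>\<close> is lower unitriangular, the minor is a triangular determinant whose diagonal is
  \<open>1, \<dots>, 1, v\<^sub>i\<^sub>l\<close>.
\<close>

lemma coord_cell_matrix:
  assumes v: "cell_matrix v" and l: "l < n" and i: "i < n"
  shows "coord l i (v * P) = v $$ (i, l)"
proof -
  let ?m = "Suc (\<rho>' l)" and ?r = "\<lambda>a. if a = \<rho>' l then i else \<rho> a"
  have m: "?m \<le> n" using \<rho>'_less[OF l] by simp
  have vm: "v \<in> carrier_mat n n" using v by (simp add: cell_matrix_def)
  have r: "?r a < n" if "a < ?m" for a using that m i \<rho>_less[of a] by auto
  define M where "M = mat ?m ?m (\<lambda>(a, c). (v * P) $$ (?r a, c))"
  have M: "M \<in> carrier_mat ?m ?m" by (simp add: M_def)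
  have entry: "M $$ (a, c) = v $$ (?r a, \<rho> c)" if "a < ?m" "c < ?m" for a c
    using mult_P_index[OF vm r[OF that(1)], of c] that m by (simp add: M_def)
  have diag: "M $$ (a, a) = (if a = \<rho>' l then v $$ (i, l) else 1)" if "a < ?m" for a
    using entry[OF that that] v that m \<rho>_less[of a] by (auto simp: cell_matrix_def \<rho>_\<rho>'[OF l])
  have "det M = prod_list (diag_mat M)"
  proof (rule det_lower_triangular[OF _ M])
    fix a c assume ac: "a < c" "c < ?m"
    then have n: "a < n" "c < n" using m by auto
    have "\<rho> a \<noteq> \<rho> c" using ac(1) \<rho>'_\<rho>[OF n(1)] \<rho>'_\<rho>[OF n(2)] by auto
    moreover have "(Suc (\<rho> a), Suc (\<rho> c)) \<notin> inversions n \<pi>"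
      using ac(1) by (simp add: inversions_def Suc_\<rho> n permutes_inverses[OF perm])
    ultimately have "v $$ (\<rho> a, \<rho> c) = 0"
      using v \<rho>_less[OF n(1)] \<rho>_less[OF n(2)] by (auto simp: cell_matrix_def)
    then show "M $$ (a, c) = 0" using entry[of a c] ac by simp
  qed
  also have "\<dots> = (\<Prod>a<?m. if a = \<rho>' l then v $$ (i, l) else 1)"
    unfolding prod_list_diag_prod using M diag by (intro prod.cong) (auto simp: lessThan_atLeast0)
  also have "\<dots> = v $$ (i, l)" by simp
  finally show ?thesis by (simp add: coord_def M_def)
qed

end


section \<open>Dense torus orbits\<close>

context schubert
begin

lemma toric_iff:
  "toric n (schubert_variety n \<pi>) \<longleftrightarrow>
     (\<exists>x\<in>schubert_variety n \<pi>. schubert_variety n \<pi> \<subseteq>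
        flag_topology n closure_of (schubert_variety n \<pi> \<inter> torus_orbit n x))"
  unfolding toric_def closure_of_subtopology by blast

lemma cell_subset_flags: "schubert_cell n \<pi> \<subseteq> flags n"
  unfolding schubert_cell_eq flags_eq by (intro image_subsetI imageI GL_mult borel_GL P_GL)

lemma cell_subset_variety: "schubert_cell n \<pi> \<subseteq> schubert_variety n \<pi>"
  unfolding schubert_variety_def
  by (rule closure_of_subset) (simp add: topspace_flag_topology cell_subset_flags)

lemma variety_subset_flags: "schubert_variety n \<pi> \<subseteq> flags n"
  unfolding schubert_variety_def using closure_of_subset_topspace topspace_flag_topology by metis

lemma flag_of_cell_matrix: "cell_matrix v \<Longrightarrow> flag_of n (v * P) \<in> schubert_cell n \<pi>"
  unfolding schubert_cell_eq using cell_matrix_borel by blast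

lemma torus_orbit_flag_of:
  assumes "g \<in> carrier (GL n)"
  shows "torus_orbit n (flag_of n g) = (\<lambda>t. flag_of n (t * g)) ` torus n"
  unfolding torus_orbit_def using coset_mult[OF torus_GL assms] by (intro image_cong) auto

text \<open>
  Let \<open>p\<^sub>i\<close> and \<open>q\<^sub>i = p\<^sub>i\<^sub>+\<^sub>1\<close> be the ends of the \<open>i\<close>-th edge of a cycle and \<open>h\<^sub>i\<close> the larger one. The
  products \<open>F\<close> of all \<open>coord h\<^sub>i p\<^sub>i\<close> and \<open>G\<close> of all \<open>coord h\<^sub>i q\<^sub>i\<close> have the same weight, since \<open>p\<close> and
  \<open>q\<close> run through the same vertices; on the cell they are the products of the coordinates over the edges
  traversed upwards and downwards, respectively. A linear relation between \<open>F\<close> and \<open>G\<close> that holds at one point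
  of a dense orbit would hold on the whole cell, where \<open>F\<close> and \<open>G\<close> are linearly independent.
\<close>

lemma toric_imp_forest:
  assumes "toric n (schubert_variety n \<pi>)"
  shows "forest (inversion_graph n \<pi>)"
  unfolding forest_def
proof
  assume "\<exists>c. graph_cycle (inversion_graph n \<pi>) c"
  then obtain c where "graph_cycle ({1..n}, inv_edges n \<pi>) c"
    unfolding inversion_graph_eq[symmetric] by blast
  then have len: "3 \<le> length c" and d: "distinct c" and V: "set c \<subseteq> {1..n}"
    and edge: "\<And>i. i < length c \<Longrightarrow> {c ! i, c ! (Suc i mod length c)} \<in> inv_edges n \<pi>"
    by (auto simp: graph_cycle_def)
  let ?L = "length c"
  have "0 < ?L" using len by linarith
  define p where "p i = c ! i - 1" for i
  define q where "q i = c ! (Suc i mod ?L) - 1" for i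
  define h where "h i = max (p i) (q i)" for i
  have Suc_p: "Suc (p i) = c ! i" and Suc_q: "Suc (q i) = c ! (Suc i mod ?L)" if "i < ?L" for i
  proof -
    have "c ! i \<in> {1..n}" "c ! (Suc i mod ?L) \<in> {1..n}"
      using V that \<open>0 < ?L\<close> by (meson nth_mem subsetD mod_less_divisor)+
    then show "Suc (p i) = c ! i" "Suc (q i) = c ! (Suc i mod ?L)" by (auto simp: p_def q_def)
  qed
  have less: "p i < n" "q i < n" "h i < n" if "i < ?L" for i
  proof -
    have "c ! i \<in> {1..n}" "c ! (Suc i mod ?L) \<in> {1..n}"
      using V that \<open>0 < ?L\<close> by (meson nth_mem subsetD mod_less_divisor)+
    then show "p i < n" "q i < n" using Suc_p[OF that] Suc_q[OF that] by auto
    then show "h i < n" by (simp add: h_def)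
  qed
  define F where "F A = (\<Prod>i<?L. coord (h i) (p i) A)" for A
  define G where "G A = (\<Prod>i<?L. coord (h i) (q i) A)" for A
  have FG_poly: "F \<in> poly_functions n" "G \<in> poly_functions n"
    unfolding F_def[abs_def] G_def[abs_def]
    using less by (auto intro!: poly_functions_prod coord_poly)
  have rot: "(\<Prod>i<?L. f (q i)) = (\<Prod>i<?L. f (p i))" for f :: "nat \<Rightarrow> complex"
  proof -
    let ?f = "\<lambda>x. f (x - 1)"
    have "(\<Prod>i<?L. f (q i)) = (\<Prod>i<?L. ?f (rotate1 c ! i))"
      by (intro prod.cong) (auto simp: q_def nth_rotate1)
    also have "\<dots> = prod_list (map ?f (rotate1 c))"
      by (simp add: prod.list_conv_set_nth lessThan_atLeast0)
    also have "\<dots> = prod_list (map ?f c)" by (cases c) (auto simp: mult.commute)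
    also have "\<dots> = (\<Prod>i<?L. f (p i))" by (simp add: prod.list_conv_set_nth lessThan_atLeast0 p_def)
    finally show ?thesis .
  qed
  have torus: "\<exists>\<chi>. \<chi> \<noteq> 0 \<and> F (t * A) = \<chi> * F A \<and> G (t * A) = \<chi> * G A"
    if t: "t \<in> torus n" and A: "A \<in> carrier_mat n n" for t A
  proof -
    define \<chi> where "\<chi> = (\<Prod>i<?L. \<Prod>a<\<rho>' (h i). t $$ (\<rho> a, \<rho> a)) * (\<Prod>i<?L. t $$ (p i, p i))"
    have tn: "t $$ (i, i) \<noteq> 0" if "i < n" for i using t that by (simp add: torus_iff)
    have "\<rho> a < n" if "i < ?L" "a < \<rho>' (h i)" for i a
      using that less(3) \<rho>'_less \<rho>_less by (meson less_trans)
    then have "\<chi> \<noteq> 0" unfolding \<chi>_def using less tn by simp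
    moreover have "F (t * A) = \<chi> * F A"
      unfolding F_def \<chi>_def prod.distrib[symmetric]
      using less by (intro prod.cong) (auto simp: coord_torus[OF t A])
    moreover have "G (t * A) = \<chi> * G A"
      unfolding G_def \<chi>_def rot[of "\<lambda>x. t $$ (x, x)", symmetric] prod.distrib[symmetric]
      using less by (intro prod.cong) (auto simp: coord_torus[OF t A])
    ultimately show ?thesis by blast
  qed
  have borel: "\<exists>\<chi>. \<chi> \<noteq> 0 \<and> F (A * b) = F A * \<chi> \<and> G (A * b) = G A * \<chi>"
    if b: "b \<in> borel_subgroup n" and A: "A \<in> carrier_mat n n" for b A
  proof -
    define \<chi> where "\<chi> = (\<Prod>i<?L. \<Prod>a\<le>\<rho>' (h i). b $$ (a, a))"
    have bn: "b $$ (i, i) \<noteq> 0" if "i < n" for i using b that by (simp add: borel_iff)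
    have "a < n" if "i < ?L" "a \<le> \<rho>' (h i)" for i a
      using that less(3) \<rho>'_less by (meson le_less_trans)
    then have "\<chi> \<noteq> 0" unfolding \<chi>_def using bn by simp
    moreover have "F (A * b) = F A * \<chi>" "G (A * b) = G A * \<chi>"
      unfolding F_def G_def \<chi>_def prod.distrib[symmetric]
      using less by (auto intro!: prod.cong simp: coord_borel[OF b A])
    ultimately show ?thesis by blast
  qed
  from assms obtain x where x: "x \<in> schubert_variety n \<pi>"
    and dense: "schubert_variety n \<pi> \<subseteq>
        flag_topology n closure_of (schubert_variety n \<pi> \<inter> torus_orbit n x)"
    unfolding toric_iff by blast
  obtain g where g: "g \<in> carrier (GL n)" "x = flag_of n g"
    using x variety_subset_flags flags_eq by blast
  have gm: "g \<in> carrier_mat n n" by (rule GL_mat[OF g(1)])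
  \<comment> \<open>Stated for linear relations rather than for the ratio \<open>F / G\<close>, because \<open>F\<close> and \<open>G\<close> might vanish at
    \<open>g\<close>, which need not lie over the cell.\<close>
  have key: "\<alpha> * F (v * P) + \<beta> * G (v * P) = 0"
    if v: "cell_matrix v" and orb: "\<alpha> * F g + \<beta> * G g = 0" for v \<alpha> \<beta>
  proof -
    define H where "H A = \<alpha> * F A + \<beta> * G A" for A
    have vP: "v * P \<in> carrier (GL n)" using v by (intro GL_mult borel_GL cell_matrix_borel P_GL)
    have H_borel: "H (A * b) = 0 \<longleftrightarrow> H A = 0" if A: "A \<in> carrier (GL n)" and b: "b \<in> borel_subgroup n" for A b
    proof -
      obtain \<chi> where "\<chi> \<noteq> 0" "F (A * b) = F A * \<chi>" "G (A * b) = G A * \<chi>"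
        using borel[OF b GL_mat[OF A]] by blast
      then have "H (A * b) = H A * \<chi>" by (simp add: H_def algebra_simps)
      then show ?thesis using \<open>\<chi> \<noteq> 0\<close> by simp
    qed
    have "H (v * P) = 0"
    proof (rule flag_closure_polynomial_zero[OF _ H_borel vP])
      show "H \<in> poly_functions n"
        unfolding H_def[abs_def]
        by (intro poly_functions.add poly_functions.mult poly_functions.const FG_poly)
      show "flag_of n (v * P) \<in> flag_topology n closure_of (schubert_variety n \<pi> \<inter> torus_orbit n x)"
        using dense cell_subset_variety flag_of_cell_matrix[OF v] by blast
      fix g' assume g': "g' \<in> carrier (GL n)" "flag_of n g' \<in> schubert_variety n \<pi> \<inter> torus_orbit n x"
      then obtain t where t: "t \<in> torus n" "flag_of n g' = flag_of n (t * g)"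
        unfolding g(2) torus_orbit_flag_of[OF g(1)] by blast
      then have "g' \<in> flag_of n (t * g)" using mem_flag_of[OF g'(1)] by simp
      then obtain b where b: "b \<in> borel_subgroup n" "g' = t * g * b" unfolding GL_coset by blast
      obtain \<chi> where "F (t * g) = \<chi> * F g" "G (t * g) = \<chi> * G g" using torus[OF t(1) gm] by blast
      then have "H (t * g) = \<chi> * (\<alpha> * F g + \<beta> * G g)" by (simp add: H_def algebra_simps)
      then show "H g' = 0"
        using orb H_borel[OF GL_mult[OF torus_GL[OF t(1)] g(1)] b(1)] b(2) by simp
    qed
    then show ?thesis by (simp add: H_def)
  qed
  \<comment> \<open>Varying the coordinate \<open>z\<close> at the first edge of the cycle changes exactly one of \<open>F\<close> and \<open>G\<close>.\<close>
  define v where "v z = mat n n (\<lambda>(i, j). if i = j then 1 else if (Suc i, Suc j) \<in> inversions n \<pi>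
      then (if {i, j} = {p 0, q 0} then z else 1) else 0 :: complex)" for z
  have v: "cell_matrix (v z)" for z by (auto simp: cell_matrix_def v_def)
  have pq_ne: "p i \<noteq> q i" and inv: "(Suc (min (p i) (q i)), Suc (h i)) \<in> inversions n \<pi>" if "i < ?L" for i
  proof -
    have e: "{Suc (p i), Suc (q i)} \<in> inv_edges n \<pi>" using edge[OF that] Suc_p Suc_q that by simp
    then obtain a b where "(a, b) \<in> inversions n \<pi>" "{Suc (p i), Suc (q i)} = {a, b}"
      by (auto simp: inv_edges_eq)
    then show "p i \<noteq> q i" by (auto simp: inversions_def doubleton_eq_iff)
    then show "(Suc (min (p i) (q i)), Suc (h i)) \<in> inversions n \<pi>"
      using e inv_edges_iff[of "Suc (min (p i) (q i))" "Suc (h i)" n \<pi>]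
      by (auto simp: h_def min_def max_def insert_commute split: if_splits)
  qed
  have first_edge: "{p i, q i} \<noteq> {p 0, q 0}" if i: "i < ?L" "i \<noteq> 0" for i
  proof
    assume eq: "{p i, q i} = {p 0, q 0}"
    have p_inj: "p i = p j \<longleftrightarrow> i = j" if "i < ?L" "j < ?L" for i j
      using Suc_p[OF that(1)] Suc_p[OF that(2)] nth_eq_iff_index_eq[OF d that] by auto
    have q_p: "q i = p (Suc i mod ?L)" for i by (simp add: p_def q_def)
    have L: "1 < ?L" "Suc i mod ?L < ?L" using len \<open>0 < ?L\<close> by simp_all
    have "p i \<noteq> p 0" using p_inj[OF i(1) \<open>0 < ?L\<close>] i(2) by simp
    then have "p i = q 0" "q i = p 0" using eq by (auto simp: doubleton_eq_iff)
    moreover have "q 0 = p 1" using q_p[of 0] L(1) by simp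
    ultimately have "i = 1" "Suc i mod ?L = 0"
      using p_inj[OF i(1) L(1)] p_inj[OF L(2) \<open>0 < ?L\<close>] q_p[of i] by simp_all
    then show False using len by simp
  qed
  have entries: "v z $$ (p i, h i) * v z $$ (q i, h i) = (if i = 0 then z else 1)"
    "i \<noteq> 0 \<Longrightarrow> v z $$ (p i, h i) = 1" "i \<noteq> 0 \<Longrightarrow> v z $$ (q i, h i) = 1"
    "v z $$ (p i, h i) = 1 \<or> v z $$ (q i, h i) = 1"
    if i: "i < ?L" for i z
  proof -
    have sets: "{p i, h i} = {p i, q i}" if "p i \<noteq> h i" using that by (auto simp: h_def max_def split: if_splits)
    have sets': "{q i, h i} = {p i, q i}" if "q i \<noteq> h i" using that by (auto simp: h_def max_def split: if_splits)
    have inv_p: "(Suc (p i), Suc (h i)) \<in> inversions n \<pi>" if "p i \<noteq> h i"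
      using inv[OF i] that by (auto simp: h_def min_def max_def split: if_splits)
    have inv_q: "(Suc (q i), Suc (h i)) \<in> inversions n \<pi>" if "q i \<noteq> h i"
      using inv[OF i] that by (auto simp: h_def min_def max_def split: if_splits)
    have vp: "v z $$ (p i, h i) = (if p i = h i then 1 else if i = 0 then z else 1)"
      using less[OF i] inv_p sets first_edge[OF i] by (auto simp: v_def)
    have vq: "v z $$ (q i, h i) = (if q i = h i then 1 else if i = 0 then z else 1)"
      using less[OF i] inv_q sets' first_edge[OF i] by (auto simp: v_def)
    have "p i = h i \<longleftrightarrow> q i \<noteq> h i" using pq_ne[OF i] by (auto simp: h_def max_def)
    then show "v z $$ (p i, h i) * v z $$ (q i, h i) = (if i = 0 then z else 1)"
      "i \<noteq> 0 \<Longrightarrow> v z $$ (p i, h i) = 1" "i \<noteq> 0 \<Longrightarrow> v z $$ (q i, h i) = 1"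
      "v z $$ (p i, h i) = 1 \<or> v z $$ (q i, h i) = 1"
      unfolding vp vq by auto
  qed
  have F_v: "F (v z * P) = v z $$ (p 0, h 0)" and G_v: "G (v z * P) = v z $$ (q 0, h 0)" for z
  proof -
    have "F (v z * P) = (\<Prod>i<?L. if i = 0 then v z $$ (p 0, h 0) else 1)"
      unfolding F_def by (intro prod.cong) (auto simp: coord_cell_matrix[OF v] less entries(2))
    then show "F (v z * P) = v z $$ (p 0, h 0)" using \<open>0 < ?L\<close> by simp
    have "G (v z * P) = (\<Prod>i<?L. if i = 0 then v z $$ (q 0, h 0) else 1)"
      unfolding G_def by (intro prod.cong) (auto simp: coord_cell_matrix[OF v] less entries(3))
    then show "G (v z * P) = v z $$ (q 0, h 0)" using \<open>0 < ?L\<close> by simp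
  qed
  have prod: "F (v z * P) * G (v z * P) = z" and or: "F (v z * P) = 1 \<or> G (v z * P) = 1" for z
    unfolding F_v G_v using entries(1,4)[of 0 z] \<open>0 < ?L\<close> by auto
  have one: "F (v 1 * P) = 1" "G (v 1 * P) = 1" using prod[of 1] or[of 1] by auto
  have "F g \<noteq> 0" using key[OF v[of 1], of 1 0] one by auto
  moreover have "G g * F (v z * P) = F g * G (v z * P)" for z
    using key[OF v[of z], of "G g" "- F g"] by simp
  from this[of 1] this[of 0] have "F g = G g" "G g * F (v 0 * P) = F g * G (v 0 * P)" using one by auto
  ultimately have "F (v 0 * P) = G (v 0 * P)" by simp
  then show False using prod[of 0] or[of 0] by auto
qed

text \<open>
  The matrix \<open>u\<close> has all coordinates equal to 1.
\<close>

lemma forest_imp_toric: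
  assumes forest: "forest (inversion_graph n \<pi>)"
  shows "toric n (schubert_variety n \<pi>)"
proof -
  define N where "N = mat n n (\<lambda>(i, j). if (Suc i, Suc j) \<in> inversions n \<pi> then 1 else 0 :: complex)"
  define u where "u = 1\<^sub>m n + N"
  have u: "cell_matrix u"
    by (auto simp: cell_matrix_def u_def N_def inversions_def)
  define x where "x = flag_of n (u * P)"
  have uP: "u * P \<in> carrier (GL n)" using u by (intro GL_mult borel_GL cell_matrix_borel P_GL)
  have um: "u \<in> carrier_mat n n" using u by (simp add: cell_matrix_def)
  \<comment> \<open>The torus scales the coordinate at an inversion \<open>(a, b)\<close> by \<open>t\<^sub>a / t\<^sub>b\<close>; on a forest these
    ratios can be prescribed freely.\<close>
  have orbit: "flag_of n (w * P) \<in> torus_orbit n x"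
    if w: "cell_matrix w"
      and nz: "\<And>i j. i < n \<Longrightarrow> j < n \<Longrightarrow> (Suc i, Suc j) \<in> inversions n \<pi> \<Longrightarrow> w $$ (i, j) \<noteq> 0" for w
  proof -
    have wm: "w \<in> carrier_mat n n" using w by (simp add: cell_matrix_def)
    define W where "W a b = (if a < b then w $$ (a - 1, b - 1) else 1 / w $$ (b - 1, a - 1))" for a b
    have "W a b \<noteq> 0 \<and> W a b * W b a = 1" if "{a, b} \<in> inv_edges n \<pi>" for a b
    proof -
      have dir: "(a, b) \<in> inversions n \<pi> \<or> (b, a) \<in> inversions n \<pi>"
        using that by (auto simp: inv_edges_eq doubleton_eq_iff)
      have nz': "w $$ (a - 1, b - 1) \<noteq> 0 \<and> a < b" if "(a, b) \<in> inversions n \<pi>" for a b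
      proof -
        have "a - 1 < n" "b - 1 < n" "Suc (a - 1) = a" "Suc (b - 1) = b" "a < b"
          using that by (auto simp: inversions_def)
        then show ?thesis using nz[of "a - 1" "b - 1"] that by simp
      qed
      from dir show ?thesis
      proof
        assume "(a, b) \<in> inversions n \<pi>"
        from nz'[OF this] show ?thesis by (simp add: W_def)
      next
        assume "(b, a) \<in> inversions n \<pi>"
        from nz'[OF this] show ?thesis by (simp add: W_def)
      qed
    qed
    then obtain t where t: "\<And>a. t a \<noteq> 0" "\<And>a b. {a, b} \<in> inv_edges n \<pi> \<Longrightarrow> t a = W a b * t b"
      using forest_potential[OF simple_inversion_graph, of n \<pi> W] forest
      unfolding inversion_graph_eq[symmetric] by blast
    define T where "T = mat n n (\<lambda>(i, j). if i = j then t (Suc i) else 0)"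
    define D where "D = mat n n (\<lambda>(i, j). if i = j then t (Suc (\<rho> i)) else 0)"
    have carr: "T \<in> carrier_mat n n" "D \<in> carrier_mat n n" by (auto simp: T_def D_def)
    have T: "T \<in> torus n" using t(1) by (auto simp: torus_iff T_def)
    have D: "D \<in> borel_subgroup n" using t(1) by (auto simp: borel_iff D_def)
    have Tu: "T * u \<in> carrier_mat n n" "w * P \<in> carrier_mat n n" "u * P \<in> carrier_mat n n"
      using carr um wm P_carrier by auto
    have "T * (u * P) = w * P * D"
    proof (rule eq_matI)
      fix i j assume "i < dim_row (w * P * D)" "j < dim_col (w * P * D)"
      then have ij: "i < n" "j < n" using wm carr by auto
      have l: "\<rho> j < n" by (rule \<rho>_less[OF ij(2)])
      have "(T * (u * P)) $$ (i, j) = (\<Sum>k\<in>{i}. T $$ (i, k) * (u * P) $$ (k, j))"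
        unfolding mat_mult_index[OF carr(1) Tu(3) ij] using ij
        by (intro sum.mono_neutral_right) (auto simp: T_def)
      then have TuP: "(T * (u * P)) $$ (i, j) = t (Suc i) * u $$ (i, \<rho> j)"
        using ij mult_P_index[OF um ij] by (simp add: T_def)
      have "(w * P * D) $$ (i, j) = (\<Sum>k\<in>{j}. (w * P) $$ (i, k) * D $$ (k, j))"
        unfolding mat_mult_index[OF Tu(2) carr(2) ij] using ij
        by (intro sum.mono_neutral_right) (auto simp: D_def)
      then have wPD: "(w * P * D) $$ (i, j) = w $$ (i, \<rho> j) * t (Suc (\<rho> j))"
        using ij mult_P_index[OF wm ij] by (simp add: D_def)
      consider "i = \<rho> j" | "i \<noteq> \<rho> j" "(Suc i, Suc (\<rho> j)) \<in> inversions n \<pi>"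
        | "i \<noteq> \<rho> j" "(Suc i, Suc (\<rho> j)) \<notin> inversions n \<pi>" by blast
      then show "(T * (u * P)) $$ (i, j) = (w * P * D) $$ (i, j)"
      proof cases
        case 1
        then show ?thesis using TuP wPD w u ij by (simp add: cell_matrix_def)
      next
        case 2
        then have "i < \<rho> j" "u $$ (i, \<rho> j) = 1"
          using ij l by (auto simp: u_def N_def inversions_def)
        moreover from this have "{Suc i, Suc (\<rho> j)} \<in> inv_edges n \<pi>"
          using 2 by (subst inv_edges_iff) auto
        ultimately show ?thesis
          using t(2)[of "Suc i" "Suc (\<rho> j)"] TuP wPD by (simp add: W_def)
      next
        case 3
        then show ?thesis using TuP wPD w u ij l by (simp add: cell_matrix_def)
      qed
    qed (use carr wm um P_carrier in auto)
    then have "flag_of n (T * (u * P)) = flag_of n (w * P)"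
      using flag_of_mult_borel[OF GL_mult[OF borel_GL[OF cell_matrix_borel[OF w]] P_GL] D] by simp
    then show ?thesis unfolding x_def torus_orbit_flag_of[OF uP] using T by force
  qed
  have closure_v: "flag_of n (v * P) \<in> flag_topology n closure_of (schubert_variety n \<pi> \<inter> torus_orbit n x)"
    if v: "cell_matrix v" for v
  proof (rule flag_closure_by_polynomials)
    have vm: "v \<in> carrier_mat n n" using v by (simp add: cell_matrix_def)
    show "v * P \<in> carrier (GL n)" using v by (intro GL_mult borel_GL cell_matrix_borel P_GL)
    fix f assume f: "f \<in> poly_functions n" "f (v * P) \<noteq> 0"
    define w where "w s = v + s \<cdot>\<^sub>m N" for s
    have Nm: "N \<in> carrier_mat n n" by (simp add: N_def)
    have wm: "w s \<in> carrier_mat n n" for s using vm Nm by (simp add: w_def)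
    have w_index: "w s $$ (i, j) = v $$ (i, j) + s * N $$ (i, j)" if "i < n" "j < n" for s i j
      using vm Nm that by (simp add: w_def)
    have w_cell: "cell_matrix (w s)" for s
      using v by (auto simp: cell_matrix_def wm w_index N_def inversions_def)
    have wP: "(w s * P) $$ (i, j) = v $$ (i, \<rho> j) + s * N $$ (i, \<rho> j)" if "i < n" "j < n" for s i j
      using mult_P_index[OF wm that] w_index[OF that(1) \<rho>_less[OF that(2)]] by simp
    obtain p where p: "\<And>s. f (w s * P) = poly p s"
      using poly_functions_line[OF f(1), of "\<lambda>s. w s * P", OF wP] by blast
    have "w 0 = v" using vm Nm by (intro eq_matI) (auto simp: w_def)
    then have "p \<noteq> 0" using p[of 0] f(2) by auto
    then have "finite {s. poly p s = 0}" by (rule poly_roots_finite)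
    \<comment> \<open>Only finitely many points of the line from \<open>v\<close> are bad: roots of \<open>p\<close>, or zeros of a
      coordinate at an inversion.\<close>
    moreover have "finite ((\<lambda>(i, j). - v $$ (i, j)) ` ({..<n} \<times> {..<n}))" by simp
    ultimately have "finite ({s. poly p s = 0} \<union> (\<lambda>(i, j). - v $$ (i, j)) ` ({..<n} \<times> {..<n}))" by simp
    then obtain s where s: "poly p s \<noteq> 0" "s \<notin> (\<lambda>(i, j). - v $$ (i, j)) ` ({..<n} \<times> {..<n})"
      using ex_new_if_finite[OF infinite_UNIV_char_0] by blast
    have "w s $$ (i, j) \<noteq> 0" if "i < n" "j < n" "(Suc i, Suc j) \<in> inversions n \<pi>" for i j
    proof
      assume "w s $$ (i, j) = 0"
      then have "s = - v $$ (i, j)" using w_index[OF that(1,2)] that by (simp add: N_def eq_neg_iff_add_eq_0 add.commute)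
      then show False using s(2) that(1,2) by force
    qed
    then have "flag_of n (w s * P) \<in> torus_orbit n x" by (rule orbit[OF w_cell])
    moreover have "flag_of n (w s * P) \<in> schubert_variety n \<pi>"
      using cell_subset_variety flag_of_cell_matrix[OF w_cell] by blast
    moreover have "w s * P \<in> carrier (GL n)" by (intro GL_mult borel_GL cell_matrix_borel P_GL w_cell)
    moreover have "f (w s * P) \<noteq> 0" using s(1) p by simp
    ultimately show "\<exists>g\<in>carrier (GL n). flag_of n g \<in> schubert_variety n \<pi> \<inter> torus_orbit n x \<and> f g \<noteq> 0"
      by blast
  qed
  have "schubert_cell n \<pi> \<subseteq> flag_topology n closure_of (schubert_variety n \<pi> \<inter> torus_orbit n x)"
    unfolding schubert_cell_eq
  proof (rule image_subsetI)
    fix b assume "b \<in> borel_subgroup n"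
    then obtain v where v: "cell_matrix v" "flag_of n (b * P) = flag_of n (v * P)"
      using cell_normal_form by blast
    show "flag_of n (b * P) \<in> flag_topology n closure_of (schubert_variety n \<pi> \<inter> torus_orbit n x)"
      unfolding v(2) by (rule closure_v[OF v(1)])
  qed
  then have "schubert_variety n \<pi> \<subseteq> flag_topology n closure_of (schubert_variety n \<pi> \<inter> torus_orbit n x)"
    unfolding schubert_variety_def[of n \<pi>] by (intro closure_of_minimal closedin_closure_of)
  moreover have "x \<in> schubert_variety n \<pi>"
    unfolding x_def using cell_subset_variety flag_of_cell_matrix[OF u] by blast
  ultimately show ?thesis unfolding toric_iff by blast
qed

end

theorem mainTheorem1:
  fixes n :: nat and \<pi> :: "nat \<Rightarrow> nat"
  assumes "n \<ge> 1" and "\<pi> permutes {1..n}"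
  shows "(cyclomatic (inversion_graph n \<pi>) = 0 \<longleftrightarrow> forest (inversion_graph n \<pi>))
    \<and> (cyclomatic (inversion_graph n \<pi>) = 0 \<longleftrightarrow> \<not> (\<exists>ws. reduced_word n \<pi> ws \<and> has_repeated_letter ws))
    \<and> (cyclomatic (inversion_graph n \<pi>) = 0 \<longleftrightarrow> coxeter_length n \<pi> = reflection_length n \<pi>)
    \<and> (cyclomatic (inversion_graph n \<pi>) = 0 \<longleftrightarrow> \<pi> \<in> Av n {[3, 2, 1], [3, 4, 1, 2]})
    \<and> (cyclomatic (inversion_graph n \<pi>) = 0 \<longleftrightarrow> direct_sum_of_unimodal_cycles n \<pi>)
    \<and> (cyclomatic (inversion_graph n \<pi>) = 0 \<longleftrightarrow> toric n (schubert_variety n \<pi>))"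
proof -
  note \<pi> = assms(2)
  interpret schubert n \<pi> by unfold_locales (rule \<pi>)
  have forest: "cyclomatic (inversion_graph n \<pi>) = 0 \<longleftrightarrow> forest (inversion_graph n \<pi>)"
    using cyclomatic_zero_iff_forest[OF simple_inversion_graph] by (metis inversion_graph_eq)
  have "direct_sum_of_unimodal_cycles n \<pi>" if "cyclomatic (inversion_graph n \<pi>) = 0"
  proof -
    from that obtain ws where ws: "reduced_word n \<pi> ws" "distinct ws"
      using cyclomatic_zero_iff_word(1)[OF \<pi>] by blast
    then have "set ws \<subseteq> {1..<n}" "simple_word_perm ws = \<pi>"
      by (auto simp: reduced_word_def simple_word_def)
    then show ?thesis using distinct_word_direct_sum[OF _ ws(2)] by metis
  qed
  moreover have "\<pi> \<in> Av n {[3, 2, 1], [3, 4, 1, 2]}" if "direct_sum_of_unimodal_cycles n \<pi>"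
    by (rule interleaving_Av[OF \<pi> direct_sum_interleaving[OF that]])
  moreover note forest_iff_Av[OF \<pi>] cyclomatic_zero_iff_word(2)[OF \<pi>] cyclomatic_zero_iff_lengths[OF \<pi>]
    toric_imp_forest forest_imp_toric forest
  ultimately show ?thesis by argo
qed


end
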